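(* Let $\theta$ be an action of an inverse semigroup $S$ on a locally compact Hausdorff space $X$, and write $C_0(X)^{\mathrm{KS}}=E(S)\ltimes^{\mathrm{KS}}C_0(X)$. With the identification $$\mathrm{Sp}(C_0(X)^{\mathrm{KS}}_e)=\{\chi\in\mathrm{Sp}(C_0(X)^{\mathrm{KS}})\mid\chi|_{C_0(X)^{\mathrm{KS}}_e}\neq0\}\qquad(e\in E(S)),$$ the homeomorphism between $\mathrm{Sp}(C_0(X)^{\mathrm{KS}})$ and $X^{\mathrm{KS}}$ given by $\chi\mapsto\tau_\chi$, with inverse $\tau\mapsto\chi_\tau$, restricts to a homeomorphism between $\mathrm{Sp}(C_0(X)^{\mathrm{KS}}_e)$ and $X^{\mathrm{KS}}_e$ for each $e\in E(S)$. Define an isomorphism $\Phi_e\colon C_0(X)^{\mathrm{KS}}_e\to C_0(X^{\mathrm{KS}}_e)$ by $$\Phi_e(\delta_{e_0}\,g)(\tau)=\chi_\tau(\delta_{e_0}\,g)=g(\tau(e_0)),\qquad e_0\le e,\ g\in C_0(X_{e_0}),\ \tau\in X^{\mathrm{KS}}_e.$$ Then for each $s\in S$ and all $a\in C_0(X)^{\mathrm{KS}}_{s^*s}$, $$\Phi_{ss^*}(\alpha^{\mathrm{KS}}_s(a))=\Phi_{s^*s}(a)\circ\theta^{\mathrm{KS}}_{s^*}\quad\text{in }C_0(X^{\mathrm{KS}}_{ss^*}).$$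
   Context: An inverse semigroup is a semigroup $S$ in which every $s$ has a unique $s^*$ with $ss^*s=s$, $s^*ss^*=s^*$; $E(S)$ is its commutative subsemigroup of idempotents; $s\le t$ means $ts^*s=s$. An action $\theta$ of $S$ on a topological space $X$ is a semigroup homomorphism $s\mapsto\theta_s$ from $S$ to the inverse semigroup of partial bijections of $X$ (bijections between subsets, composed on the largest possible domain) such that, writing $X_e$ for the subset on which $\theta_e$ ($e\in E(S)$) is the identity (so $\theta_s$ is a bijection $X_{s^*s}\to X_{ss^*}$): each $X_e$ is open, each $\theta_s\colon X_{s^*s}\to X_{ss^*}$ is continuous, and $\bigcup_{e\in E(S)}X_e=X$. The space $X^{\mathrm{KS}}$: let $\widetilde{X_e}=X_e\sqcup\{\infty_e\}$ be the one-point compactification of $X_e$ (a point $\infty_e$ is added even when $X_e$ is compact). Let $\widetilde{X^{\mathrm{KS}}}$ be the set of $\tau\in\prod_{e\in E(S)}\widetilde{X_e}$ such that (1) if $e_1\le e_2$ and $\tau(e_1)\ne\infty_{e_1}$, then $\tau(e_2)=\tau(e_1)$; (2) if $\tau(e_1)\neq\infty_{e_1}$ and $\tau(e_2)\neq\infty_{e_2}$, then $\tau(e_1e_2)\neq\infty_{e_1e_2}$; with the topology induced from the product topology. Set $X^{\mathrm{KS}}=\widetilde{X^{\mathrm{KS}}}\setminus\{\infty\}$, $\infty=(\infty_e)_e$; it is locally compact Hausdorff. $S$ acts on $X^{\mathrm{KS}}$ by $X^{\mathrm{KS}}_e=\{\tau\in X^{\mathrm{KS}}\mid\tau(e)\ne\infty_e\}$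 and $\theta^{\mathrm{KS}}_s\colon X^{\mathrm{KS}}_{s^*s}\to X^{\mathrm{KS}}_{ss^*}$, $\theta^{\mathrm{KS}}_s(\tau)(e)=\theta_{es}(\tau(s^*es))$ if $\tau(s^*es)\neq\infty_{s^*es}$ and $\infty_e$ otherwise. Functions $g\in C_0(X_e)$ are extended to $\widetilde{X_e}$ by $g(\infty_e)=0$. The commutative C*-algebra $C_0(X)^{\mathrm{KS}}=E(S)\ltimes^{\mathrm{KS}}C_0(X)$: view $C_0(X_e)$ as an ideal of $C_0(X)$; on $\bigoplus_{e\in E(S)}C_0(X_e)$ (algebraic direct sum), with $\delta_e\,g$ the element having $g\in C_0(X_e)$ in the $e$-th component and $0$ elsewhere, define $(\delta_e g)(\delta_f h)=\delta_{ef}\,gh$ and $(\delta_e g)^*=\delta_e\,\overline g$; $E(S)\ltimes^{\mathrm{KS}}C_0(X)$ is the universal enveloping C*-algebra of this $*$-algebra. $\mathrm{Sp}$ denotes the space of characters (nonzero $*$-homomorphisms to $\mathbb C$) with the topology of pointwise convergence. There are mutually inverse homeomorphisms $\chi\mapsto\tau_\chi$, $\tau\mapsto\chi_\tau$ between $\mathrm{Sp}(C_0(X)^{\mathrm{KS}})$ and $X^{\mathrm{KS}}$ determined by $g(\tau_\chi(e))=\chi(\delta_e\,g)$ and $\chi_\tau(\delta_e\,g)=g(\tau(e))$ for $e\in E(S)$, $g\in C_0(X_e)$. The $S$-action $\alpha^{\mathrm{KS}}$ on $C_0(X)^{\mathrm{KS}}$: $C_0(X)^{\mathrm{KS}}_{e}$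 is the closed ideal $\overline{\mathrm{span}}\{\delta_{e_0}\,g\mid e_0\le e,\ g\in C_0(X_{e_0})\}$, and $\alpha^{\mathrm{KS}}_s\colon C_0(X)^{\mathrm{KS}}_{s^*s}\to C_0(X)^{\mathrm{KS}}_{ss^*}$ is the unique isomorphism with $\alpha^{\mathrm{KS}}_s(\delta_{e_0}\,g)=\delta_{se_0s^*}\,\alpha_s(g)$ for $e_0\le s^*s$, $g\in C_0(X_{e_0})$, where $\alpha_s\colon C_0(X_{s^*s})\to C_0(X_{ss^*})$, $\alpha_s(g)=g\circ\theta_{s^*}$. *)

theory Defs
  imports "HOL-Analysis.Analysis"
begin

class inverse_semigroup = semigroup_mult +
  assumes unique_generalized_inverse: "\<exists>!t. s * t * s = s \<and> t * s * t = t"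

definition inv_star :: "'s::inverse_semigroup \<Rightarrow> 's" ("_\<^sup>\<star>" [1000] 999) where
  "s\<^sup>\<star> = (THE t. s * t * s = s \<and> t * s * t = t)"

lemma inv_star: "s * s\<^sup>\<star> * s = s" "s\<^sup>\<star> * s * s\<^sup>\<star> = s\<^sup>\<star>"
  using theI'[OF unique_generalized_inverse[of s]] unfolding inv_star_def by blast+

definition idems :: "'s::inverse_semigroup set" where
  "idems = {e. e * e = e}"

definition natural_le :: "'s::inverse_semigroup \<Rightarrow> 's \<Rightarrow> bool" (infix "\<preceq>" 50) where
  "s \<preceq> t \<longleftrightarrow> t * s\<^sup>\<star> * s = s"

definition fix_dom :: "('s::inverse_semigroup \<Rightarrow> 'x \<rightharpoonup> 'x) \<Rightarrow> 's \<Rightarrow> 'x set" where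
  "fix_dom \<theta> e = {x. \<theta> e x = Some x}"

text \<open>Partial bijections of the space are injective partial maps, composed by \<open>\<circ>\<^sub>m\<close>, which is
  composition on the largest possible domain. The carrier of the semigroup is a whole type.\<close>

definition semigroup_action ::
    "'x topology \<Rightarrow> ('s::inverse_semigroup \<Rightarrow> 'x \<rightharpoonup> 'x) \<Rightarrow> bool" where
  "semigroup_action X \<theta> \<longleftrightarrow>
     (\<forall>s. dom (\<theta> s) \<subseteq> topspace X \<and> ran (\<theta> s) \<subseteq> topspace X \<and> inj_on (\<theta> s) (dom (\<theta> s))) \<and>
     (\<forall>s t. \<theta> (s * t) = \<theta> s \<circ>\<^sub>m \<theta> t) \<and>
     (\<forall>e\<in>idems. openin X (fix_dom \<theta> e)) \<and>
     (\<forall>s. continuous_map (subtopology X (fix_dom \<theta> (s\<^sup>\<star> * s)))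
            (subtopology X (fix_dom \<theta> (s * s\<^sup>\<star>))) (\<lambda>x. the (\<theta> s x))) \<and>
     (\<Union>e\<in>idems. fix_dom \<theta> e) = topspace X"

record 'a star_alg =
  carr :: "'a set"
  vzero :: 'a
  vadd :: "'a \<Rightarrow> 'a \<Rightarrow> 'a"
  vscale :: "complex \<Rightarrow> 'a \<Rightarrow> 'a"
  vmult :: "'a \<Rightarrow> 'a \<Rightarrow> 'a"
  vstar :: "'a \<Rightarrow> 'a"

record 'a normed_star_alg = "'a star_alg" +
  vnorm :: "'a \<Rightarrow> real"

definition vdiff :: "('a, 'm) star_alg_scheme \<Rightarrow> 'a \<Rightarrow> 'a \<Rightarrow> 'a" where
  "vdiff A a b = vadd A a (vscale A (-1) b)"

definition star_hom ::
    "('a, 'm) star_alg_scheme \<Rightarrow> ('b, 'n) star_alg_scheme \<Rightarrow> ('a \<Rightarrow> 'b) \<Rightarrow> bool" where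
  "star_hom A B f \<longleftrightarrow>
     (\<forall>a\<in>carr A. f a \<in> carr B) \<and>
     (\<forall>a\<in>carr A. \<forall>b\<in>carr A. f (vadd A a b) = vadd B (f a) (f b)) \<and>
     (\<forall>c. \<forall>a\<in>carr A. f (vscale A c a) = vscale B c (f a)) \<and>
     (\<forall>a\<in>carr A. \<forall>b\<in>carr A. f (vmult A a b) = vmult B (f a) (f b)) \<and>
     (\<forall>a\<in>carr A. f (vstar A a) = vstar B (f a))"

definition star_iso ::
    "('a, 'm) star_alg_scheme \<Rightarrow> ('b, 'n) star_alg_scheme \<Rightarrow> ('a \<Rightarrow> 'b) \<Rightarrow> bool" where
  "star_iso A B f \<longleftrightarrow> star_hom A B f \<and> bij_betw f (carr A) (carr B)"

inductive_set vspan :: "('a, 'm) star_alg_scheme \<Rightarrow> 'a set \<Rightarrow> 'a set" for A G where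
  zero: "vzero A \<in> vspan A G"
| gen: "g \<in> G \<Longrightarrow> g \<in> vspan A G"
| add: "a \<in> vspan A G \<Longrightarrow> b \<in> vspan A G \<Longrightarrow> vadd A a b \<in> vspan A G"
| scale: "a \<in> vspan A G \<Longrightarrow> vscale A c a \<in> vspan A G"

definition closed_vspan :: "('a, 'm) normed_star_alg_scheme \<Rightarrow> 'a set \<Rightarrow> 'a set" where
  "closed_vspan A G =
     {a \<in> carr A. \<forall>\<epsilon>>0. \<exists>b\<in>vspan A G. vnorm A (vdiff A a b) < \<epsilon>}"

definition complex_alg :: "complex star_alg" where
  "complex_alg = \<lparr>carr = UNIV, vzero = 0, vadd = (+), vscale = (*), vmult = (*), vstar = cnj\<rparr>"

definition characters :: "('a, 'm) star_alg_scheme \<Rightarrow> ('a \<Rightarrow> complex) set" where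
  "characters A =
     {\<xi> \<in> extensional (carr A). star_hom A complex_alg \<xi> \<and> (\<exists>a\<in>carr A. \<xi> a \<noteq> 0)}"

definition Sp :: "('a, 'm) star_alg_scheme \<Rightarrow> ('a \<Rightarrow> complex) topology" where
  "Sp A = subtopology (product_topology (\<lambda>_. euclidean) (carr A)) (characters A)"

text \<open>Functions on a space are total functions that are \<open>0\<close> off the space. For open \<open>U\<close> this makes
  \<open>C0 (subtopology X U)\<close> literally an ideal of \<open>C0 X\<close>.\<close>

definition C0 :: "'y topology \<Rightarrow> ('y \<Rightarrow> complex) set" where
  "C0 Y = {f. continuous_map Y euclidean f \<and> (\<forall>y. y \<notin> topspace Y \<longrightarrow> f y = 0) \<and>
              (\<forall>\<epsilon>>0. compactin Y {y \<in> topspace Y. \<epsilon> \<le> cmod (f y)})}"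

definition C0_alg :: "'y topology \<Rightarrow> ('y \<Rightarrow> complex) star_alg" where
  "C0_alg Y = \<lparr>carr = C0 Y, vzero = (\<lambda>_. 0), vadd = (\<lambda>f g y. f y + g y),
     vscale = (\<lambda>c f y. c * f y), vmult = (\<lambda>f g y. f y * g y), vstar = (\<lambda>f y. cnj (f y))\<rparr>"

definition zero_off :: "'y set \<Rightarrow> ('y \<Rightarrow> complex) \<Rightarrow> 'y \<Rightarrow> complex" where
  "zero_off U f = (\<lambda>y. if y \<in> U then f y else 0)"

text \<open>The value at a point of the one-point compactification, where \<open>None\<close> is the added point.\<close>

definition ext_inf :: "('y \<Rightarrow> complex) \<Rightarrow> 'y option \<Rightarrow> complex" where
  "ext_inf g p = (case p of None \<Rightarrow> 0 | Some y \<Rightarrow> g y)"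

definition cstar_seminorm :: "('a, 'm) star_alg_scheme \<Rightarrow> ('a \<Rightarrow> real) \<Rightarrow> bool" where
  "cstar_seminorm D p \<longleftrightarrow>
     (\<forall>a\<in>carr D. 0 \<le> p a) \<and>
     (\<forall>a\<in>carr D. \<forall>b\<in>carr D. p (vadd D a b) \<le> p a + p b) \<and>
     (\<forall>c. \<forall>a\<in>carr D. p (vscale D c a) = cmod c * p a) \<and>
     (\<forall>a\<in>carr D. \<forall>b\<in>carr D. p (vmult D a b) \<le> p a * p b) \<and>
     (\<forall>a\<in>carr D. p (vmult D (vstar D a) a) = (p a)\<^sup>2)"

text \<open>The C*-seminorms on \<open>D\<close> are exactly the functions \<open>a \<mapsto> \<parallel>\<phi> a\<parallel>\<close> for star-homomorphisms
  \<open>\<phi>\<close> of \<open>D\<close> into C*-algebras. So if their pointwise supremum is finite, it is the largest of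
  them, and the Hausdorff completion of \<open>D\<close> for it is the universal enveloping C*-algebra. (If it is
  infinite there is no enveloping C*-algebra, and \<open>SUP\<close> has no meaning.) The completion
  consists of the Cauchy sequences modulo sequences converging to \<open>0\<close>.\<close>

definition env_seminorm :: "('a, 'm) star_alg_scheme \<Rightarrow> 'a \<Rightarrow> real" where
  "env_seminorm D a = (SUP p\<in>{p. cstar_seminorm D p}. p a)"

definition env_seqs :: "('a, 'm) star_alg_scheme \<Rightarrow> (nat \<Rightarrow> 'a) set" where
  "env_seqs D = {x. (\<forall>n. x n \<in> carr D) \<and>
     (\<forall>\<epsilon>>0. \<exists>N. \<forall>m\<ge>N. \<forall>n\<ge>N. env_seminorm D (vdiff D (x m) (x n)) < \<epsilon>)}"

definition env_rel :: "('a, 'm) star_alg_scheme \<Rightarrow> ((nat \<Rightarrow> 'a) \<times> (nat \<Rightarrow> 'a)) set" where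
  "env_rel D = {(x, y). x \<in> env_seqs D \<and> y \<in> env_seqs D \<and>
     (\<lambda>n. env_seminorm D (vdiff D (x n) (y n))) \<longlonglongrightarrow> 0}"

definition envelope :: "('a, 'm) star_alg_scheme \<Rightarrow> (nat \<Rightarrow> 'a) set normed_star_alg" where
  "envelope D =
     \<lparr>carr = env_seqs D // env_rel D,
      vzero = env_rel D `` {\<lambda>_. vzero D},
      vadd = (\<lambda>P Q. \<Union>x\<in>P. \<Union>y\<in>Q. env_rel D `` {\<lambda>n. vadd D (x n) (y n)}),
      vscale = (\<lambda>c P. \<Union>x\<in>P. env_rel D `` {\<lambda>n. vscale D c (x n)}),
      vmult = (\<lambda>P Q. \<Union>x\<in>P. \<Union>y\<in>Q. env_rel D `` {\<lambda>n. vmult D (x n) (y n)}),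
      vstar = (\<lambda>P. \<Union>x\<in>P. env_rel D `` {\<lambda>n. vstar D (x n)}),
      vnorm = (\<lambda>P. THE r. \<forall>x\<in>P. (\<lambda>n. env_seminorm D (x n)) \<longlonglongrightarrow> r)\<rparr>"

definition env_embed :: "('a, 'm) star_alg_scheme \<Rightarrow> 'a \<Rightarrow> (nat \<Rightarrow> 'a) set" where
  "env_embed D a = env_rel D `` {\<lambda>_. a}"

abbreviation sub_space ::
    "'x topology \<Rightarrow> ('s::inverse_semigroup \<Rightarrow> 'x \<rightharpoonup> 'x) \<Rightarrow> 's \<Rightarrow> 'x topology" where
  "sub_space X \<theta> e \<equiv> subtopology X (fix_dom \<theta> e)"

definition XKS ::
    "'x topology \<Rightarrow> ('s::inverse_semigroup \<Rightarrow> 'x \<rightharpoonup> 'x) \<Rightarrow> ('s \<Rightarrow> 'x option) topology" where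
  "XKS X \<theta> =
     subtopology (product_topology (\<lambda>e. Alexandroff_compactification (sub_space X \<theta> e)) idems)
       {\<tau>. (\<forall>e1\<in>idems. \<forall>e2\<in>idems. e1 \<preceq> e2 \<and> \<tau> e1 \<noteq> None \<longrightarrow> \<tau> e2 = \<tau> e1) \<and>
           (\<forall>e1\<in>idems. \<forall>e2\<in>idems. \<tau> e1 \<noteq> None \<and> \<tau> e2 \<noteq> None \<longrightarrow> \<tau> (e1 * e2) \<noteq> None) \<and>
           \<tau> \<noteq> (\<lambda>e\<in>idems. None)}"

definition XKS_dom ::
    "'x topology \<Rightarrow> ('s::inverse_semigroup \<Rightarrow> 'x \<rightharpoonup> 'x) \<Rightarrow> 's \<Rightarrow> ('s \<Rightarrow> 'x option) set" where
  "XKS_dom X \<theta> e = {\<tau> \<in> topspace (XKS X \<theta>). \<tau> e \<noteq> None}"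

definition theta_KS ::
    "('s::inverse_semigroup \<Rightarrow> 'x \<rightharpoonup> 'x) \<Rightarrow> 's \<Rightarrow> ('s \<Rightarrow> 'x option) \<Rightarrow> 's \<Rightarrow> 'x option" where
  "theta_KS \<theta> s \<tau> =
     (\<lambda>e\<in>idems. case \<tau> (s\<^sup>\<star> * e * s) of None \<Rightarrow> None | Some x \<Rightarrow> \<theta> (e * s) x)"

definition delta :: "'s \<Rightarrow> ('x \<Rightarrow> complex) \<Rightarrow> 's \<Rightarrow> 'x \<Rightarrow> complex" where
  "delta e g = (\<lambda>f. if f = e then g else (\<lambda>_. 0))"

definition supp :: "('s \<Rightarrow> 'x \<Rightarrow> complex) \<Rightarrow> 's set" where
  "supp a = {e. a e \<noteq> (\<lambda>_. 0)}"

definition KS_direct_sum ::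
    "'x topology \<Rightarrow> ('s::inverse_semigroup \<Rightarrow> 'x \<rightharpoonup> 'x) \<Rightarrow> ('s \<Rightarrow> 'x \<Rightarrow> complex) star_alg" where
  "KS_direct_sum X \<theta> =
     \<lparr>carr = {a. finite (supp a) \<and> supp a \<subseteq> idems \<and> (\<forall>e\<in>idems. a e \<in> C0 (sub_space X \<theta> e))},
      vzero = (\<lambda>_ _. 0),
      vadd = (\<lambda>a b e x. a e x + b e x),
      vscale = (\<lambda>c a e x. c * a e x),
      vmult = (\<lambda>a b d x. \<Sum>(e, f)\<in>{(e, f) \<in> supp a \<times> supp b. e * f = d}. a e x * b f x),
      vstar = (\<lambda>a e x. cnj (a e x))\<rparr>"

lemma KS_direct_sum_mult_delta:
  "vmult (KS_direct_sum X \<theta>) (delta e g) (delta f h) = delta (e * f) (\<lambda>x. g x * h x)"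
proof (cases "g = (\<lambda>_. 0) \<or> h = (\<lambda>_. 0)")
  case True
  have "supp (delta e g) = {} \<or> supp (delta f h) = {}"
    using True by (auto simp: supp_def delta_def)
  then show ?thesis
    using True by (auto simp: KS_direct_sum_def delta_def fun_eq_iff)
next
  case False
  then have "supp (delta e g) = {e}" "supp (delta f h) = {f}"
    by (auto simp: supp_def delta_def fun_eq_iff)
  then have "{(e', f') \<in> supp (delta e g) \<times> supp (delta f h). e' * f' = d}
      = (if d = e * f then {(e, f)} else {})" for d
    by auto
  then show ?thesis
    by (auto simp: KS_direct_sum_def delta_def fun_eq_iff)
qed

lemma KS_direct_sum_star_delta:
  "vstar (KS_direct_sum X \<theta>) (delta e g) = delta e (\<lambda>x. cnj (g x))"
  by (auto simp: KS_direct_sum_def delta_def fun_eq_iff)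

type_synonym ('s, 'x) KS = "(nat \<Rightarrow> 's \<Rightarrow> 'x \<Rightarrow> complex) set"

definition C0_KS ::
    "'x topology \<Rightarrow> ('s::inverse_semigroup \<Rightarrow> 'x \<rightharpoonup> 'x) \<Rightarrow> ('s, 'x) KS normed_star_alg" where
  "C0_KS X \<theta> = envelope (KS_direct_sum X \<theta>)"

definition delta_KS ::
    "'x topology \<Rightarrow> ('s::inverse_semigroup \<Rightarrow> 'x \<rightharpoonup> 'x) \<Rightarrow> 's \<Rightarrow> ('x \<Rightarrow> complex) \<Rightarrow> ('s, 'x) KS" where
  "delta_KS X \<theta> e g = env_embed (KS_direct_sum X \<theta>) (delta e g)"

definition C0_KS_ideal ::
    "'x topology \<Rightarrow> ('s::inverse_semigroup \<Rightarrow> 'x \<rightharpoonup> 'x) \<Rightarrow> 's \<Rightarrow> ('s, 'x) KS normed_star_alg" where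
  "C0_KS_ideal X \<theta> e = (C0_KS X \<theta>)
     \<lparr>carr := closed_vspan (C0_KS X \<theta>)
        {delta_KS X \<theta> e0 g | e0 g. e0 \<in> idems \<and> e0 \<preceq> e \<and> g \<in> C0 (sub_space X \<theta> e0)}\<rparr>"

definition alpha ::
    "('s::inverse_semigroup \<Rightarrow> 'x \<rightharpoonup> 'x) \<Rightarrow> 's \<Rightarrow> ('x \<Rightarrow> complex) \<Rightarrow> 'x \<Rightarrow> complex" where
  "alpha \<theta> s g = zero_off (fix_dom \<theta> (s * s\<^sup>\<star>)) (\<lambda>x. g (the (\<theta> (s\<^sup>\<star>) x)))"

text \<open>In the following definitions, extensionality makes a map that is determined on its domain
  unique as a total function, so that \<open>THE\<close> applies.\<close>

definition alpha_KS ::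
    "'x topology \<Rightarrow> ('s::inverse_semigroup \<Rightarrow> 'x \<rightharpoonup> 'x) \<Rightarrow> 's \<Rightarrow> ('s, 'x) KS \<Rightarrow> ('s, 'x) KS" where
  "alpha_KS X \<theta> s = (THE \<alpha>. \<alpha> \<in> extensional (carr (C0_KS_ideal X \<theta> (s\<^sup>\<star> * s))) \<and>
     star_iso (C0_KS_ideal X \<theta> (s\<^sup>\<star> * s)) (C0_KS_ideal X \<theta> (s * s\<^sup>\<star>)) \<alpha> \<and>
     (\<forall>e0\<in>idems. e0 \<preceq> s\<^sup>\<star> * s \<longrightarrow> (\<forall>g\<in>C0 (sub_space X \<theta> e0).
        \<alpha> (delta_KS X \<theta> e0 g) = delta_KS X \<theta> (s * e0 * s\<^sup>\<star>) (alpha \<theta> s g))))"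

definition tau_of ::
    "'x topology \<Rightarrow> ('s::inverse_semigroup \<Rightarrow> 'x \<rightharpoonup> 'x) \<Rightarrow> (('s, 'x) KS \<Rightarrow> complex) \<Rightarrow>
     ('s \<Rightarrow> 'x option)" where
  "tau_of X \<theta> \<xi> = (THE \<tau>. \<tau> \<in> topspace (XKS X \<theta>) \<and>
     (\<forall>e\<in>idems. \<forall>g\<in>C0 (sub_space X \<theta> e). ext_inf g (\<tau> e) = \<xi> (delta_KS X \<theta> e g)))"

definition chi_of ::
    "'x topology \<Rightarrow> ('s::inverse_semigroup \<Rightarrow> 'x \<rightharpoonup> 'x) \<Rightarrow> ('s \<Rightarrow> 'x option) \<Rightarrow>
     (('s, 'x) KS \<Rightarrow> complex)" where
  "chi_of X \<theta> \<tau> = (THE \<xi>. \<xi> \<in> topspace (Sp (C0_KS X \<theta>)) \<and>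
     (\<forall>e\<in>idems. \<forall>g\<in>C0 (sub_space X \<theta> e). \<xi> (delta_KS X \<theta> e g) = ext_inf g (\<tau> e)))"

definition Sp_dom ::
    "'x topology \<Rightarrow> ('s::inverse_semigroup \<Rightarrow> 'x \<rightharpoonup> 'x) \<Rightarrow> 's \<Rightarrow> (('s, 'x) KS \<Rightarrow> complex) set" where
  "Sp_dom X \<theta> e =
     {\<xi> \<in> topspace (Sp (C0_KS X \<theta>)). \<exists>a\<in>carr (C0_KS_ideal X \<theta> e). \<xi> a \<noteq> 0}"

definition Phi ::
    "'x topology \<Rightarrow> ('s::inverse_semigroup \<Rightarrow> 'x \<rightharpoonup> 'x) \<Rightarrow> 's \<Rightarrow>
     ('s, 'x) KS \<Rightarrow> ('s \<Rightarrow> 'x option) \<Rightarrow> complex" where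
  "Phi X \<theta> e = (THE \<Phi>. \<Phi> \<in> extensional (carr (C0_KS_ideal X \<theta> e)) \<and>
     star_iso (C0_KS_ideal X \<theta> e) (C0_alg (subtopology (XKS X \<theta>) (XKS_dom X \<theta> e))) \<Phi> \<and>
     (\<forall>e0\<in>idems. e0 \<preceq> e \<longrightarrow> (\<forall>g\<in>C0 (sub_space X \<theta> e0). \<forall>\<tau>\<in>XKS_dom X \<theta> e.
        \<Phi> (delta_KS X \<theta> e0 g) \<tau> = ext_inf g (\<tau> e0))))"

end

theory Submission
  imports Defs
begin

text \<open>The algebra \<open>C0_KS\<close> is the enveloping C*-algebra of the direct sum \<open>D\<close> of the \<open>C0 (X\<^sub>e)\<close>. An element
  \<open>a = \<Sum>e. \<delta>\<^sub>e a\<^sub>e\<close> of \<open>D\<close> defines a function \<open>ev a\<close> on \<open>XKS\<close> by \<open>ev a \<tau> = \<Sum>e. a\<^sub>e (\<tau> e)\<close>. The whole statement follows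
  from the fact that \<open>ev\<close> induces an isometric isomorphism of \<open>C0_KS\<close> with the algebra \<open>C0\<close> of the locally
  compact Hausdorff space \<open>XKS\<close>.

  The conditions defining \<open>XKS\<close> say that \<open>\<delta>\<^sub>e g \<mapsto> g (\<tau> e)\<close> is multiplicative
  (\<open>KS_tilde_iff_multiplicative\<close>). So \<open>ev\<close> is a homomorphism, and \<open>XKS\<close> together with the point at infinity is a
  closed subspace of a product of compact spaces. The image of \<open>ev\<close> is dense by the Stone-Weierstrass theorem
  (\<open>C0_Stone_Weierstrass\<close>, \<open>dense_ideal\<close>).

  The enveloping seminorm of \<open>a\<close> is the supremum norm of \<open>ev a\<close> (\<open>env_seminorm_eq\<close>). It is at least that, as
  the supremum norm pulls back to a C*-seminorm. For the converse, let \<open>p\<close> be a C*-seminorm on \<open>D\<close>. On each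
  summand it is bounded by the supremum norm (\<open>cstar_seminorm_C0_le_unorm\<close>), so \<open>p a \<le> \<Sum>e. \<parallel>a\<^sub>e\<parallel>\<close>. If \<open>a\<close> is
  supported in a finite set \<open>G\<close> of idempotents, its coefficients are combinations of values of \<open>ev a\<close>, by a
  triangular system of equations (\<open>coefficient_bound\<close>). Hence \<open>p a \<le> C \<parallel>ev a\<parallel>\<close> with \<open>C\<close> depending only on \<open>G\<close>.
  If \<open>G\<close> is closed under products, this estimate also applies to \<open>a\<^sup>* a\<close> and its iterates; because this
  operation squares both sides, the constant can be dropped.

  Gelfand duality for \<open>C0\<close> of a locally compact Hausdorff space (\<open>C0_character_is_evaluation\<close>,
  \<open>homeomorphic_map_spectrum\<close>) then identifies the characters of \<open>C0_KS\<close> with the points of \<open>XKS\<close>. By density,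
  the closed ideal of \<open>e\<close> corresponds to the functions vanishing outside the open set \<open>XKS_dom X \<theta> e\<close>
  (\<open>carr_J\<close>), which gives the spectrum of the ideal and the isomorphism \<open>Phi\<close>. Finally, composition with the
  action on \<open>XKS\<close> agrees with the transport of functions by \<open>\<theta>\<close> on generators (\<open>pullback_delta\<close>). By density
  it maps the one ideal onto the other, and by uniqueness it is \<open>alpha_KS\<close>.\<close>

section \<open>Functions vanishing at infinity\<close>

lemma ext_inf_simps [simp]: "ext_inf g None = 0" "ext_inf g (Some x) = g x"
  by (auto simp: ext_inf_def)

lemma ext_inf_linear:
  "ext_inf (\<lambda>x. g x + h x) p = ext_inf g p + ext_inf h p"
  "ext_inf (\<lambda>x. c * g x) p = c * ext_inf g p"
  "ext_inf (\<lambda>x. cnj (g x)) p = cnj (ext_inf g p)"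
  "ext_inf (\<lambda>_. 0) p = 0"
  by (cases p; simp)+

lemma ext_inf_sum: "ext_inf (\<lambda>x. \<Sum>i\<in>I. g i x) p = (\<Sum>i\<in>I. ext_inf (g i) p)"
  by (cases p) simp_all

lemma continuous_map_compose_euclidean:
  assumes "continuous_map X euclidean f" "continuous_on UNIV h"
  shows "continuous_map X euclidean (\<lambda>x. h (f x))"
  using continuous_map_compose[OF assms(1), of euclidean h] assms(2) by (simp add: o_def)

lemma continuous_map_mult_complex:
  fixes f g :: "'a \<Rightarrow> complex"
  assumes "continuous_map X euclidean f" "continuous_map X euclidean g"
  shows "continuous_map X euclidean (\<lambda>x. f x * g x)"
  using assms by (simp add: continuous_map_atin tendsto_mult)

text \<open>A closed set avoiding \<open>0\<close> has its preimage in a level set \<open>\<bar>f\<bar> \<ge> e\<close>, so compactness of the level sets is exactly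
  continuity of the extension at the added point.\<close>

lemma C0_iff_continuous_Alexandroff:
  assumes "Hausdorff_space Y"
  shows "f \<in> C0 Y \<longleftrightarrow> (\<forall>y. y \<notin> topspace Y \<longrightarrow> f y = 0) \<and>
           continuous_map (Alexandroff_compactification Y) euclidean (ext_inf f)"
  (is "_ \<longleftrightarrow> ?Z \<and> ?C")
proof (intro iffI conjI)
  let ?A = "Alexandroff_compactification Y"
  assume f: "f \<in> C0 Y"
  then show ?Z by (auto simp: C0_def)
  have cf: "continuous_map Y euclidean f"
    using f by (auto simp: C0_def)
  show ?C
    unfolding continuous_map_closedin
  proof (intro conjI allI impI)
    fix C :: "complex set" assume "closedin euclidean C"
    then have C: "closed C" by simp
    have cl: "closedin Y {y \<in> topspace Y. f y \<in> C}"
      using cf C by (auto simp: continuous_map_closedin)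
    show "closedin ?A {p \<in> topspace ?A. ext_inf f p \<in> C}"
    proof (cases "0 \<in> C")
      case True
      then have "{p \<in> topspace ?A. ext_inf f p \<in> C}
          = topspace ?A - Some ` (topspace Y - {y \<in> topspace Y. f y \<in> C})"
        by (auto simp: image_iff)
      then show ?thesis
        unfolding closedin_Alexandroff_compactification using openin_diff[OF openin_topspace cl] by blast
    next
      case False
      then have "\<exists>e>0. ball 0 e \<subseteq> - C"
        using C open_contains_ball[of "- C"] by (simp add: open_Compl)
      then obtain e where e: "e > 0" "\<And>z. z \<in> C \<Longrightarrow> e \<le> cmod z"
        by (metis ComplD dist_0_norm linorder_not_less mem_ball subsetD)
      have "{y \<in> topspace Y. f y \<in> C} \<subseteq> {y \<in> topspace Y. e \<le> cmod (f y)}"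
        using e by auto
      moreover have "compactin Y {y \<in> topspace Y. e \<le> cmod (f y)}"
        using f e by (simp add: C0_def)
      ultimately have "compactin Y {y \<in> topspace Y. f y \<in> C}"
        using cl by (rule_tac closed_compactin)
      moreover have "{p \<in> topspace ?A. ext_inf f p \<in> C} = Some ` {y \<in> topspace Y. f y \<in> C}"
        using False by (auto simp: image_iff)
      ultimately show ?thesis using cl by simp
    qed
  qed auto
next
  let ?A = "Alexandroff_compactification Y"
  assume f: "?Z \<and> ?C"
  have "continuous_map Y euclidean f"
    using continuous_map_compose[OF continuous_map_Some, of Y euclidean "ext_inf f"] f
    by (simp add: o_def)
  moreover have "compactin Y {y \<in> topspace Y. e \<le> cmod (f y)}" if "e > 0" for e
  proof -
    have "continuous_map ?A euclideanreal (\<lambda>p. cmod (ext_inf f p))"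
      using f by (intro continuous_map_norm) auto
    then have "closedin ?A {p \<in> topspace ?A. cmod (ext_inf f p) \<in> {e..}}"
      by (rule closedin_continuous_map_preimage) simp
    moreover have "{p \<in> topspace ?A. cmod (ext_inf f p) \<in> {e..}}
        = Some ` {y \<in> topspace Y. e \<le> cmod (f y)}"
      using that by (auto simp: image_iff)
    ultimately show ?thesis
      by simp
  qed
  ultimately show "f \<in> C0 Y"
    using f by (auto simp: C0_def)
qed

lemma C0_zero: "(\<lambda>_. 0) \<in> C0 Y"
  by (auto simp: C0_def)

text \<open>A level set of \<open>f\<close> is a closed subset of a level set of \<open>g\<close>, which is compact.\<close>

lemma C0_dominated:
  assumes g: "g \<in> C0 Y" and f: "continuous_map Y euclidean f"
    and le: "\<And>y. cmod (f y) \<le> c * cmod (g y)"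
  shows "f \<in> C0 Y"
proof -
  have "f y = 0" if "y \<notin> topspace Y" for y
    using le[of y] g that by (auto simp: C0_def)
  moreover have "compactin Y {y \<in> topspace Y. e \<le> cmod (f y)}" if "e > 0" for e
  proof (rule closed_compactin)
    define c' where "c' = max c 1"
    have c': "c' > 0" "c \<le> c'" by (auto simp: c'_def)
    have "continuous_map Y euclideanreal (\<lambda>p. cmod (f p))"
      using f by (intro continuous_map_norm) auto
    then have "closedin Y {p \<in> topspace Y. cmod (f p) \<in> {e..}}"
      by (rule closedin_continuous_map_preimage) simp
    then show "closedin Y {y \<in> topspace Y. e \<le> cmod (f y)}" by simp
    show "compactin Y {y \<in> topspace Y. e / c' \<le> cmod (g y)}"
      using g that c' by (auto simp: C0_def)
    have "e / c' \<le> cmod (g y)" if "e \<le> cmod (f y)" for y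
    proof -
      have "e \<le> c * cmod (g y)" using le[of y] that by simp
      also have "\<dots> \<le> c' * cmod (g y)" using c' by (intro mult_right_mono) auto
      finally show ?thesis using c' by (simp add: field_simps)
    qed
    then show "{y \<in> topspace Y. e \<le> cmod (f y)} \<subseteq> {y \<in> topspace Y. e / c' \<le> cmod (g y)}"
      by auto
  qed
  ultimately show ?thesis using f by (auto simp: C0_def)
qed

lemma C0_continuous: "f \<in> C0 Y \<Longrightarrow> continuous_map Y euclidean f"
  and C0_off: "f \<in> C0 Y \<Longrightarrow> y \<notin> topspace Y \<Longrightarrow> f y = 0"
  by (auto simp: C0_def)

lemma C0_compact: "f \<in> C0 Y \<Longrightarrow> e > 0 \<Longrightarrow> compactin Y {y \<in> topspace Y. e \<le> cmod (f y)}"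
  by (simp add: C0_def)

lemma C0_bounded:
  assumes "f \<in> C0 Y" shows "bdd_above (range (\<lambda>y. cmod (f y)))"
proof -
  let ?K = "{y \<in> topspace Y. 1 \<le> cmod (f y)}"
  have "compactin Y ?K"
    using assms by (auto simp: C0_def)
  then have "compactin euclidean (f ` ?K)"
    using C0_continuous[OF assms] image_compactin by blast
  then have "bounded (f ` ?K)"
    using compact_imp_bounded by simp
  then obtain B where B: "\<forall>z\<in>f ` ?K. cmod z \<le> B"
    unfolding bounded_iff ..
  have "cmod (f y) \<le> max 1 B" for y
  proof (cases "y \<in> ?K")
    case True
    then have "cmod (f y) \<le> B" using B by blast
    then show ?thesis by simp
  next
    case False
    then have "cmod (f y) \<le> 1" using C0_off[OF assms, of y] by force
    then show ?thesis by simp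
  qed
  then show ?thesis by (rule bdd_aboveI2)
qed

lemma C0_scale:
  assumes "f \<in> C0 Y" shows "(\<lambda>y. c * f y) \<in> C0 Y"
proof (rule C0_dominated[OF assms])
  show "continuous_map Y euclidean (\<lambda>y. c * f y)"
    using C0_continuous[OF assms] by (intro continuous_map_mult_complex) auto
  show "cmod (c * f y) \<le> cmod c * cmod (f y)" for y by (simp add: norm_mult)
qed

lemma C0_cnj:
  assumes "f \<in> C0 Y" shows "(\<lambda>y. cnj (f y)) \<in> C0 Y"
proof (rule C0_dominated[OF assms])
  show "continuous_map Y euclidean (\<lambda>y. cnj (f y))"
    using C0_continuous[OF assms]
    by (rule continuous_map_compose_euclidean) (auto intro: continuous_intros)
  show "cmod (cnj (f y)) \<le> 1 * cmod (f y)" for y by simp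
qed

lemma C0_multiplier:
  assumes f: "f \<in> C0 Y" and g: "continuous_map Y euclidean g" "\<And>y. y \<in> topspace Y \<Longrightarrow> cmod (g y) \<le> B"
  shows "(\<lambda>y. g y * f y) \<in> C0 Y"
proof (rule C0_dominated[OF f])
  show "continuous_map Y euclidean (\<lambda>y. g y * f y)"
    using C0_continuous[OF f] g by (intro continuous_map_mult_complex) auto
  show "cmod (g y * f y) \<le> B * cmod (f y)" for y
    using g(2)[of y] C0_off[OF f, of y] by (cases "y \<in> topspace Y") (auto simp: norm_mult mult_right_mono)
qed

lemma C0_mult:
  assumes "f \<in> C0 Y" "g \<in> C0 Y" shows "(\<lambda>y. f y * g y) \<in> C0 Y"
proof -
  obtain B where "\<And>y. cmod (f y) \<le> B"
    using C0_bounded[OF assms(1)] by (auto simp: bdd_above_def)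
  then show ?thesis
    using C0_multiplier[OF assms(2) C0_continuous[OF assms(1)]] by auto
qed

lemma C0_add:
  assumes "f \<in> C0 Y" "g \<in> C0 Y" shows "(\<lambda>y. f y + g y) \<in> C0 Y"
proof -
  have c: "continuous_map Y euclidean (\<lambda>y. f y + g y)"
    using assms by (intro continuous_map_add C0_continuous)
  have "compactin Y {y \<in> topspace Y. e \<le> cmod (f y + g y)}" if "e > 0" for e
  proof (rule closed_compactin)
    have "continuous_map Y euclideanreal (\<lambda>y. cmod (f y + g y))"
      using c by (intro continuous_map_norm) auto
    then have "closedin Y {p \<in> topspace Y. cmod (f p + g p) \<in> {e..}}"
      by (rule closedin_continuous_map_preimage) simp
    then show "closedin Y {y \<in> topspace Y. e \<le> cmod (f y + g y)}" by simp
    have "e / 2 \<le> cmod (f y) \<or> e / 2 \<le> cmod (g y)" if "e \<le> cmod (f y + g y)" for y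
      using that norm_triangle_ineq[of "f y" "g y"] by linarith
    then show "{y \<in> topspace Y. e \<le> cmod (f y + g y)} \<subseteq>
        {y \<in> topspace Y. e / 2 \<le> cmod (f y)} \<union> {y \<in> topspace Y. e / 2 \<le> cmod (g y)}"
      by auto
    show "compactin Y ({y \<in> topspace Y. e / 2 \<le> cmod (f y)} \<union> {y \<in> topspace Y. e / 2 \<le> cmod (g y)})"
      using assms that by (intro compactin_Un C0_compact) auto
  qed
  then show ?thesis using assms c by (auto simp: C0_def)
qed

lemma C0_diff:
  assumes "f \<in> C0 Y" "g \<in> C0 Y" shows "(\<lambda>y. f y - g y) \<in> C0 Y"
  using C0_add[OF assms(1) C0_scale[OF assms(2), of "-1"]] by simp

lemma C0_sum:
  assumes "\<And>i. i \<in> I \<Longrightarrow> f i \<in> C0 Y" shows "(\<lambda>y. \<Sum>i\<in>I. f i y) \<in> C0 Y"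
  using assms by (induction I rule: infinite_finite_induct) (auto simp: C0_zero intro: C0_add)

text \<open>Extension by the value \<open>0\<close> makes uniform limits in \<open>C0 Y\<close> a question about continuous
  functions on a compact space.\<close>

lemma C0_uniform_limit:
  assumes Y: "Hausdorff_space Y"
    and ap: "\<And>e. e > 0 \<Longrightarrow> \<exists>g\<in>C0 Y. \<forall>y. cmod (f y - g y) < e"
  shows "f \<in> C0 Y"
  unfolding C0_iff_continuous_Alexandroff[OF Y]
proof (intro conjI allI impI)
  let ?A = "Alexandroff_compactification Y"
  fix y assume y: "y \<notin> topspace Y"
  show "f y = 0"
  proof (rule ccontr)
    assume "f y \<noteq> 0"
    then obtain g where "g \<in> C0 Y" "cmod (f y - g y) < cmod (f y)"
      using ap[of "cmod (f y)"] by auto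
    then show False using y C0_off[of g Y y] by auto
  qed
next
  let ?A = "Alexandroff_compactification Y"
  have "\<exists>g\<in>C0 Y. \<forall>y. cmod (f y - g y) < 1 / real (Suc n)" for n
    using ap by simp
  then obtain g where g: "\<And>n. g n \<in> C0 Y" "\<And>n y. cmod (f y - g n y) < 1 / real (Suc n)"
    by metis
  have "continuous_map ?A Met_TC.mtopology (ext_inf f)"
  proof (rule Met_TC.continuous_map_uniform_limit)
    show "\<forall>\<^sub>F n in sequentially. continuous_map ?A Met_TC.mtopology (ext_inf (g n))"
      using g(1) by (simp add: C0_iff_continuous_Alexandroff[OF Y])
    fix e :: real assume e: "0 < e"
    have "\<forall>\<^sub>F n in sequentially. 1 / real (Suc n) < e"
      using LIMSEQ_inverse_real_of_nat e by (simp add: order_tendsto_iff inverse_eq_divide)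
    then show "\<forall>\<^sub>F n in sequentially. \<forall>x\<in>topspace ?A. ext_inf f x \<in> UNIV \<and> dist (ext_inf (g n) x) (ext_inf f x) < e"
    proof eventually_elim
      case (elim n)
      have "dist (ext_inf (g n) x) (ext_inf f x) < e" for x
        using g(2)[of _ n] elim e
        by (cases x) (auto simp: dist_norm norm_minus_commute intro: less_trans)
      then show ?case by auto
    qed
  qed auto
  then show "continuous_map ?A euclidean (ext_inf f)" by simp
qed

text \<open>A level set \<open>\<bar>f\<bar> \<ge> e\<close> that is compact in \<open>U\<close> is closed in \<open>Y\<close>; so the extension of \<open>f\<close> by \<open>0\<close> is small
  near the points outside \<open>U\<close>, and hence continuous.\<close>

lemma C0_open_subspace:
  assumes Y: "Hausdorff_space Y" and U: "openin Y U"
  shows "C0 (subtopology Y U) = {f \<in> C0 Y. \<forall>y. y \<notin> U \<longrightarrow> f y = 0}"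
proof (intro set_eqI iffI)
  fix f assume f: "f \<in> C0 (subtopology Y U)"
  have UY: "U \<subseteq> topspace Y" using U openin_subset by auto
  have off: "f y = 0" if "y \<notin> U" for y
    using C0_off[OF f] UY that by auto
  have comp: "compactin Y {y \<in> topspace Y. e \<le> cmod (f y)}" if "e > 0" for e
  proof -
    have "compactin (subtopology Y U) {y \<in> topspace (subtopology Y U). e \<le> cmod (f y)}"
      using f that by (rule C0_compact)
    moreover have "y \<in> U" if "e \<le> cmod (f y)" for y
      using off[of y] that \<open>e > 0\<close> by (cases "y \<in> U") auto
    then have "{y \<in> topspace (subtopology Y U). e \<le> cmod (f y)} = {y \<in> topspace Y. e \<le> cmod (f y)}"
      using UY by auto
    ultimately show ?thesis by (simp add: compactin_subtopology)
  qed
  have "continuous_map Y euclidean f"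
    unfolding continuous_map_def
  proof (intro conjI allI impI)
    fix V :: "complex set" assume "openin euclidean V"
    then have V: "open V" by simp
    have "openin (subtopology Y U) {y \<in> topspace (subtopology Y U). f y \<in> V}"
      using C0_continuous[OF f] V by (auto simp: continuous_map_def)
    then have o: "openin Y {y \<in> U. f y \<in> V}"
      using U UY by (simp add: openin_open_subtopology inf_absorb2)
    show "openin Y {y \<in> topspace Y. f y \<in> V}"
    proof (cases "0 \<in> V")
      case True
      then have "\<exists>e>0. ball 0 e \<subseteq> V"
        using V open_contains_ball[of V] by simp
      then obtain e where e: "e > 0" "\<And>z. cmod z < e \<Longrightarrow> z \<in> V"
        by (metis dist_0_norm mem_ball subsetD)
      have "closedin Y {y \<in> topspace Y. e \<le> cmod (f y)}"
        using comp[OF e(1)] Y compactin_imp_closedin by blast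
      then have "openin Y (topspace Y - {y \<in> topspace Y. e \<le> cmod (f y)})" by blast
      then have "openin Y ((topspace Y - {y \<in> topspace Y. e \<le> cmod (f y)}) \<union> {y \<in> U. f y \<in> V})"
        using o by blast
      moreover have A: "e \<le> cmod (f y)" if "f y \<notin> V" for y
        using contrapos_nn[OF that e(2)] by (rule leI)
      have B: "y \<in> U" if "e \<le> cmod (f y)" for y
        using off[of y] that e(1) by (cases "y \<in> U") auto
      have "(topspace Y - {y \<in> topspace Y. e \<le> cmod (f y)}) \<union> {y \<in> U. f y \<in> V}
         = {y \<in> topspace Y. f y \<in> V}"
        apply (intro set_eqI)
        subgoal for x using A[of x] B[of x] UY by (cases "e \<le> cmod (f x)") auto
        done
      ultimately show ?thesis by simp
    next
      case False
      then have "y \<in> U" if "f y \<in> V" for y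
        using off[of y] that by (cases "y \<in> U") auto
      then have "{y \<in> topspace Y. f y \<in> V} = {y \<in> U. f y \<in> V}" using UY by auto
      then show ?thesis using o by simp
    qed
  qed auto
  then show "f \<in> {f \<in> C0 Y. \<forall>y. y \<notin> U \<longrightarrow> f y = 0}"
    using comp off subsetD[OF UY] by (auto simp: C0_def)
next
  fix f assume f: "f \<in> {f \<in> C0 Y. \<forall>y. y \<notin> U \<longrightarrow> f y = 0}"
  have UY: "U \<subseteq> topspace Y" using U openin_subset by auto
  have "compactin (subtopology Y U) {y \<in> topspace (subtopology Y U). e \<le> cmod (f y)}" if "e > 0" for e
  proof -
    have "y \<in> U" if "e \<le> cmod (f y)" for y
      using f that \<open>e > 0\<close> by (cases "y \<in> U") auto
    then have "{y \<in> topspace (subtopology Y U). e \<le> cmod (f y)} = {y \<in> topspace Y. e \<le> cmod (f y)}"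
      and "{y \<in> topspace Y. e \<le> cmod (f y)} \<subseteq> U"
      using UY by auto
    moreover have "compactin Y {y \<in> topspace Y. e \<le> cmod (f y)}"
      using f that by (simp add: C0_compact)
    ultimately show ?thesis by (simp add: compactin_subtopology)
  qed
  then show "f \<in> C0 (subtopology Y U)"
    using f by (auto simp: C0_def continuous_map_from_subtopology)
qed

text \<open>Cut off by \<open>0\<close> outside a neighbourhood of \<open>y\<close> with compact closure in \<open>U\<close>, using that locally compact
  Hausdorff spaces are completely regular.\<close>

lemma C0_bump:
  assumes Y: "locally_compact_space Y" "Hausdorff_space Y" and U: "openin Y U" "y \<in> U"
  obtains f where "f \<in> C0 Y" "f y = 1" "\<And>z. z \<notin> U \<Longrightarrow> f z = 0"
proof -
  have "neighbourhood_base_of (compactin Y) Y"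
    using Y locally_compact_space_neighbourhood_base by blast
  then obtain V K where VK: "openin Y V" "compactin Y K" "y \<in> V" "V \<subseteq> K" "K \<subseteq> U"
    using U unfolding neighbourhood_base_of by meson
  have cr: "completely_regular_space Y"
    using Y locally_compact_Hausdorff_imp_regular_space
      locally_compact_regular_imp_completely_regular_space by blast
  then obtain f where f: "continuous_map Y euclideanreal f" "f y = 0" "f ` (topspace Y - V) \<subseteq> {1}"
    using VK unfolding completely_regular_space_alt' by meson
  define g where "g = (\<lambda>z. if z \<in> topspace Y then complex_of_real (1 - f z) else 0)"
  have 1: "continuous_map Y euclidean (\<lambda>z. complex_of_real (1 - f z))"
    using f(1) by (rule continuous_map_compose_euclidean) (auto intro: continuous_intros)
  then have 2: "continuous_map Y euclidean g"
    by (rule continuous_map_eq) (auto simp: g_def)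
  have gV: "g z = 0" if "z \<notin> V" for z
    using f(3) that by (auto simp: g_def)
  have "compactin Y {y \<in> topspace Y. e \<le> cmod (g y)}" if "e > 0" for e
  proof (rule closed_compactin[OF VK(2)])
    have "y \<in> V" if "e \<le> cmod (g y)" for y
      using gV[of y] that \<open>e > 0\<close> by (cases "y \<in> V") auto
    then show "{y \<in> topspace Y. e \<le> cmod (g y)} \<subseteq> K"
      using VK by auto
    have "continuous_map Y euclideanreal (\<lambda>y. cmod (g y))"
      using 2 by (intro continuous_map_norm) auto
    then have "closedin Y {p \<in> topspace Y. cmod (g p) \<in> {e..}}"
      by (rule closedin_continuous_map_preimage) simp
    then show "closedin Y {y \<in> topspace Y. e \<le> cmod (g y)}" by simp
  qed
  then have "g \<in> C0 Y"
    using 2 by (auto simp: C0_def g_def)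
  moreover have "y \<in> topspace Y" using U openin_subset by auto
  then have "g y = 1" using f by (simp add: g_def)
  moreover have "\<And>z. z \<notin> U \<Longrightarrow> g z = 0" using gV VK by blast
  ultimately show ?thesis using that by blast
qed

section \<open>C*-seminorms and characters of function algebras\<close>

definition unorm :: "('y \<Rightarrow> complex) \<Rightarrow> real" where
  "unorm f = (SUP y. cmod (f y))"

lemma unorm_upper: "f \<in> C0 Y \<Longrightarrow> cmod (f y) \<le> unorm f"
  unfolding unorm_def by (rule cSUP_upper[OF UNIV_I C0_bounded])

lemma unorm_least: "(\<And>y. cmod (f y) \<le> c) \<Longrightarrow> unorm f \<le> c"
  unfolding unorm_def by (rule cSUP_least) auto

lemma unorm_nonneg: "f \<in> C0 Y \<Longrightarrow> 0 \<le> unorm f"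
  using unorm_upper[of f Y] norm_ge_zero order_trans by blast

lemma C0_alg_simps [simp]:
  "carr (C0_alg Y) = C0 Y" "vzero (C0_alg Y) = (\<lambda>_. 0)"
  "vadd (C0_alg Y) f g = (\<lambda>y. f y + g y)" "vscale (C0_alg Y) c f = (\<lambda>y. c * f y)"
  "vmult (C0_alg Y) f g = (\<lambda>y. f y * g y)" "vstar (C0_alg Y) f = (\<lambda>y. cnj (f y))"
  by (auto simp: C0_alg_def)

lemma complex_alg_simps [simp]:
  "carr complex_alg = UNIV" "vzero complex_alg = 0" "vadd complex_alg a b = a + b"
  "vscale complex_alg c a = c * a" "vmult complex_alg a b = a * b" "vstar complex_alg a = cnj a"
  by (auto simp: complex_alg_def)

lemma cstar_seminorm_unorm: "cstar_seminorm (C0_alg Y) unorm"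
  unfolding cstar_seminorm_def C0_alg_simps
proof (intro conjI ballI allI)
  fix f g assume f: "f \<in> C0 Y" and g: "g \<in> C0 Y"
  show "0 \<le> unorm f" using f by (rule unorm_nonneg)
  show "unorm (\<lambda>y. f y + g y) \<le> unorm f + unorm g"
    by (intro unorm_least norm_triangle_le add_mono unorm_upper[OF f] unorm_upper[OF g])
  show "unorm (\<lambda>y. f y * g y) \<le> unorm f * unorm g"
    unfolding norm_mult
    by (intro unorm_least, subst norm_mult)
      (intro mult_mono unorm_upper[OF f] unorm_upper[OF g] unorm_nonneg[OF f] norm_ge_zero)
  show "unorm (\<lambda>y. cnj (f y) * f y) = (unorm f)\<^sup>2"
  proof (rule antisym)
    show "unorm (\<lambda>y. cnj (f y) * f y) \<le> (unorm f)\<^sup>2"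
      by (intro unorm_least) (simp add: norm_mult flip: power2_eq_square, intro power_mono unorm_upper[OF f], simp)
    have "unorm f \<le> sqrt (unorm (\<lambda>y. cnj (f y) * f y))"
    proof (rule unorm_least)
      fix y
      have "(cmod (f y))\<^sup>2 \<le> unorm (\<lambda>y. cnj (f y) * f y)"
        using unorm_upper[OF C0_mult[OF C0_cnj[OF f] f], of y] by (simp add: norm_mult power2_eq_square)
      then show "cmod (f y) \<le> sqrt (unorm (\<lambda>y. cnj (f y) * f y))"
        by (rule real_le_rsqrt)
    qed
    then show "(unorm f)\<^sup>2 \<le> unorm (\<lambda>y. cnj (f y) * f y)"
      using unorm_nonneg[OF f] unorm_nonneg[OF C0_mult[OF C0_cnj[OF f] f]]
      by (metis abs_of_nonneg real_sqrt_abs real_sqrt_le_iff)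
  qed
next
  fix c f assume f: "f \<in> C0 Y"
  have le: "unorm (\<lambda>y. c * f y) \<le> cmod c * unorm f" if "f \<in> C0 Y" for c and f :: "'a \<Rightarrow> complex"
    by (intro unorm_least, subst norm_mult) (intro mult_left_mono unorm_upper[OF that] norm_ge_zero)
  show "unorm (\<lambda>y. c * f y) = cmod c * unorm f"
  proof (cases "c = 0")
    case True
    then show ?thesis by (simp add: unorm_def)
  next
    case False
    have "unorm (\<lambda>y. inverse c * (c * f y)) \<le> cmod (inverse c) * unorm (\<lambda>y. c * f y)"
      by (rule le[OF C0_scale[OF f]])
    then have "unorm f \<le> unorm (\<lambda>y. c * f y) / cmod c"
      using False by (simp add: norm_inverse divide_inverse mult.commute flip: mult.assoc)
    then show ?thesis
      using le[OF f, of c] False by (simp add: field_simps)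
  qed
qed

text \<open>Multiplication by a continuous unimodular function preserves a C*-seminorm \<open>p\<close>. A real
  function \<open>c\<close> with \<open>\<bar>c\<bar> \<le> 1\<close> is the mean of the unimodular functions \<open>c \<plusminus> \<i> sqrt (1 - c\<^sup>2)\<close>, so
  multiplication by \<open>c\<close> does not increase \<open>p\<close>. For real \<open>h\<close> with \<open>\<bar>h\<bar> \<le> 1\<close> this gives
  \<open>p h\<^sup>2 = p (h * h) \<le> p h\<close>, that is \<open>p h \<le> 1\<close>. The general case is \<open>p f\<^sup>2 = p (f\<^sup>* f)\<close> with \<open>f\<close> scaled.\<close>

lemma cstar_seminorm_C0_le_unorm:
  assumes p: "cstar_seminorm (C0_alg Y) p" and f: "f \<in> C0 Y"
  shows "p f \<le> unorm f"
proof -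
  have pos: "0 \<le> p g" if "g \<in> C0 Y" for g
    using p that unfolding cstar_seminorm_def C0_alg_simps by blast
  have add: "p (\<lambda>y. g y + h y) \<le> p g + p h" if "g \<in> C0 Y" "h \<in> C0 Y" for g h
    using p that unfolding cstar_seminorm_def C0_alg_simps by blast
  have scale: "p (\<lambda>y. c * g y) = cmod c * p g" if "g \<in> C0 Y" for g c
    using p that unfolding cstar_seminorm_def C0_alg_simps by blast
  have sq: "p (\<lambda>y. cnj (g y) * g y) = (p g)\<^sup>2" if "g \<in> C0 Y" for g
    using p that unfolding cstar_seminorm_def C0_alg_simps by blast
  have unimodular: "p (\<lambda>y. u y * g y) = p g"
    if g: "g \<in> C0 Y" and u: "continuous_map Y euclidean u" "\<And>y. y \<in> topspace Y \<Longrightarrow> cmod (u y) = 1" for g u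
  proof -
    have ug: "(\<lambda>y. u y * g y) \<in> C0 Y"
      using C0_multiplier[OF g u(1)] u(2) by (metis order_refl)
    have "cnj (u y * g y) * (u y * g y) = cnj (g y) * g y" for y
    proof (cases "y \<in> topspace Y")
      case True
      have "cnj (u y * g y) * (u y * g y) = (u y * cnj (u y)) * (cnj (g y) * g y)" by simp
      also have "u y * cnj (u y) = 1"
        using u(2)[OF True] by (simp add: complex_norm_square[symmetric])
      finally show ?thesis by simp
    qed (use C0_off[OF g] in simp)
    then have "(\<lambda>y. cnj (u y * g y) * (u y * g y)) = (\<lambda>y. cnj (g y) * g y)" by (rule ext)
    then have "(p (\<lambda>y. u y * g y))\<^sup>2 = (p g)\<^sup>2"
      using sq[OF ug] sq[OF g] by (simp only:)
    then show ?thesis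
      using pos[OF ug] pos[OF g] by (simp add: power2_eq_iff_nonneg)
  qed
  have shrink: "p (\<lambda>y. of_real (c y) * g y) \<le> p g"
    if g: "g \<in> C0 Y" and c: "continuous_map Y euclideanreal c" "\<And>y. y \<in> topspace Y \<Longrightarrow> \<bar>c y\<bar> \<le> 1" for g c
  proof -
    \<comment> \<open>\<open>c\<close> is the mean of the unimodular function \<open>u\<close> and its conjugate.\<close>
    define u where "u = (\<lambda>y. Complex (c y) (sqrt (1 - (c y)\<^sup>2)))"
    have cu: "continuous_map Y euclidean u"
      unfolding u_def using c(1)
      by (rule continuous_map_compose_euclidean) (simp add: Complex_eq, intro continuous_intros)
    have cu': "continuous_map Y euclidean (\<lambda>y. cnj (u y))"
      using cu by (rule continuous_map_compose_euclidean) (intro continuous_intros)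
    have nu: "cmod (u y) = 1" if "y \<in> topspace Y" for y
      using c(2)[OF that] by (simp add: u_def cmod_def abs_square_le_1)
    have 1: "(\<lambda>y. u y * g y) \<in> C0 Y" "(\<lambda>y. cnj (u y) * g y) \<in> C0 Y"
      using nu by (auto intro!: C0_multiplier[OF g, where B = 1] cu cu')
    have "(\<lambda>y. of_real (c y) * g y) = (\<lambda>y. (1/2) * (u y * g y) + (1/2) * (cnj (u y) * g y))"
      by (simp add: u_def complex_eq_iff fun_eq_iff add_divide_distrib diff_divide_distrib)
    then have "p (\<lambda>y. of_real (c y) * g y)
        \<le> p (\<lambda>y. (1/2) * (u y * g y)) + p (\<lambda>y. (1/2) * (cnj (u y) * g y))"
      using add[OF C0_scale[OF 1(1), of "1/2"] C0_scale[OF 1(2), of "1/2"]] by simp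
    also have "\<dots> = (1/2) * p (\<lambda>y. u y * g y) + (1/2) * p (\<lambda>y. cnj (u y) * g y)"
      using scale[OF 1(1), of "1/2"] scale[OF 1(2), of "1/2"] by simp
    also have "\<dots> = p g"
      using unimodular[OF g cu nu] unimodular[OF g cu'] nu by simp
    finally show ?thesis .
  qed
  have real: "p (\<lambda>y. of_real (h y)) \<le> 1"
    if h: "(\<lambda>y. complex_of_real (h y)) \<in> C0 Y" "\<And>y. \<bar>h y\<bar> \<le> 1" for h
  proof -
    have "continuous_map Y euclideanreal (\<lambda>y. Re (complex_of_real (h y)))"
      using C0_continuous[OF h(1)] by (rule continuous_map_compose_euclidean) (intro continuous_intros)
    then have "p (\<lambda>y. of_real (h y) * of_real (h y)) \<le> p (\<lambda>y. of_real (h y))"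
      using shrink[OF h(1), of h] h(2) by simp
    then have "(p (\<lambda>y. of_real (h y)))\<^sup>2 \<le> p (\<lambda>y. of_real (h y))"
      using sq[OF h(1)] by simp
    then show ?thesis
      using pos[OF h(1)] by (cases "p (\<lambda>y. of_real (h y)) = 0") (auto simp: power2_eq_square)
  qed
  have "p f \<le> M" if M: "M > unorm f" for M
  proof -
    have M0: "M > 0" using M unorm_nonneg[OF f] by simp
    define h where "h = (\<lambda>y. (cmod (f y) / M)\<^sup>2)"
    have eq: "(\<lambda>y. complex_of_real (h y)) = (\<lambda>y. of_real (1 / M\<^sup>2) * (cnj (f y) * f y))"
    proof
      fix y
      have "cnj (f y) * f y = of_real ((cmod (f y))\<^sup>2)"
        unfolding complex_norm_square by (rule mult.commute)
      then show "complex_of_real (h y) = of_real (1 / M\<^sup>2) * (cnj (f y) * f y)"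
        by (simp add: h_def power_divide)
    qed
    have hC: "(\<lambda>y. complex_of_real (h y)) \<in> C0 Y"
      unfolding eq by (intro C0_scale C0_mult C0_cnj f)
    have "\<bar>h y\<bar> \<le> 1" for y
      using unorm_upper[OF f, of y] M M0 by (simp add: h_def power_le_one)
    then have "p (\<lambda>y. complex_of_real (h y)) \<le> 1"
      using real[OF hC] by simp
    moreover have "p (\<lambda>y. complex_of_real (h y)) = (p f)\<^sup>2 / M\<^sup>2"
      unfolding eq scale[OF C0_mult[OF C0_cnj[OF f] f]] sq[OF f] by (simp add: norm_power norm_divide)
    ultimately have "(p f)\<^sup>2 \<le> M\<^sup>2" using M0 by simp
    then show ?thesis using less_imp_le[OF M0] by (rule power2_le_imp_le)
  qed
  then show ?thesis by (rule dense_ge)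
qed

lemma star_hom_compose:
  "star_hom A B f \<Longrightarrow> star_hom B C g \<Longrightarrow> star_hom A C (\<lambda>a. g (f a))"
  by (simp add: star_hom_def)

lemma cstar_seminorm_pullback:
  assumes f: "star_hom A B f" and p: "cstar_seminorm B p"
    and star: "\<And>a. a \<in> carr A \<Longrightarrow> vstar A a \<in> carr A"
  shows "cstar_seminorm A (\<lambda>a. p (f a))"
proof -
  have eqs: "f a \<in> carr B" "f (vscale A c a) = vscale B c (f a)" "f (vstar A a) = vstar B (f a)"
    if "a \<in> carr A" for a c
    using f that by (auto simp: star_hom_def)
  have eqs2: "f (vadd A a b) = vadd B (f a) (f b)" "f (vmult A a b) = vmult B (f a) (f b)"
    if "a \<in> carr A" "b \<in> carr A" for a b
    using f that by (auto simp: star_hom_def)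
  show ?thesis
    using p star unfolding cstar_seminorm_def by (simp add: eqs eqs2)
qed

lemma cstar_seminorm_cmod: "cstar_seminorm complex_alg cmod"
  by (auto simp: cstar_seminorm_def norm_triangle_ineq norm_mult power2_eq_square)

text \<open>The point is a common zero of the kernel of \<open>\<xi>\<close>. If there were none, finitely many elements of the
  kernel would have no common zero on the compact set where \<open>\<bar>g\<bar> \<ge> 1/2\<close>, for a \<open>g\<close> with \<open>\<xi> g = 1\<close>.
  The sum \<open>h\<close> of their squared moduli is in the kernel and bounded below by some \<open>c > 0\<close> on that set. So
  \<open>k = h g / max c h\<close> is in the kernel and agrees with \<open>g\<close> on that set, which gives \<open>\<bar>g - k\<bar> \<le> 1/2\<close>
  everywhere. This contradicts \<open>\<xi> (g - k) = 1\<close>, as \<open>\<xi>\<close> is contractive.\<close>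

lemma C0_character_is_evaluation:
  assumes \<xi>: "star_hom (C0_alg Y) complex_alg \<xi>" and nz: "f0 \<in> C0 Y" "\<xi> f0 \<noteq> 0"
    and Y: "locally_compact_space Y" "Hausdorff_space Y"
  obtains y where "y \<in> topspace Y" "\<And>f. f \<in> C0 Y \<Longrightarrow> \<xi> f = f y"
proof -
  have add: "\<xi> (\<lambda>y. f y + g y) = \<xi> f + \<xi> g" if "f \<in> C0 Y" "g \<in> C0 Y" for f g
    using \<xi> that by (simp add: star_hom_def)
  have scale: "\<xi> (\<lambda>y. c * f y) = c * \<xi> f" if "f \<in> C0 Y" for f c
    using \<xi> that by (simp add: star_hom_def)
  have mult: "\<xi> (\<lambda>y. f y * g y) = \<xi> f * \<xi> g" if "f \<in> C0 Y" "g \<in> C0 Y" for f g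
    using \<xi> that by (simp add: star_hom_def)
  have diff: "\<xi> (\<lambda>y. f y - g y) = \<xi> f - \<xi> g" if "f \<in> C0 Y" "g \<in> C0 Y" for f g
    using add[OF that(1) C0_scale[OF that(2), of "-1"]] scale[OF that(2), of "-1"] by simp
  have bound: "cmod (\<xi> f) \<le> unorm f" if "f \<in> C0 Y" for f
    using cstar_seminorm_C0_le_unorm[OF cstar_seminorm_pullback[OF \<xi> cstar_seminorm_cmod] that]
    by (simp add: C0_cnj)
  define g where "g = (\<lambda>y. (1 / \<xi> f0) * f0 y)"
  have g: "g \<in> C0 Y" "\<xi> g = 1"
    unfolding g_def using C0_scale[OF nz(1), of "1 / \<xi> f0"] scale[OF nz(1), of "1 / \<xi> f0"] nz(2) by auto
  have "\<exists>y\<in>topspace Y. \<forall>f\<in>C0 Y. \<xi> f = 0 \<longrightarrow> f y = 0"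
  proof (rule ccontr)
    assume "\<not> ?thesis"
    then have "\<forall>y\<in>topspace Y. \<exists>f. f \<in> C0 Y \<and> \<xi> f = 0 \<and> f y \<noteq> 0" by blast
    then obtain F where F: "\<And>y. y \<in> topspace Y \<Longrightarrow> F y \<in> C0 Y \<and> \<xi> (F y) = 0 \<and> F y y \<noteq> 0"
      by metis
    let ?K = "{y \<in> topspace Y. 1/2 \<le> cmod (g y)}"
    let ?V = "\<lambda>y. {z \<in> topspace Y. F y z \<in> - {0}}"
    have K: "compactin Y ?K" using g(1) by (intro C0_compact) auto
    have "openin Y (?V y)" if "y \<in> topspace Y" for y
      using F[OF that] C0_continuous by (intro openin_continuous_map_preimage[where Y = euclidean]) auto
    moreover have "?K \<subseteq> \<Union> (?V ` ?K)" using F by auto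
    ultimately obtain \<F> where \<F>: "finite \<F>" "\<F> \<subseteq> ?V ` ?K" "?K \<subseteq> \<Union> \<F>"
      using compactinD[OF K, of "?V ` ?K"] by auto
    obtain I where I: "finite I" "I \<subseteq> ?K" "?K \<subseteq> \<Union> (?V ` I)"
      using finite_subset_image[OF \<F>(1,2)] \<F>(3) by blast
    define h where "h = (\<lambda>z. \<Sum>y\<in>I. (cmod (F y z))\<^sup>2)"
    have hC: "(\<lambda>z. \<Sum>y\<in>J. cnj (F y z) * F y z) \<in> C0 Y \<and> \<xi> (\<lambda>z. \<Sum>y\<in>J. cnj (F y z) * F y z) = 0"
      if "finite J" "J \<subseteq> I" for J
      using that
    proof (induction J)
      case empty
      then show ?case using scale[OF C0_zero, of 0] by (simp add: C0_zero)
    next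
      case (insert y J)
      have Fy: "F y \<in> C0 Y" "\<xi> (F y) = 0" using F insert I by auto
      have 1: "(\<lambda>z. cnj (F y z) * F y z) \<in> C0 Y" using Fy by (intro C0_mult C0_cnj)
      have 2: "\<xi> (\<lambda>z. cnj (F y z) * F y z) = 0" using mult[OF C0_cnj Fy(1)] Fy by simp
      have 3: "(\<lambda>z. \<Sum>y\<in>J. cnj (F y z) * F y z) \<in> C0 Y" "\<xi> (\<lambda>z. \<Sum>y\<in>J. cnj (F y z) * F y z) = 0"
        using insert by auto
      show ?case
        using insert.hyps C0_add[OF 1 3(1)] add[OF 1 3(1)] 2 3(2) by simp
    qed
    have heq: "(\<lambda>z. complex_of_real (h z)) = (\<lambda>z. \<Sum>y\<in>I. cnj (F y z) * F y z)"
      unfolding h_def of_real_sum complex_norm_square by (simp add: mult.commute)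
    have hC0: "(\<lambda>z. complex_of_real (h z)) \<in> C0 Y" "\<xi> (\<lambda>z. complex_of_real (h z)) = 0"
      unfolding heq using hC[OF I(1) order_refl] by auto
    have h0: "h z \<ge> 0" for z unfolding h_def by (simp add: sum_nonneg)
    have hcont: "continuous_map Y euclideanreal h"
      using continuous_map_compose_euclidean[OF C0_continuous[OF hC0(1)], of Re]
      by (simp add: continuous_on_Re)
    have hpos: "h z > 0" if zK: "z \<in> ?K" for z
    proof -
      obtain y where y: "y \<in> I" "F y z \<noteq> 0" using subsetD[OF I(3) zK] by auto
      then have "0 < (cmod (F y z))\<^sup>2" by simp
      also have "\<dots> \<le> h z" unfolding h_def using y(1) I(1) by (intro member_le_sum) auto
      finally show ?thesis .
    qed
    obtain c where c: "c > 0" "\<And>z. z \<in> ?K \<Longrightarrow> c \<le> h z"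
    proof (cases "?K = {}")
      case True
      then show ?thesis using that[of 1] by auto
    next
      case False
      have "compact (h ` ?K)" using image_compactin[OF K hcont] by simp
      then obtain m where m: "m \<in> h ` ?K" "\<And>t. t \<in> h ` ?K \<Longrightarrow> m \<le> t"
        using compact_attains_inf[of "h ` ?K"] False by blast
      then have "m > 0" using hpos by auto
      then show ?thesis using m that by blast
    qed
    define q where "q = (\<lambda>z. 1 / max c (h z))"
    have qcont: "continuous_map Y euclideanreal q"
      unfolding q_def using hcont
      by (rule continuous_map_compose_euclidean) (use c(1) in \<open>intro continuous_intros, auto\<close>)
    have q1: "\<bar>q z\<bar> \<le> 1 / c" for z
      using c(1) by (auto simp: q_def abs_if max_def field_simps)
    have qg: "(\<lambda>z. of_real (q z) * g z) \<in> C0 Y"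
    proof (rule C0_multiplier[OF g(1)])
      show "continuous_map Y euclidean (\<lambda>z. complex_of_real (q z))"
        using qcont by (rule continuous_map_compose_euclidean) (intro continuous_intros)
      show "cmod (complex_of_real (q z)) \<le> 1 / c" for z using q1 by simp
    qed
    let ?k = "\<lambda>z. complex_of_real (h z) * (of_real (q z) * g z)"
    have k: "?k \<in> C0 Y" "\<xi> ?k = 0"
      using C0_mult[OF hC0(1) qg] mult[OF hC0(1) qg] hC0(2) by auto
    have "cmod (g z - ?k z) \<le> 1/2" for z
    proof (cases "z \<in> ?K")
      case True
      then have "h z * q z = 1" using c(2)[OF True] c(1) by (simp add: q_def max_def)
      then have "?k z = g z" by (simp flip: mult.assoc of_real_mult)
      then show ?thesis by (simp only: diff_self norm_zero)
    next
      case False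
      then have gz: "cmod (g z) \<le> 1/2" using C0_off[OF g(1), of z] by (cases "z \<in> topspace Y") auto
      have "0 \<le> h z * q z" "h z * q z \<le> 1"
        using h0[of z] c(1) by (auto simp: q_def max_def divide_simps)
      then have "\<bar>1 - h z * q z\<bar> \<le> 1" by simp
      moreover have "g z - ?k z = of_real (1 - h z * q z) * g z" by (simp add: algebra_simps)
      ultimately have "cmod (g z - ?k z) \<le> 1 * cmod (g z)"
        by (simp only: norm_mult norm_of_real mult_right_mono norm_ge_zero)
      then show ?thesis using gz by simp
    qed
    then have "unorm (\<lambda>z. g z - ?k z) \<le> 1/2" by (rule unorm_least)
    moreover have "\<xi> (\<lambda>z. g z - ?k z) = 1" using diff[OF g(1) k(1)] g(2) k(2) by simp
    ultimately show False using bound[OF C0_diff[OF g(1) k(1)]] by simp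
  qed
  then obtain y where y: "y \<in> topspace Y" "\<And>f. f \<in> C0 Y \<Longrightarrow> \<xi> f = 0 \<Longrightarrow> f y = 0" by blast
  have fg: "f y = \<xi> f * g y" if f: "f \<in> C0 Y" for f
  proof -
    have "\<xi> (\<lambda>z. f z - \<xi> f * g z) = 0"
      using diff[OF f C0_scale[OF g(1)]] scale[OF g(1)] g(2) by simp
    then show ?thesis using y(2)[OF C0_diff[OF f C0_scale[OF g(1)]]] by fastforce
  qed
  obtain b where b: "b \<in> C0 Y" "b y = 1"
    using C0_bump[OF Y openin_topspace y(1)] by metis
  have "g y \<noteq> 0" using fg[OF b(1)] b(2) by auto
  moreover have "g y * g y = g y" using fg[OF C0_mult[OF g(1) g(1)]] mult[OF g(1) g(1)] g(2) by simp
  ultimately have "g y = 1" by simp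
  then show ?thesis using that[OF y(1)] fg by simp
qed

section \<open>Gelfand duality\<close>

lemma topspace_Sp: "topspace (Sp A) = characters A"
  unfolding Sp_def topspace_subtopology topspace_product_topology
  by (auto simp: characters_def PiE_def)

lemma star_iso_hom: "star_iso A B f \<Longrightarrow> star_hom A B f"
  and star_iso_bij: "star_iso A B f \<Longrightarrow> bij_betw f (carr A) (carr B)"
  by (simp_all add: star_iso_def)

lemma star_hom_evaluation:
  "star_hom (C0_alg Y) complex_alg (\<lambda>f. f y)"
  by (simp add: star_hom_def)

definition closed_under_ops :: "('a, 'm) star_alg_scheme \<Rightarrow> bool" where
  "closed_under_ops A \<longleftrightarrow> (\<forall>a\<in>carr A. \<forall>b\<in>carr A. \<forall>c.
     vadd A a b \<in> carr A \<and> vscale A c a \<in> carr A \<and> vmult A a b \<in> carr A \<and> vstar A a \<in> carr A)"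

lemma star_hom_restrict:
  assumes "star_hom A B f" and "closed_under_ops A"
  shows "star_hom A B (restrict f (carr A))"
  using assms unfolding star_hom_def closed_under_ops_def by simp

lemma star_hom_inverse:
  assumes f: "star_hom A B f" "bij_betw f (carr A) (carr B)"
    and closed: "closed_under_ops A"
  shows "star_hom B A (inv_into (carr A) f)"
proof -
  have cl: "vadd A a b \<in> carr A \<and> vscale A c a \<in> carr A \<and> vmult A a b \<in> carr A \<and> vstar A a \<in> carr A"
    if "a \<in> carr A" "b \<in> carr A" for a b c
    using closed that unfolding closed_under_ops_def by blast
  let ?g = "inv_into (carr A) f"
  have g: "?g b \<in> carr A" "f (?g b) = b" if "b \<in> carr B" for b
    using f(2) that by (auto simp: bij_betw_def inv_into_into f_inv_into_f)
  have inj: "?g (f a) = a" if "a \<in> carr A" for a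
    using f(2) that by (simp add: bij_betw_def)
  have f1: "f (vscale A c a) = vscale B c (f a)" "f (vstar A a) = vstar B (f a)"
    if "a \<in> carr A" for a c
    using f(1) that by (auto simp: star_hom_def)
  have f2: "f (vadd A a b) = vadd B (f a) (f b)" "f (vmult A a b) = vmult B (f a) (f b)"
    if "a \<in> carr A" "b \<in> carr A" for a b
    using f(1) that by (auto simp: star_hom_def)
  show ?thesis
    unfolding star_hom_def
  proof (intro conjI ballI allI)
    fix a b c assume a: "a \<in> carr B" and b: "b \<in> carr B"
    show "?g a \<in> carr A" by (rule g(1)[OF a])
    show "?g (vadd B a b) = vadd A (?g a) (?g b)"
      using inj[of "vadd A (?g a) (?g b)"] cl[OF g(1)[OF a] g(1)[OF b]] f2(1)[OF g(1)[OF a] g(1)[OF b]]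
      by (simp add: g(2)[OF a] g(2)[OF b])
    show "?g (vmult B a b) = vmult A (?g a) (?g b)"
      using inj[of "vmult A (?g a) (?g b)"] cl[OF g(1)[OF a] g(1)[OF b]] f2(2)[OF g(1)[OF a] g(1)[OF b]]
      by (simp add: g(2)[OF a] g(2)[OF b])
    show "?g (vstar B a) = vstar A (?g a)"
      using inj[of "vstar A (?g a)"] cl[OF g(1)[OF a] g(1)[OF a]] f1(2)[OF g(1)[OF a]]
      by (simp add: g(2)[OF a])
  next
    fix a c assume a: "a \<in> carr B"
    show "?g (vscale B c a) = vscale A c (?g a)"
      using inj[of "vscale A c (?g a)"] cl[OF g(1)[OF a] g(1)[OF a]] f1(1)[OF g(1)[OF a]]
      by (simp add: g(2)[OF a])
  qed
qed

lemma star_iso_compose: "star_iso A B f \<Longrightarrow> star_iso B C g \<Longrightarrow> star_iso A C (\<lambda>a. g (f a))"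
  using bij_betw_trans[of f "carr A" "carr B" g "carr C"] star_hom_compose[of A B f C g]
  by (simp add: star_iso_def o_def)

lemma star_iso_inverse:
  "star_iso A B f \<Longrightarrow> closed_under_ops A \<Longrightarrow> star_iso B A (inv_into (carr A) f)"
  by (simp add: star_iso_def star_hom_inverse bij_betw_inv_into)

lemma star_iso_restrict:
  "star_iso A B f \<Longrightarrow> closed_under_ops A \<Longrightarrow> star_iso A B (restrict f (carr A))"
  unfolding star_iso_def bij_betw_def inj_on_restrict_eq image_restrict_eq
  using star_hom_restrict by blast

text \<open>The spectrum of an algebra isomorphic to \<open>C0 Y\<close> is \<open>Y\<close>: the points give all characters, and
  the functions in \<open>C0 Y\<close> determine the topology of \<open>Y\<close> because there are enough bump functions.\<close>

lemma homeomorphic_map_spectrum: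
  assumes \<Psi>: "star_iso B (C0_alg Y) \<Psi>" and cl: "closed_under_ops B"
    and Y: "locally_compact_space Y" "Hausdorff_space Y"
  shows "homeomorphic_map Y (Sp B) (\<lambda>y. \<lambda>b\<in>carr B. \<Psi> b y)"
proof -
  let ?c = "\<lambda>y. \<lambda>b\<in>carr B. \<Psi> b y"
  have hom: "star_hom B (C0_alg Y) \<Psi>" and bij: "bij_betw \<Psi> (carr B) (C0 Y)"
    using \<Psi> by (auto simp: star_iso_def)
  have into: "\<Psi> b \<in> C0 Y" if "b \<in> carr B" for b
    using bij that by (auto simp: bij_betw_def)
  have onto: "\<exists>b\<in>carr B. \<Psi> b = f" if "f \<in> C0 Y" for f
    using bij that unfolding bij_betw_def by (metis imageE)
  have char: "?c y \<in> characters B" if y: "y \<in> topspace Y" for y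
    unfolding characters_def
  proof (intro CollectI conjI IntI)
    show "star_hom B complex_alg (?c y)"
      by (intro star_hom_restrict star_hom_compose[OF hom star_hom_evaluation] cl)
    obtain f where "f \<in> C0 Y" "f y = 1" using C0_bump[OF Y openin_topspace y] by metis
    then show "\<exists>a\<in>carr B. ?c y a \<noteq> 0" using onto[of f] by force
  qed auto
  have sep: "\<exists>f\<in>C0 Y. f y = 1 \<and> f z = 0" if yz: "y \<in> topspace Y" "z \<in> topspace Y" "y \<noteq> z" for y z
  proof -
    have "openin Y (topspace Y - {z})"
      using Y(2) yz(2) by (meson Hausdorff_imp_t1_space openin_diff openin_topspace t1_space_closedin_singleton)
    then obtain f where "f \<in> C0 Y" "f y = 1" "\<And>x. x \<notin> topspace Y - {z} \<Longrightarrow> f x = 0"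
      using C0_bump[OF Y, of "topspace Y - {z}" y] yz by blast
    then show ?thesis by auto
  qed
  have inj: "inj_on ?c (topspace Y)"
  proof (rule inj_onI, rule ccontr)
    fix y z assume yz: "y \<in> topspace Y" "z \<in> topspace Y" "?c y = ?c z" "y \<noteq> z"
    obtain f where f: "f \<in> C0 Y" "f y = 1" "f z = 0" using sep[OF yz(1,2,4)] by blast
    obtain b where "b \<in> carr B" "\<Psi> b = f" using onto[OF f(1)] by blast
    then show False using fun_cong[OF yz(3), of b] f by simp
  qed
  have surj: "?c ` topspace Y = topspace (Sp B)"
  proof
    show "?c ` topspace Y \<subseteq> topspace (Sp B)" using char by (auto simp: topspace_Sp)
    show "topspace (Sp B) \<subseteq> ?c ` topspace Y"
    proof
      fix \<xi> assume "\<xi> \<in> topspace (Sp B)"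
      then have \<xi>: "\<xi> \<in> extensional (carr B)" "star_hom B complex_alg \<xi>" "\<exists>a\<in>carr B. \<xi> a \<noteq> 0"
        by (auto simp: topspace_Sp characters_def)
      let ?g = "inv_into (carr B) \<Psi>"
      have gh: "star_hom (C0_alg Y) B ?g"
        by (rule star_iso_hom[OF star_iso_inverse[OF \<Psi> cl]])
      have ginv: "?g (\<Psi> b) = b" if "b \<in> carr B" for b
        using bij that by (simp add: bij_betw_def)
      obtain a where a: "a \<in> carr B" "\<xi> a \<noteq> 0" using \<xi>(3) by blast
      obtain y where y: "y \<in> topspace Y" "\<And>f. f \<in> C0 Y \<Longrightarrow> \<xi> (?g f) = f y"
        using C0_character_is_evaluation[OF star_hom_compose[OF gh \<xi>(2)] into[OF a(1)] _ Y]
          ginv[OF a(1)] a(2) by auto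
      have "\<xi> = ?c y"
      proof (rule extensionalityI[OF \<xi>(1)])
        show "\<xi> b = ?c y b" if "b \<in> carr B" for b
          using y(2)[OF into[OF that]] ginv[OF that] that by simp
      qed auto
      then show "\<xi> \<in> ?c ` topspace Y" using y(1) by blast
    qed
  qed
  have cont: "continuous_map Y (Sp B) ?c"
    unfolding Sp_def continuous_map_in_subtopology
  proof
    show "continuous_map Y (product_topology (\<lambda>_. euclidean) (carr B)) ?c"
      unfolding continuous_map_componentwise
      using C0_continuous[OF into] by auto
    show "?c \<in> topspace Y \<rightarrow> characters B" using char by blast
  qed
  have "open_map Y (Sp B) ?c"
    unfolding open_map_def
  proof (intro allI impI)
    fix U assume U: "openin Y U"
    show "openin (Sp B) (?c ` U)"
    proof (subst openin_subopen, intro ballI)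
      fix \<xi> assume "\<xi> \<in> ?c ` U"
      then obtain y where y: "y \<in> U" "\<xi> = ?c y" by blast
      obtain f where f: "f \<in> C0 Y" "f y = 1" "\<And>z. z \<notin> U \<Longrightarrow> f z = 0"
        using C0_bump[OF Y U y(1)] by metis
      obtain b where b: "b \<in> carr B" "\<Psi> b = f" using onto[OF f(1)] by blast
      let ?N = "{\<eta> \<in> topspace (Sp B). \<eta> b \<in> - {0}}"
      have "continuous_map (Sp B) euclidean (\<lambda>\<eta>. \<eta> b)"
        unfolding Sp_def
        by (intro continuous_map_from_subtopology continuous_map_product_projection b(1))
      then have "openin (Sp B) ?N"
        by (rule openin_continuous_map_preimage) auto
      moreover have "\<xi> \<in> ?N"
        using y U b f char openin_subset[OF U] by (auto simp: topspace_Sp)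
      moreover have "?N \<subseteq> ?c ` U"
      proof
        fix \<eta> assume \<eta>: "\<eta> \<in> ?N"
        then obtain z where z: "z \<in> topspace Y" "\<eta> = ?c z" using surj by blast
        then have "f z \<noteq> 0" using \<eta> b by auto
        then show "\<eta> \<in> ?c ` U" using f(3) z(2) by blast
      qed
      ultimately show "\<exists>T. openin (Sp B) T \<and> \<xi> \<in> T \<and> T \<subseteq> ?c ` U" by blast
    qed
  qed
  with cont inj surj show ?thesis
    by (intro bijective_open_imp_homeomorphic_map)
qed

section \<open>Stone-Weierstrass\<close>

text \<open>A copy of \<^typ>\<open>'i \<Rightarrow> real\<close> with the product topology. For arbitrary index types, an instance of
  \<^class>\<open>t2_space\<close> on the function type itself conflicts with the metric it carries for countable ones.\<close>

typedef 'i cube = "UNIV :: ('i \<Rightarrow> real) set"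
  morphisms coords Cube by simp

instantiation cube :: (type) t2_space
begin

definition open_cube_def: "open U \<longleftrightarrow> open (Cube -` U)"

lemma open_vimage_coords: "open V \<Longrightarrow> open (coords -` V :: 'a cube set)"
  by (simp add: open_cube_def vimage_def Cube_inverse)

instance
proof
  show "open (UNIV :: 'a cube set)" by (simp add: open_cube_def)
  show "open (U \<inter> V)" if "open U" "open V" for U V :: "'a cube set"
    using that by (simp add: open_cube_def open_Int)
  show "open (\<Union> \<U>)" if "\<forall>U\<in>\<U>. open U" for \<U> :: "'a cube set set"
    using that by (auto simp: open_cube_def vimage_Union)
next
  fix v w :: "'a cube" assume "v \<noteq> w"
  then obtain i where i: "coords v i \<noteq> coords w i"
    using coords_inject[of v w] by (auto simp: fun_eq_iff)
  obtain U V where UV: "open U" "open V" "coords v i \<in> U" "coords w i \<in> V" "U \<inter> V = {}"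
    using hausdorff[OF i] by (elim exE conjE)
  have "open ((\<lambda>h::'a \<Rightarrow> real. h i) -` U)" "open ((\<lambda>h::'a \<Rightarrow> real. h i) -` V)"
    using UV(1,2) by (auto intro!: open_vimage continuous_on_product_coordinates)
  then show "\<exists>U V. open U \<and> open V \<and> v \<in> U \<and> w \<in> V \<and> U \<inter> V = {}"
    using UV(3-5)
    by (intro exI[of _ "coords -` (\<lambda>h. h i) -` U"] exI[of _ "coords -` (\<lambda>h. h i) -` V"])
      (auto intro!: open_vimage_coords)
qed

end

lemma Hausdorff_space_cube: "Hausdorff_space (euclidean :: 'i cube topology)"
  unfolding Hausdorff_space_def disjnt_def using hausdorff by (intro allI impI) simp

lemma continuous_on_Cube: "continuous_on UNIV Cube"
  by (simp add: continuous_on_open_vimage open_cube_def)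

lemma continuous_on_coords: "continuous_on S (\<lambda>v. coords v i)"
proof -
  have "continuous_on UNIV (coords :: 'a cube \<Rightarrow> _)"
    by (simp add: continuous_on_open_vimage open_vimage_coords)
  then show ?thesis
    by (rule continuous_on_subset[OF continuous_on_product_then_coordinatewise subset_UNIV])
qed

text \<open>The functions in a separating set \<open>R\<close> embed a compact space into the product of copies of the
  real line indexed by \<open>R\<close>. This reduces the theorem for a \<^typ>\<open>'k topology\<close> to the one for
  compact subsets of a type with a topology.\<close>

lemma Stone_Weierstrass_compact_space:
  fixes K :: "'k topology" and R :: "('k \<Rightarrow> real) set"
  assumes K: "compact_space K"
    and cont: "\<And>r. r \<in> R \<Longrightarrow> continuous_map K euclideanreal r"
    and add: "\<And>r s. r \<in> R \<Longrightarrow> s \<in> R \<Longrightarrow> (\<lambda>x. r x + s x) \<in> R"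
    and mult: "\<And>r s. r \<in> R \<Longrightarrow> s \<in> R \<Longrightarrow> (\<lambda>x. r x * s x) \<in> R"
    and const: "\<And>c. (\<lambda>_. c) \<in> R"
    and sep: "\<And>x y. x \<in> topspace K \<Longrightarrow> y \<in> topspace K \<Longrightarrow> x \<noteq> y \<Longrightarrow> \<exists>r\<in>R. r x \<noteq> r y"
    and f: "continuous_map K euclideanreal f" and e: "e > 0"
  obtains r where "r \<in> R" "\<And>x. x \<in> topspace K \<Longrightarrow> \<bar>f x - r x\<bar> < e"
proof -
  define J' where "J' = (\<lambda>x r. if r \<in> R then r x else (0::real))"
  define J where "J = (\<lambda>x. Cube (J' x))"
  have coords_J: "coords (J x) r = r x" if "r \<in> R" for x r
    using that by (simp add: J_def J'_def Cube_inverse)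
  define S where "S = J ` topspace K"
  have "continuous_map K euclidean J'"
    unfolding euclidean_product_topology[symmetric] continuous_map_componentwise
    using cont by (auto simp: J'_def)
  then have J: "continuous_map K euclidean J"
    unfolding J_def using continuous_on_Cube by (rule continuous_map_compose_euclidean)
  have injJ: "inj_on J (topspace K)"
  proof (rule inj_onI, rule ccontr)
    fix x y assume xy: "x \<in> topspace K" "y \<in> topspace K" "J x = J y" "x \<noteq> y"
    obtain r where r: "r \<in> R" "r x \<noteq> r y" using sep[OF xy(1,2,4)] by blast
    then show False using coords_J[OF r(1), of x] coords_J[OF r(1), of y] xy(3) by simp
  qed
  have cS: "compact S"
    using image_compactin[of K "topspace K" euclidean J] K J by (simp add: S_def compact_space_def)
  have "homeomorphic_map K (top_of_set S) J"
    using J injJ K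
    by (intro continuous_imp_homeomorphic_map)
      (auto simp: S_def continuous_map_in_subtopology Hausdorff_space_subtopology[OF Hausdorff_space_cube])
  then obtain g where g: "homeomorphic_maps K (top_of_set S) J g"
    by (auto simp: homeomorphic_map_maps)
  define R' where "R' = {F. continuous_on S F \<and> (\<exists>r\<in>R. \<forall>x\<in>topspace K. F (J x) = r x)}"
  interpret fr: function_ring_on R' S
  proof
    show "compact S" by (rule cS)
    show "continuous_on S F" if "F \<in> R'" for F using that by (simp add: R'_def)
    show "(\<lambda>v. F v + G v) \<in> R'" if "F \<in> R'" "G \<in> R'" for F G
    proof -
      obtain r s where "r \<in> R" "\<forall>x\<in>topspace K. F (J x) = r x" "s \<in> R" "\<forall>x\<in>topspace K. G (J x) = s x"
        using \<open>F \<in> R'\<close> \<open>G \<in> R'\<close> by (auto simp: R'_def)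
      then have "\<exists>r\<in>R. \<forall>x\<in>topspace K. F (J x) + G (J x) = r x"
        by (intro bexI[OF _ add[of r s]]) auto
      then show ?thesis using that by (auto simp: R'_def intro: continuous_on_add)
    qed
    show "(\<lambda>v. F v * G v) \<in> R'" if "F \<in> R'" "G \<in> R'" for F G
    proof -
      obtain r s where "r \<in> R" "\<forall>x\<in>topspace K. F (J x) = r x" "s \<in> R" "\<forall>x\<in>topspace K. G (J x) = s x"
        using \<open>F \<in> R'\<close> \<open>G \<in> R'\<close> by (auto simp: R'_def)
      then have "\<exists>r\<in>R. \<forall>x\<in>topspace K. F (J x) * G (J x) = r x"
        by (intro bexI[OF _ mult[of r s]]) auto
      then show ?thesis using that by (auto simp: R'_def intro: continuous_on_mult)
    qed
    show "(\<lambda>_. c) \<in> R'" for c using const[of c] by (auto simp: R'_def)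
    fix v w assume vw: "v \<in> S" "w \<in> S" "v \<noteq> w"
    then obtain x y where xy: "x \<in> topspace K" "y \<in> topspace K" "v = J x" "w = J y" "x \<noteq> y"
      by (auto simp: S_def)
    then obtain r where r: "r \<in> R" "r x \<noteq> r y" using sep by blast
    have "(\<lambda>v. coords v r) \<in> R'"
      using r(1) continuous_on_coords by (auto simp: R'_def coords_J)
    then show "\<exists>F\<in>R'. F v \<noteq> F w"
      using r xy by (intro bexI[of _ "\<lambda>v. coords v r"]) (simp_all add: coords_J)
  qed
  have "continuous_map (top_of_set S) euclideanreal (f \<circ> g)"
    using g f continuous_map_compose unfolding homeomorphic_maps_def by blast
  then have "continuous_on S (f \<circ> g)" by simp
  then obtain F where F: "F \<in> R'" "\<forall>v\<in>S. \<bar>(f \<circ> g) v - F v\<bar> < e"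
    using fr.Stone_Weierstrass_basic[OF _ e] by blast
  then obtain r where r: "r \<in> R" "\<forall>x\<in>topspace K. F (J x) = r x" by (auto simp: R'_def)
  have "\<bar>f x - r x\<bar> < e" if "x \<in> topspace K" for x
  proof -
    have "g (J x) = x" using g that by (auto simp: homeomorphic_maps_def)
    moreover have "J x \<in> S" using that by (simp add: S_def)
    ultimately show ?thesis using F(2) r(2) that by force
  qed
  then show ?thesis using that r(1) by blast
qed

text \<open>On the one-point compactification, add the constants to the real parts of the given functions.
  Comparing values at the added point shows that the constant of an approximation is small.\<close>

lemma C0_Stone_Weierstrass:
  assumes Y: "locally_compact_space Y" "Hausdorff_space Y"
    and A: "A \<subseteq> C0 Y" "(\<lambda>_. 0) \<in> A"
    and add: "\<And>f g. f \<in> A \<Longrightarrow> g \<in> A \<Longrightarrow> (\<lambda>y. f y + g y) \<in> A"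
    and scale: "\<And>c f. f \<in> A \<Longrightarrow> (\<lambda>y. c * f y) \<in> A"
    and mult: "\<And>f g. f \<in> A \<Longrightarrow> g \<in> A \<Longrightarrow> (\<lambda>y. f y * g y) \<in> A"
    and star: "\<And>f. f \<in> A \<Longrightarrow> (\<lambda>y. cnj (f y)) \<in> A"
    and nonvanishing: "\<And>y. y \<in> topspace Y \<Longrightarrow> \<exists>f\<in>A. f y \<noteq> 0"
    and sep: "\<And>y z. y \<in> topspace Y \<Longrightarrow> z \<in> topspace Y \<Longrightarrow> y \<noteq> z \<Longrightarrow> \<exists>f\<in>A. f y \<noteq> f z"
    and f: "f \<in> C0 Y" and e: "e > 0"
  obtains g where "g \<in> A" "\<And>y. cmod (f y - g y) < e"
proof -
  let ?K = "Alexandroff_compactification Y"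
  have re: "(\<lambda>y. of_real (Re (f y))) \<in> A" if "f \<in> A" for f
  proof -
    have "(\<lambda>y. (1/2) * (f y + cnj (f y))) \<in> A" using that by (intro scale add star)
    moreover have "(\<lambda>y. (1/2) * (f y + cnj (f y))) = (\<lambda>y. of_real (Re (f y)))"
      by (simp add: complex_add_cnj)
    ultimately show ?thesis by simp
  qed
  define R where "R = {r. \<exists>c. \<exists>g\<in>A. r = (\<lambda>p. c + Re (ext_inf g p))}"
  have R: "(\<lambda>p. c + Re (ext_inf g p)) \<in> R" if "g \<in> A" for g c
    using that by (auto simp: R_def)
  have extA: "continuous_map ?K euclidean (ext_inf g)" if "g \<in> C0 Y" for g
    using that C0_iff_continuous_Alexandroff[OF Y(2)] by blast
  have approx: "\<exists>g\<in>A. \<forall>y. \<bar>h y - Re (g y)\<bar> < d"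
    if h: "(\<lambda>y. complex_of_real (h y)) \<in> C0 Y" and d: "d > 0" for h d
  proof -
    let ?h = "\<lambda>p. Re (ext_inf (\<lambda>y. complex_of_real (h y)) p)"
    have ch: "continuous_map ?K euclideanreal ?h"
      using extA[OF h] by (rule continuous_map_compose_euclidean) (intro continuous_intros)
    obtain r where r: "r \<in> R" "\<And>p. p \<in> topspace ?K \<Longrightarrow> \<bar>?h p - r p\<bar> < d / 2"
    proof (rule Stone_Weierstrass_compact_space[of ?K R ?h "d/2"])
      show "compact_space ?K" by simp
      show "continuous_map ?K euclideanreal r" if rR: "r \<in> R" for r
      proof -
        obtain c g where g: "g \<in> A" "r = (\<lambda>p. c + Re (ext_inf g p))"
          using rR by (auto simp: R_def)
        have "continuous_map ?K euclideanreal (\<lambda>p. Re (ext_inf g p))"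
          using extA[OF subsetD[OF A(1) g(1)]]
          by (rule continuous_map_compose_euclidean) (intro continuous_intros)
        then show ?thesis unfolding g(2) by (intro continuous_map_add) auto
      qed
      show "(\<lambda>p. r p + s p) \<in> R" if "r \<in> R" "s \<in> R" for r s
      proof -
        obtain c g c' g' where g: "g \<in> A" "r = (\<lambda>p. c + Re (ext_inf g p))"
          and g': "g' \<in> A" "s = (\<lambda>p. c' + Re (ext_inf g' p))"
          using \<open>r \<in> R\<close> \<open>s \<in> R\<close> by (auto simp: R_def)
        have "(\<lambda>p. r p + s p) = (\<lambda>p. (c + c') + Re (ext_inf (\<lambda>y. g y + g' y) p))"
          unfolding g(2) g'(2) by (rule ext) (auto simp: ext_inf_def split: option.split)
        then show ?thesis using R[OF add[OF g(1) g'(1)]] by simp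
      qed
      show "(\<lambda>p. r p * s p) \<in> R" if "r \<in> R" "s \<in> R" for r s
      proof -
        obtain c g c' g' where g: "g \<in> A" "r = (\<lambda>p. c + Re (ext_inf g p))"
          and g': "g' \<in> A" "s = (\<lambda>p. c' + Re (ext_inf g' p))"
          using \<open>r \<in> R\<close> \<open>s \<in> R\<close> by (auto simp: R_def)
        let ?m = "\<lambda>y. (of_real c * g' y + of_real c' * g y) + of_real (Re (g y)) * g' y"
        have "?m \<in> A" using g(1) g'(1) by (intro add scale mult re)
        moreover have "(\<lambda>p. r p * s p) = (\<lambda>p. (c * c') + Re (ext_inf ?m p))"
          unfolding g(2) g'(2) by (rule ext) (auto simp: ext_inf_def algebra_simps split: option.split)
        ultimately show ?thesis using R[of ?m "c * c'"] by simp
      qed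
      show "(\<lambda>_. c) \<in> R" for c
        using R[OF A(2), of c] by (simp add: ext_inf_def option.case_eq_if)
      show "\<exists>r\<in>R. r p \<noteq> r q" if pq: "p \<in> topspace ?K" "q \<in> topspace ?K" "p \<noteq> q" for p q
      proof -
        have "\<exists>g\<in>A. ext_inf g p \<noteq> ext_inf g q"
        proof (cases p)
          case None
          then obtain z where "q = Some z" "z \<in> topspace Y" using pq by auto
          then show ?thesis using nonvanishing[of z] None by force
        next
          case (Some y)
          then have y: "y \<in> topspace Y" using pq by auto
          show ?thesis
          proof (cases q)
            case None
            then show ?thesis using nonvanishing[OF y] Some by force
          next
            case (Some z)
            then show ?thesis using sep[OF y, of z] \<open>p = Some y\<close> pq by auto
          qed
        qed
        then obtain g where g: "g \<in> A" "ext_inf g p \<noteq> ext_inf g q" by blast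
        show ?thesis
        proof (cases "Re (ext_inf g p) = Re (ext_inf g q)")
          case False
          then show ?thesis by (intro bexI[OF _ R[OF g(1), of 0]]) simp
        next
          case True
          then have "Im (ext_inf g p) \<noteq> Im (ext_inf g q)" using g(2) by (simp add: complex_eq_iff)
          moreover have "Re (ext_inf (\<lambda>y. \<i> * g y) p) = - Im (ext_inf g p)" for p
            by (auto simp: ext_inf_def split: option.split)
          ultimately show ?thesis
            by (intro bexI[OF _ R[OF scale[OF g(1), of \<i>], of 0]]) simp
        qed
      qed
      show "continuous_map ?K euclideanreal ?h" by (rule ch)
      show "0 < d / 2" using d by simp
      fix r assume "r \<in> R" "\<And>x. x \<in> topspace ?K \<Longrightarrow> \<bar>?h x - r x\<bar> < d / 2"
      then show thesis using that by blast
    qed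
    obtain c g where g: "g \<in> A" "r = (\<lambda>p. c + Re (ext_inf g p))" using r(1) by (auto simp: R_def)
    have c: "\<bar>c\<bar> < d / 2" using r(2)[of None] g(2) by simp
    have "\<bar>h y - Re (g y)\<bar> < d" for y
    proof (cases "y \<in> topspace Y")
      case True
      then have "\<bar>h y - (c + Re (g y))\<bar> < d / 2" using r(2)[of "Some y"] g(2) by simp
      then show ?thesis using c by arith
    next
      case False
      then show ?thesis using C0_off[OF h False] C0_off[OF subsetD[OF A(1) g(1)] False] d by simp
    qed
    then show ?thesis using g(1) by blast
  qed
  have "(\<lambda>y. complex_of_real (Re (f y))) = (\<lambda>y. (1/2) * (f y + cnj (f y)))"
    "(\<lambda>y. complex_of_real (Im (f y))) = (\<lambda>y. (-\<i>/2) * (f y - cnj (f y)))"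
    by (simp_all add: complex_eq_iff fun_eq_iff)
  moreover have "(\<lambda>y. (1/2) * (f y + cnj (f y))) \<in> C0 Y" "(\<lambda>y. (-\<i>/2) * (f y - cnj (f y))) \<in> C0 Y"
    using f by (intro C0_scale C0_add C0_diff C0_cnj; assumption)+
  ultimately have reim: "(\<lambda>y. complex_of_real (Re (f y))) \<in> C0 Y" "(\<lambda>y. complex_of_real (Im (f y))) \<in> C0 Y"
    by (simp_all only:)
  obtain g1 where g1: "g1 \<in> A" "\<And>y. \<bar>Re (f y) - Re (g1 y)\<bar> < e / 2"
    using approx[OF reim(1), of "e/2"] e by auto
  obtain g2 where g2: "g2 \<in> A" "\<And>y. \<bar>Im (f y) - Re (g2 y)\<bar> < e / 2"
    using approx[OF reim(2), of "e/2"] e by auto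
  let ?g = "\<lambda>y. of_real (Re (g1 y)) + \<i> * of_real (Re (g2 y))"
  have "?g \<in> A" using g1 g2 by (intro add scale re)
  moreover have "cmod (f y - ?g y) < e" for y
  proof -
    have "cmod (f y - ?g y) \<le> \<bar>Re (f y - ?g y)\<bar> + \<bar>Im (f y - ?g y)\<bar>" by (rule cmod_le)
    also have "\<dots> < e" using g1(2)[of y] g2(2)[of y] by simp
    finally show ?thesis .
  qed
  ultimately show ?thesis using that by blast
qed

section \<open>Computing an enveloping C*-algebra\<close>

text \<open>A star-algebra \<open>D\<close> with a dense image in \<open>C0 Y\<close> such that the pulled back supremum norm is
  the largest C*-seminorm: its enveloping C*-algebra is \<open>C0 Y\<close>. The Cauchy sequences whose images
  converge uniformly to a given function \<open>f\<close> form one element \<open>cls f\<close> of the completion.\<close>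

locale dense_representation =
  fixes D :: "('a, 'm) star_alg_scheme" and Y :: "'y topology" and ev :: "'a \<Rightarrow> 'y \<Rightarrow> complex"
  assumes Hausdorff: "Hausdorff_space Y"
    and closed: "closed_under_ops D"
    and zero_carr: "vzero D \<in> carr D" and ev_zero: "ev (vzero D) = (\<lambda>_. 0)"
    and hom: "star_hom D (C0_alg Y) ev"
    and norm: "\<And>a. a \<in> carr D \<Longrightarrow> env_seminorm D a = unorm (ev a)"
    and dense: "\<And>f e. f \<in> C0 Y \<Longrightarrow> e > 0 \<Longrightarrow> \<exists>a\<in>carr D. \<forall>y. cmod (f y - ev a y) < e"
begin

lemma carr_ops:
  assumes "a \<in> carr D" "b \<in> carr D"
  shows "vadd D a b \<in> carr D" "vmult D a b \<in> carr D" "vdiff D a b \<in> carr D"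
  using closed assms unfolding closed_under_ops_def vdiff_def by auto

lemma carr_unary_ops:
  assumes "a \<in> carr D"
  shows "vscale D c a \<in> carr D" "vstar D a \<in> carr D"
  using closed assms unfolding closed_under_ops_def by auto

lemma ev_C0: "a \<in> carr D \<Longrightarrow> ev a \<in> C0 Y"
  using hom by (simp add: star_hom_def)

lemma ev_ops:
  assumes "a \<in> carr D" "b \<in> carr D"
  shows "ev (vadd D a b) = (\<lambda>y. ev a y + ev b y)" "ev (vmult D a b) = (\<lambda>y. ev a y * ev b y)"
  using hom assms by (simp_all add: star_hom_def)

lemma ev_unary_ops:
  assumes "a \<in> carr D"
  shows "ev (vscale D c a) = (\<lambda>y. c * ev a y)" "ev (vstar D a) = (\<lambda>y. cnj (ev a y))"
  using hom assms by (simp_all add: star_hom_def)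

lemma ev_diff:
  assumes "a \<in> carr D" "b \<in> carr D" shows "ev (vdiff D a b) = (\<lambda>y. ev a y - ev b y)"
  unfolding vdiff_def using ev_ops(1)[OF assms(1) carr_unary_ops(1)[OF assms(2), of "-1"]]
    ev_unary_ops(1)[OF assms(2), of "-1"] by simp

definition cls :: "('y \<Rightarrow> complex) \<Rightarrow> (nat \<Rightarrow> 'a) set" where
  "cls f = {x. (\<forall>n. x n \<in> carr D) \<and> uniform_limit UNIV (\<lambda>n. ev (x n)) f sequentially}"

lemma unorm_less_iff:
  assumes "f \<in> C0 Y"
  shows "unorm f < e \<Longrightarrow> cmod (f y) < e" "(\<And>y. cmod (f y) < e / 2) \<Longrightarrow> 0 < e \<Longrightarrow> unorm f < e"
proof -
  show "unorm f < e \<Longrightarrow> cmod (f y) < e" using unorm_upper[OF assms, of y] by simp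
  assume *: "\<And>y. cmod (f y) < e / 2" and e: "0 < e"
  have "unorm f \<le> e / 2" using * by (intro unorm_least less_imp_le)
  then show "unorm f < e" using e by simp
qed

lemma env_seminorm_vdiff_less:
  assumes "a \<in> carr D" "b \<in> carr D"
  shows "env_seminorm D (vdiff D a b) < e \<Longrightarrow> dist (ev a y) (ev b y) < e"
    "(\<And>y. dist (ev a y) (ev b y) < e / 2) \<Longrightarrow> 0 < e \<Longrightarrow> env_seminorm D (vdiff D a b) < e"
  unfolding norm[OF carr_ops(3)[OF assms]] ev_diff[OF assms] dist_norm
  using unorm_less_iff[OF C0_diff[OF ev_C0[OF assms(1)] ev_C0[OF assms(2)]]] by auto

text \<open>Cauchy sequences for the enveloping seminorm are sequences with uniformly Cauchy images, and \<open>C0 Y\<close> is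
  complete.\<close>

lemma env_seqs_iff: "x \<in> env_seqs D \<longleftrightarrow> (\<exists>f\<in>C0 Y. x \<in> cls f)"
proof
  assume x: "x \<in> env_seqs D"
  then have xc: "x n \<in> carr D" for n by (simp add: env_seqs_def)
  have "uniformly_Cauchy_on UNIV (\<lambda>n. ev (x n))"
    unfolding uniformly_Cauchy_on_def
  proof (intro allI impI)
    fix e :: real assume "e > 0"
    then obtain N where "\<forall>m\<ge>N. \<forall>n\<ge>N. env_seminorm D (vdiff D (x m) (x n)) < e"
      using x unfolding env_seqs_def by blast
    then show "\<exists>M. \<forall>y\<in>UNIV. \<forall>m\<ge>M. \<forall>n\<ge>M. dist (ev (x m) y) (ev (x n) y) < e"
      using env_seminorm_vdiff_less(1)[OF xc xc] by blast
  qed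
  then obtain f where f: "uniform_limit UNIV (\<lambda>n. ev (x n)) f sequentially"
    using Cauchy_uniformly_convergent by (auto simp: uniformly_convergent_on_def)
  have "f \<in> C0 Y"
  proof (rule C0_uniform_limit[OF Hausdorff])
    fix e :: real assume "e > 0"
    then have "\<forall>\<^sub>F n in sequentially. \<forall>y\<in>UNIV. dist (ev (x n) y) (f y) < e"
      by (rule uniform_limitD[OF f])
    then obtain n where "\<forall>y. dist (ev (x n) y) (f y) < e"
      by (auto simp: eventually_sequentially)
    then show "\<exists>g\<in>C0 Y. \<forall>y. cmod (f y - g y) < e"
      using ev_C0[OF xc, of n] by (intro bexI[of _ "ev (x n)"]) (auto simp: dist_norm norm_minus_commute)
  qed
  then show "\<exists>f\<in>C0 Y. x \<in> cls f" using f xc by (auto simp: cls_def)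
next
  assume "\<exists>f\<in>C0 Y. x \<in> cls f"
  then obtain f where x: "x n \<in> carr D" and f: "uniform_limit UNIV (\<lambda>n. ev (x n)) f sequentially" for n
    by (auto simp: cls_def)
  have "\<exists>N. \<forall>m\<ge>N. \<forall>n\<ge>N. env_seminorm D (vdiff D (x m) (x n)) < e" if e: "e > 0" for e
  proof -
    have "\<forall>\<^sub>F n in sequentially. \<forall>y\<in>UNIV. dist (ev (x n) y) (f y) < e / 4"
      using e by (intro uniform_limitD[OF f]) simp
    then obtain N where N: "\<And>n y. n \<ge> N \<Longrightarrow> dist (ev (x n) y) (f y) < e / 4"
      by (auto simp: eventually_sequentially)
    have "env_seminorm D (vdiff D (x m) (x n)) < e" if mn: "m \<ge> N" "n \<ge> N" for m n
    proof (rule env_seminorm_vdiff_less(2)[OF x x _ e])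
      fix y
      have "dist (ev (x m) y) (ev (x n) y) \<le> dist (ev (x m) y) (f y) + dist (ev (x n) y) (f y)"
        by (rule dist_triangle2)
      then show "dist (ev (x m) y) (ev (x n) y) < e / 2" using N[OF mn(1), of y] N[OF mn(2), of y] by simp
    qed
    then show ?thesis by blast
  qed
  then show "x \<in> env_seqs D" using x by (simp add: env_seqs_def)
qed

lemma cls_unique: "x \<in> cls f \<Longrightarrow> x \<in> cls g \<Longrightarrow> f = g"
  unfolding cls_def by (intro ext) (auto dest!: tendsto_uniform_limitI[where x = y for y] intro: LIMSEQ_unique)

lemma env_rel_iff:
  assumes x: "x \<in> cls f" and f: "f \<in> C0 Y"
  shows "(x, z) \<in> env_rel D \<longleftrightarrow> z \<in> cls f"
proof
  have xc: "x n \<in> carr D" for n using x by (simp add: cls_def)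
  have xl: "uniform_limit UNIV (\<lambda>n. ev (x n)) f sequentially" using x by (simp add: cls_def)
  {
    assume "(x, z) \<in> env_rel D"
    then have z: "z \<in> env_seqs D" and l: "(\<lambda>n. env_seminorm D (vdiff D (x n) (z n))) \<longlonglongrightarrow> 0"
      by (auto simp: env_rel_def)
    then have zc: "z n \<in> carr D" for n by (simp add: env_seqs_def)
    have "uniform_limit UNIV (\<lambda>n. ev (z n)) f sequentially"
    proof (rule uniform_limitI)
      fix e :: real assume e: "e > 0"
      have "\<forall>\<^sub>F n in sequentially. env_seminorm D (vdiff D (x n) (z n)) < e / 2"
        using order_tendstoD(2)[OF l, of "e/2"] e by simp
      moreover have "\<forall>\<^sub>F n in sequentially. \<forall>y\<in>UNIV. dist (ev (x n) y) (f y) < e / 2"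
        using e by (intro uniform_limitD[OF xl]) simp
      ultimately show "\<forall>\<^sub>F n in sequentially. \<forall>y\<in>UNIV. dist (ev (z n) y) (f y) < e"
      proof eventually_elim
        case (elim n)
        show ?case
        proof
          fix y
          have "dist (ev (z n) y) (f y) \<le> dist (ev (x n) y) (ev (z n) y) + dist (ev (x n) y) (f y)"
            by (rule dist_triangle3)
          then show "dist (ev (z n) y) (f y) < e"
            using env_seminorm_vdiff_less(1)[OF xc zc elim(1), of y] bspec[OF elim(2), of y] by simp
        qed
      qed
    qed
    then show "z \<in> cls f" using zc by (simp add: cls_def)
  }
  {
    assume z: "z \<in> cls f"
    then have zc: "z n \<in> carr D" for n by (simp add: cls_def)
    have zl: "uniform_limit UNIV (\<lambda>n. ev (z n)) f sequentially" using z by (simp add: cls_def)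
    have "(\<lambda>n. env_seminorm D (vdiff D (x n) (z n))) \<longlonglongrightarrow> 0"
    proof (rule order_tendstoI)
      fix e :: real assume e: "e < 0"
      have "0 \<le> env_seminorm D (vdiff D (x n) (z n))" for n
        unfolding norm[OF carr_ops(3)[OF xc zc]] by (rule unorm_nonneg[OF ev_C0[OF carr_ops(3)[OF xc zc]]])
      then show "\<forall>\<^sub>F n in sequentially. e < env_seminorm D (vdiff D (x n) (z n))"
        using e by (intro always_eventually allI) (rule less_le_trans)
    next
      fix e :: real assume e: "0 < e"
      have "\<forall>\<^sub>F n in sequentially. \<forall>y\<in>UNIV. dist (ev (x n) y) (f y) < e / 4"
        using e by (intro uniform_limitD[OF xl]) simp
      moreover have "\<forall>\<^sub>F n in sequentially. \<forall>y\<in>UNIV. dist (ev (z n) y) (f y) < e / 4"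
        using e by (intro uniform_limitD[OF zl]) simp
      ultimately show "\<forall>\<^sub>F n in sequentially. env_seminorm D (vdiff D (x n) (z n)) < e"
      proof eventually_elim
        case (elim n)
        show ?case
        proof (rule env_seminorm_vdiff_less(2)[OF xc zc _ e])
          fix y
          have "dist (ev (x n) y) (ev (z n) y) \<le> dist (ev (x n) y) (f y) + dist (ev (z n) y) (f y)"
            by (rule dist_triangle2)
          then show "dist (ev (x n) y) (ev (z n) y) < e / 2"
            using bspec[OF elim(1), of y] bspec[OF elim(2), of y] by simp
        qed
      qed
    qed
    then show "(x, z) \<in> env_rel D"
      using x z f env_seqs_iff by (auto simp: env_rel_def)
  }
qed

lemma env_rel_image: "x \<in> cls f \<Longrightarrow> f \<in> C0 Y \<Longrightarrow> env_rel D `` {x} = cls f"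
  using env_rel_iff by blast

lemma cls_nonempty: assumes f: "f \<in> C0 Y" shows "cls f \<noteq> {}"
proof -
  have "\<exists>a\<in>carr D. \<forall>y. cmod (f y - ev a y) < inverse (real (Suc n))" for n
    using dense[OF f] by simp
  then obtain x where x: "\<And>n. x n \<in> carr D" "\<And>n y. cmod (f y - ev (x n) y) < inverse (real (Suc n))"
    by metis
  have "uniform_limit UNIV (\<lambda>n. ev (x n)) f sequentially"
  proof (rule uniform_limitI)
    fix e :: real assume "e > 0"
    then have "\<forall>\<^sub>F n in sequentially. inverse (real (Suc n)) < e"
      using LIMSEQ_inverse_real_of_nat by (simp add: order_tendsto_iff)
    then show "\<forall>\<^sub>F n in sequentially. \<forall>y\<in>UNIV. dist (ev (x n) y) (f y) < e"
    proof eventually_elim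
      case (elim n)
      then show ?case using x(2)[of _ n] less_trans unfolding dist_norm norm_minus_commute[of "ev _ _"] by blast
    qed
  qed
  then show ?thesis using x(1) by (auto simp: cls_def)
qed

lemma carr_envelope: "carr (envelope D) = cls ` C0 Y"
proof -
  have "env_seqs D // env_rel D = cls ` C0 Y"
  proof (intro equalityI subsetI)
    fix P assume "P \<in> env_seqs D // env_rel D"
    then obtain x where x: "x \<in> env_seqs D" "P = env_rel D `` {x}" by (auto simp: quotient_def)
    then obtain f where "f \<in> C0 Y" "x \<in> cls f" using env_seqs_iff by blast
    then show "P \<in> cls ` C0 Y" using x(2) env_rel_image by blast
  next
    fix P assume "P \<in> cls ` C0 Y"
    then obtain f where f: "f \<in> C0 Y" "P = cls f" by blast
    then obtain x where "x \<in> cls f" using cls_nonempty by blast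
    then show "P \<in> env_seqs D // env_rel D"
      using f env_rel_image[of x f] env_seqs_iff by (auto simp: quotient_def)
  qed
  then show ?thesis by (simp add: envelope_def)
qed

lemma inj_on_cls: "inj_on cls (C0 Y)"
proof (rule inj_onI)
  fix f g assume "f \<in> C0 Y" "cls f = cls g"
  then show "f = g" using cls_nonempty[of f] cls_unique by blast
qed

lemma UN_cls:
  assumes "f \<in> C0 Y" and "\<And>x. x \<in> cls f \<Longrightarrow> G x = C" shows "(\<Union>x\<in>cls f. G x) = C"
  using cls_nonempty[OF assms(1)] assms(2) by auto

lemma cls_vadd:
  assumes f: "f \<in> C0 Y" and g: "g \<in> C0 Y"
  shows "vadd (envelope D) (cls f) (cls g) = cls (\<lambda>y. f y + g y)"
proof -
  have "(\<lambda>n. vadd D (x n) (z n)) \<in> cls (\<lambda>y. f y + g y)" if "x \<in> cls f" "z \<in> cls g" for x z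
    using that carr_ops(1) by (auto simp: cls_def ev_ops(1) intro: uniform_limit_add)
  then show ?thesis
    by (simp add: envelope_def) (intro UN_cls f g env_rel_image C0_add)
qed

lemma cls_vscale:
  assumes f: "f \<in> C0 Y" shows "vscale (envelope D) c (cls f) = cls (\<lambda>y. c * f y)"
proof -
  have "(\<lambda>n. vscale D c (x n)) \<in> cls (\<lambda>y. c * f y)" if "x \<in> cls f" for x
    using that carr_unary_ops(1)
    by (auto simp: cls_def ev_unary_ops(1) intro: bounded_linear_uniform_limit_intros)
  then show ?thesis
    by (simp add: envelope_def) (intro UN_cls f env_rel_image C0_scale)
qed

lemma cls_vstar:
  assumes f: "f \<in> C0 Y" shows "vstar (envelope D) (cls f) = cls (\<lambda>y. cnj (f y))"
proof -
  have "(\<lambda>n. vstar D (x n)) \<in> cls (\<lambda>y. cnj (f y))" if "x \<in> cls f" for x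
    using that carr_unary_ops(2) bounded_linear.uniform_limit[OF bounded_linear_cnj]
    by (auto simp: cls_def ev_unary_ops(2))
  then show ?thesis
    by (simp add: envelope_def) (intro UN_cls f env_rel_image C0_cnj)
qed

lemma cls_vmult:
  assumes f: "f \<in> C0 Y" and g: "g \<in> C0 Y"
  shows "vmult (envelope D) (cls f) (cls g) = cls (\<lambda>y. f y * g y)"
proof -
  have bdd: "bounded (f ` UNIV)" "bounded (g ` UNIV)"
    using C0_bounded[OF f] C0_bounded[OF g] by (auto simp: bdd_above_def bounded_iff)
  have "(\<lambda>n. vmult D (x n) (z n)) \<in> cls (\<lambda>y. f y * g y)" if "x \<in> cls f" "z \<in> cls g" for x z
    using that carr_ops(2) uniform_lim_mult[OF _ _ bdd]
    by (auto simp: cls_def ev_ops(2))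
  then show ?thesis
    by (simp add: envelope_def) (intro UN_cls f g env_rel_image C0_mult)
qed

lemma constant_mem_cls: "a \<in> carr D \<Longrightarrow> (\<lambda>_. a) \<in> cls (ev a)"
  by (simp add: cls_def uniform_limit_const)

lemma env_embed_eq: "a \<in> carr D \<Longrightarrow> env_embed D a = cls (ev a)"
  unfolding env_embed_def by (intro env_rel_image constant_mem_cls ev_C0)

lemma cls_vzero: "vzero (envelope D) = cls (\<lambda>_. 0)"
  using env_embed_eq[OF zero_carr] by (simp add: envelope_def env_embed_def ev_zero)

lemma cls_vnorm: assumes f: "f \<in> C0 Y" shows "vnorm (envelope D) (cls f) = unorm f"
proof -
  have lim: "(\<lambda>n. env_seminorm D (x n)) \<longlonglongrightarrow> unorm f" if x: "x \<in> cls f" for x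
  proof (rule tendstoI)
    fix e :: real assume e: "e > 0"
    have xc: "x n \<in> carr D" for n using x by (simp add: cls_def)
    have "\<forall>\<^sub>F n in sequentially. \<forall>y\<in>UNIV. dist (ev (x n) y) (f y) < e / 2"
      using x e by (intro uniform_limitD) (auto simp: cls_def)
    then show "\<forall>\<^sub>F n in sequentially. dist (env_seminorm D (x n)) (unorm f) < e"
    proof eventually_elim
      case (elim n)
      have near: "cmod (ev (x n) y - f y) \<le> e / 2" for y using elim by (simp add: dist_norm less_imp_le)
      have "unorm f \<le> unorm (ev (x n)) + e / 2"
      proof (rule unorm_least)
        fix y
        show "cmod (f y) \<le> unorm (ev (x n)) + e / 2"
          using near[of y] unorm_upper[OF ev_C0[OF xc], of n y] norm_triangle_ineq2[of "f y" "ev (x n) y"]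
          by (simp add: norm_minus_commute)
      qed
      moreover have "unorm (ev (x n)) \<le> unorm f + e / 2"
      proof (rule unorm_least)
        fix y
        show "cmod (ev (x n) y) \<le> unorm f + e / 2"
          using near[of y] unorm_upper[OF f, of y] norm_triangle_ineq2[of "ev (x n) y" "f y"] by simp
      qed
      ultimately show ?case using e unfolding norm[OF xc] dist_real_def by linarith
    qed
  qed
  have "(THE r. \<forall>x\<in>cls f. (\<lambda>n. env_seminorm D (x n)) \<longlonglongrightarrow> r) = unorm f"
  proof (rule the_equality)
    show "\<forall>x\<in>cls f. (\<lambda>n. env_seminorm D (x n)) \<longlonglongrightarrow> unorm f" using lim by blast
    fix r assume r: "\<forall>x\<in>cls f. (\<lambda>n. env_seminorm D (x n)) \<longlonglongrightarrow> r"
    obtain x where "x \<in> cls f" using cls_nonempty[OF f] by blast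
    then show "r = unorm f" using r lim LIMSEQ_unique by blast
  qed
  then show ?thesis by (simp add: envelope_def)
qed

definition gelfand :: "(nat \<Rightarrow> 'a) set \<Rightarrow> 'y \<Rightarrow> complex" where
  "gelfand = inv_into (C0 Y) cls"

lemma gelfand_cls: "f \<in> C0 Y \<Longrightarrow> gelfand (cls f) = f"
  unfolding gelfand_def by (rule inv_into_f_f[OF inj_on_cls])

lemma cls_gelfand: "P \<in> carr (envelope D) \<Longrightarrow> cls (gelfand P) = P"
  and gelfand_C0: "P \<in> carr (envelope D) \<Longrightarrow> gelfand P \<in> C0 Y"
  unfolding gelfand_def carr_envelope by (simp_all only: f_inv_into_f inv_into_into)

lemma closed_under_ops_envelope: "closed_under_ops (envelope D)"
  unfolding closed_under_ops_def carr_envelope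
  by (auto simp: cls_vadd cls_vscale cls_vmult cls_vstar intro!: imageI C0_add C0_scale C0_mult C0_cnj)

lemma star_hom_gelfand: "star_hom (envelope D) (C0_alg Y) gelfand"
  unfolding star_hom_def carr_envelope
  by (auto simp: cls_vadd cls_vscale cls_vmult cls_vstar gelfand_cls C0_add C0_scale C0_mult C0_cnj)

lemma star_iso_gelfand: "star_iso (envelope D) (C0_alg Y) gelfand"
proof -
  have "bij_betw cls (C0 Y) (carr (envelope D))"
    using inj_on_cls by (simp add: bij_betw_def carr_envelope)
  then have "bij_betw gelfand (carr (envelope D)) (C0 Y)"
    unfolding gelfand_def by (rule bij_betw_inv_into)
  then show ?thesis using star_hom_gelfand by (simp add: star_iso_def)
qed

lemma vnorm_gelfand: "P \<in> carr (envelope D) \<Longrightarrow> vnorm (envelope D) P = unorm (gelfand P)"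
  using cls_vnorm[OF gelfand_C0] by (simp add: cls_gelfand)

lemma gelfand_embed:
  assumes "a \<in> carr D" shows "env_embed D a \<in> carr (envelope D)" "gelfand (env_embed D a) = ev a"
  using assms by (auto simp: env_embed_eq carr_envelope gelfand_cls ev_C0)

lemma gelfand_vzero: "vzero (envelope D) \<in> carr (envelope D)" "gelfand (vzero (envelope D)) = (\<lambda>_. 0)"
  unfolding cls_vzero carr_envelope by (simp_all add: gelfand_cls C0_zero)

end

section \<open>Idempotents of an inverse semigroup\<close>

lemma inv_star_unique:
  assumes "s * t * s = s" "t * s * t = t" shows "s\<^sup>\<star> = t"
  using unique_generalized_inverse[of s] inv_star[of s] assms by blast

lemma inv_star_inv_star [simp]: "(s\<^sup>\<star>)\<^sup>\<star> = s"
  by (intro inv_star_unique inv_star)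

lemma idem: "e \<in> idems \<Longrightarrow> e * e = e"
  by (simp add: idems_def)

lemma inv_star_idem: "e \<in> idems \<Longrightarrow> e\<^sup>\<star> = e"
  by (intro inv_star_unique) (simp_all add: idem)

text \<open>The generalized inverse \<open>x\<close> of a product \<open>e * f\<close> of idempotents equals \<open>f * x * e\<close>, which is idempotent.
  So \<open>e * f\<close>, its generalized inverse, equals \<open>x\<close>.\<close>

lemma idems_mult:
  assumes e: "e \<in> idems" and f: "f \<in> idems" shows "e * f \<in> idems"
proof -
  define x where "x = (e * f)\<^sup>\<star>"
  have x: "e * f * x * (e * f) = e * f" "x * (e * f) * x = x"
    unfolding x_def by (rule inv_star)+
  have e': "e * (e * z) = e * z" for z using idem[OF e] by (simp flip: mult.assoc)
  have f': "f * (f * z) = f * z" for z using idem[OF f] by (simp flip: mult.assoc)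
  have x': "x * (e * (f * (x * z))) = x * z" for z using x(2) by (simp flip: mult.assoc)
  have x1: "e * (f * (x * (e * f))) = e * f" using x(1) by (simp add: mult.assoc)
  have "x = f * x * e"
    unfolding x_def by (rule inv_star_unique) (simp_all add: mult.assoc e' f' x' x1 flip: x_def)
  then have "x * x = x" by (metis e' f' mult.assoc x')
  then have "x\<^sup>\<star> = x" by (intro inv_star_idem) (simp add: idems_def)
  then have "e * f = x" by (simp add: x_def)
  then show ?thesis using \<open>x * x = x\<close> by (simp add: idems_def)
qed

lemma idems_commute:
  assumes e: "e \<in> idems" and f: "f \<in> idems" shows "e * f = f * e"
proof -
  have e': "e * (e * z) = e * z" for z using idem[OF e] by (simp flip: mult.assoc)
  have f': "f * (f * z) = f * z" for z using idem[OF f] by (simp flip: mult.assoc)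
  have ef: "e * (f * (e * f)) = e * f" using idem[OF idems_mult[OF e f]] by (simp add: mult.assoc)
  have fe: "f * (e * (f * e)) = f * e" using idem[OF idems_mult[OF f e]] by (simp add: mult.assoc)
  \<comment> \<open>Being idempotent, \<open>e * f\<close> is also its own generalized inverse.\<close>
  have "(e * f)\<^sup>\<star> = f * e"
    by (intro inv_star_unique) (simp_all add: mult.assoc e' f' ef fe)
  then show ?thesis using inv_star_idem[OF idems_mult[OF e f]] by simp
qed

lemma idems_left_commute: "e \<in> idems \<Longrightarrow> f \<in> idems \<Longrightarrow> e * (f * x) = f * (e * x)"
  using idems_commute[of e f] by (simp flip: mult.assoc)

lemma star_mult_idem [simp]: "s\<^sup>\<star> * s \<in> idems" "s * s\<^sup>\<star> \<in> idems"
  by (simp_all add: idems_def inv_star flip: mult.assoc)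

lemma inv_star_left: "s * (s\<^sup>\<star> * (s * x)) = s * x" "s\<^sup>\<star> * (s * (s\<^sup>\<star> * x)) = s\<^sup>\<star> * x"
  "s * (s\<^sup>\<star> * s) = s" "s\<^sup>\<star> * (s * s\<^sup>\<star>) = s\<^sup>\<star>"
  using inv_star[of s] by (simp_all flip: mult.assoc)

lemma conj_mult_conj:
  assumes e: "e \<in> idems" and f: "f \<in> idems"
  shows "(s\<^sup>\<star> * e * s) * (s\<^sup>\<star> * f * s) = s\<^sup>\<star> * (e * f) * s"
proof -
  have "(s\<^sup>\<star> * e * s) * (s\<^sup>\<star> * f * s) = s\<^sup>\<star> * (e * ((s * s\<^sup>\<star>) * (f * s)))"
    by (simp add: mult.assoc)
  also have "e * ((s * s\<^sup>\<star>) * (f * s)) = (s * s\<^sup>\<star>) * (e * (f * s))"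
    by (rule idems_left_commute[OF e star_mult_idem(2)])
  finally show ?thesis by (simp add: mult.assoc inv_star_left)
qed

lemma conj_idem: "e \<in> idems \<Longrightarrow> s\<^sup>\<star> * e * s \<in> idems"
  using conj_mult_conj[of e e s] idem[of e] by (simp add: idems_def)

lemma conj_idem': "e \<in> idems \<Longrightarrow> s * e * s\<^sup>\<star> \<in> idems"
  using conj_idem[of e "s\<^sup>\<star>"] by simp

lemma natural_le_idem: "e \<in> idems \<Longrightarrow> e \<preceq> f \<longleftrightarrow> f * e = e"
  by (simp add: natural_le_def inv_star_idem mult.assoc idem)

lemma natural_le_mult:
  assumes "e \<in> idems" "f \<in> idems" shows "e * f \<preceq> e" "e * f \<preceq> f"
  using assms idems_left_commute[of f e f] 
  by (simp_all add: natural_le_idem idems_mult idem flip: mult.assoc[of e e f])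

lemma natural_le_refl: "e \<in> idems \<Longrightarrow> e \<preceq> e"
  by (simp add: natural_le_idem idem)

lemma conj_conj:
  assumes e: "e \<in> idems" "e \<preceq> s\<^sup>\<star> * s" shows "s\<^sup>\<star> * (s * e * s\<^sup>\<star>) * s = e"
proof -
  have se: "(s\<^sup>\<star> * s) * e = e" using e by (simp add: natural_le_idem)
  have "s\<^sup>\<star> * (s * e * s\<^sup>\<star>) * s = ((s\<^sup>\<star> * s) * e) * (s\<^sup>\<star> * s)" by (simp add: mult.assoc)
  also have "\<dots> = (s\<^sup>\<star> * s) * e"
    unfolding se using idems_commute[OF e(1) star_mult_idem(1)[of s]] se by simp
  finally show ?thesis using se by simp
qed

lemma conj_le: "e \<in> idems \<Longrightarrow> s * e * s\<^sup>\<star> \<preceq> s * s\<^sup>\<star>"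
  using conj_idem'[of e s] by (simp add: natural_le_idem mult.assoc inv_star_left)

lemma natural_le_trans_mult: "e \<preceq> f \<Longrightarrow> e \<in> idems \<Longrightarrow> f \<in> idems \<Longrightarrow> e * f = e"
  by (simp add: natural_le_idem idems_commute[of e f])

text \<open>Adjoining one idempotent \<open>e\<close> to a finite multiplicatively closed set \<open>G\<close> only adds \<open>e\<close> and \<open>e * G\<close>.\<close>

lemma finite_subsemilattice:
  assumes "finite F" "F \<subseteq> idems"
  obtains G where "finite G" "F \<subseteq> G" "G \<subseteq> idems" "\<And>e f. e \<in> G \<Longrightarrow> f \<in> G \<Longrightarrow> e * f \<in> G"
proof -
  have "\<exists>G. finite G \<and> F \<subseteq> G \<and> G \<subseteq> idems \<and> (\<forall>e\<in>G. \<forall>f\<in>G. e * f \<in> G)"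
    using assms
  proof (induction F)
    case empty
    then show ?case by blast
  next
    case (insert e F)
    then obtain G where G: "finite G" "F \<subseteq> G" "G \<subseteq> idems" "\<forall>e\<in>G. \<forall>f\<in>G. e * f \<in> G" by auto
    have e: "e \<in> idems" using insert by simp
    have e': "e * (e * z) = e * z" for z using idem[OF e] by (simp flip: mult.assoc)
    let ?H = "insert e (G \<union> (\<lambda>g. e * g) ` G)"
    have "a * b \<in> ?H" if "a \<in> ?H" "b \<in> ?H" for a b
    proof -
      have ge: "g * e = e * g" "g * (e * h) = e * (g * h)" if "g \<in> G" for g h
        using idems_commute[OF _ e, of g] idems_left_commute[OF _ e, of g] that G(3) by auto
      show ?thesis using that G(4) by (auto simp: idem[OF e] e' ge mult.assoc)
    qed
    moreover have "?H \<subseteq> idems" using e G(3) idems_mult by auto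
    ultimately show ?case using G(1,2) by (intro exI[of _ ?H]) auto
  qed
  then show ?thesis using that by blast
qed

section \<open>Actions on locally compact Hausdorff spaces\<close>

lemma option_eqI:
  assumes "\<And>x. p = Some x \<longleftrightarrow> q = Some x" shows "p = q"
proof (cases p)
  case None
  then have "q \<noteq> Some x" for x using assms[of x] by simp
  then have "q = None" using not_None_eq[of q] by blast
  then show ?thesis using None by simp
next
  case (Some x)
  then show ?thesis using assms[of x] by simp
qed

locale LCH_action =
  fixes X :: "'x topology" and \<theta> :: "'s::inverse_semigroup \<Rightarrow> 'x \<rightharpoonup> 'x"
  assumes locally_compact: "locally_compact_space X" and Hausdorff: "Hausdorff_space X"
    and action: "semigroup_action X \<theta>"
begin

lemma theta_mult: "\<theta> (s * t) x = (case \<theta> t x of None \<Rightarrow> None | Some y \<Rightarrow> \<theta> s y)"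
  using action unfolding semigroup_action_def by (simp add: map_comp_def)

lemma theta_inj: "\<theta> s x = Some z \<Longrightarrow> \<theta> s y = Some z \<Longrightarrow> x = y"
  using action unfolding semigroup_action_def by (metis domI inj_onD)

lemma fix_dom_iff: "x \<in> fix_dom \<theta> e \<longleftrightarrow> \<theta> e x = Some x"
  by (simp add: fix_dom_def)

lemma theta_idem:
  assumes e: "e \<in> idems" and x: "\<theta> e x = Some y" shows "y = x"
proof -
  have "\<theta> e y = Some y" using theta_mult[of e e x] x idem[OF e] by simp
  then show ?thesis using theta_inj x by blast
qed

lemma fix_dom_mult:
  assumes "e \<in> idems" "f \<in> idems" shows "fix_dom \<theta> (e * f) = fix_dom \<theta> e \<inter> fix_dom \<theta> f"
proof (rule set_eqI)
  fix x show "x \<in> fix_dom \<theta> (e * f) \<longleftrightarrow> x \<in> fix_dom \<theta> e \<inter> fix_dom \<theta> f"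
    using theta_idem[OF assms(2), of x] by (cases "\<theta> f x") (auto simp: fix_dom_iff theta_mult)
qed

text \<open>The next lemmas compute domains: \<open>\<theta> s\<close> is a bijection from the domain of \<open>s\<^sup>\<star> * s\<close> to that of
  \<open>s * s\<^sup>\<star>\<close> with inverse \<open>\<theta> (s\<^sup>\<star>)\<close>, and the domain of \<open>s\<^sup>\<star> * e * s\<close> is the preimage of the domain of \<open>e\<close>.\<close>

lemma theta_Some:
  assumes "\<theta> s x = Some y"
  shows "x \<in> fix_dom \<theta> (s\<^sup>\<star> * s)" "\<theta> (s\<^sup>\<star>) y = Some x" "y \<in> fix_dom \<theta> (s * s\<^sup>\<star>)"
proof -
  have "\<theta> (s * (s\<^sup>\<star> * s)) x = Some y" using assms by (simp add: inv_star_left)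
  then obtain z where z: "\<theta> (s\<^sup>\<star> * s) x = Some z" by (auto simp: theta_mult[of s] split: option.splits)
  then have zx: "z = x" using theta_idem star_mult_idem by blast
  then show "x \<in> fix_dom \<theta> (s\<^sup>\<star> * s)" using z by (simp add: fix_dom_iff)
  show 1: "\<theta> (s\<^sup>\<star>) y = Some x" using z zx assms by (simp add: theta_mult)
  show "y \<in> fix_dom \<theta> (s * s\<^sup>\<star>)" using 1 assms by (simp add: fix_dom_iff theta_mult)
qed

lemma theta_defined: "x \<in> fix_dom \<theta> (s\<^sup>\<star> * s) \<Longrightarrow> \<exists>y. \<theta> s x = Some y"
  by (auto simp: fix_dom_iff theta_mult split: option.splits)

lemma theta_restrict:
  assumes "e \<in> idems"
  shows "\<theta> (e * s) x = Some y \<longleftrightarrow> \<theta> s x = Some y \<and> y \<in> fix_dom \<theta> e"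
proof (cases "\<theta> s x")
  case (Some z)
  then show ?thesis
    using theta_idem[OF assms, of z y] by (auto simp: fix_dom_iff theta_mult)
qed (simp add: theta_mult)

lemma fix_dom_conj:
  assumes "e \<in> idems"
  shows "x \<in> fix_dom \<theta> (s\<^sup>\<star> * e * s) \<longleftrightarrow> (\<exists>y. \<theta> s x = Some y \<and> y \<in> fix_dom \<theta> e)"
proof -
  have "\<theta> (s\<^sup>\<star> * e * s) x = (case \<theta> (e * s) x of None \<Rightarrow> None | Some y \<Rightarrow> \<theta> (s\<^sup>\<star>) y)"
    unfolding mult.assoc by (rule theta_mult)
  moreover have "\<theta> (s\<^sup>\<star>) y = Some x \<longleftrightarrow> True" if "\<theta> s x = Some y" for y
    using theta_Some(2)[OF that] by simp
  ultimately show ?thesis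
    using theta_restrict[OF assms, of s x]
    by (cases "\<theta> (e * s) x") (auto simp: fix_dom_iff)
qed

lemma openin_fix_dom: "e \<in> idems \<Longrightarrow> openin X (fix_dom \<theta> e)"
  using action unfolding semigroup_action_def by blast

lemma topspace_sub_space: "e \<in> idems \<Longrightarrow> topspace (sub_space X \<theta> e) = fix_dom \<theta> e"
  using openin_subset[OF openin_fix_dom] by (simp add: inf_absorb2)

lemma LCH_sub_space:
  assumes "e \<in> idems"
  shows "locally_compact_space (sub_space X \<theta> e)" "Hausdorff_space (sub_space X \<theta> e)"
  using locally_compact_space_open_subset[OF _ locally_compact openin_fix_dom[OF assms]]
    Hausdorff_space_subtopology[OF Hausdorff] Hausdorff by auto

lemma C0_sub_space:
  "e \<in> idems \<Longrightarrow> C0 (sub_space X \<theta> e) = {f \<in> C0 X. \<forall>x. x \<notin> fix_dom \<theta> e \<longrightarrow> f x = 0}"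
  by (intro C0_open_subspace Hausdorff openin_fix_dom)

lemma C0_sub_space_mult:
  assumes "e \<in> idems" "f \<in> idems" "g \<in> C0 (sub_space X \<theta> e)" "h \<in> C0 (sub_space X \<theta> f)"
  shows "(\<lambda>x. g x * h x) \<in> C0 (sub_space X \<theta> (e * f))"
proof -
  have "(\<lambda>x. g x * h x) \<in> C0 X" using assms by (intro C0_mult) (simp_all add: C0_sub_space)
  moreover have "g x * h x = 0" if "x \<notin> fix_dom \<theta> (e * f)" for x
    using assms that by (auto simp: C0_sub_space fix_dom_mult)
  ultimately show ?thesis by (simp add: C0_sub_space idems_mult[OF assms(1,2)])
qed

lemma sub_space_bump:
  assumes e: "e \<in> idems" and x: "x \<in> fix_dom \<theta> e"
  obtains g where "g \<in> C0 (sub_space X \<theta> e)" "g x = 1"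
  using C0_bump[OF LCH_sub_space[OF e] openin_topspace] x topspace_sub_space[OF e] by metis

lemma sub_space_separate:
  assumes e: "e \<in> idems" and p: "p \<in> insert None (Some ` fix_dom \<theta> e)" "q \<in> insert None (Some ` fix_dom \<theta> e)"
    and eq: "\<And>g. g \<in> C0 (sub_space X \<theta> e) \<Longrightarrow> ext_inf g p = ext_inf g q"
  shows "p = q"
proof (rule ccontr)
  assume pq: "p \<noteq> q"
  have aux: False if x: "x \<in> fix_dom \<theta> e" and q: "q \<in> insert None (Some ` fix_dom \<theta> e)" "Some x \<noteq> q"
    and eq: "\<And>g. g \<in> C0 (sub_space X \<theta> e) \<Longrightarrow> g x = ext_inf g q" for x q
  proof -
    let ?U = "fix_dom \<theta> e - {y. q = Some y}"
    have "closedin (sub_space X \<theta> e) {y \<in> fix_dom \<theta> e. q = Some y}"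
    proof (cases q)
      case None
      then show ?thesis by simp
    next
      case (Some y)
      then have "y \<in> fix_dom \<theta> e" using q(1) by auto
      then have "closedin (sub_space X \<theta> e) {y}"
        using closedin_Hausdorff_singleton LCH_sub_space(2)[OF e] topspace_sub_space[OF e] by metis
      moreover have "{z \<in> fix_dom \<theta> e. q = Some z} = {y}" using Some \<open>y \<in> fix_dom \<theta> e\<close> by auto
      ultimately show ?thesis by simp
    qed
    then have "openin (sub_space X \<theta> e) (topspace (sub_space X \<theta> e) - {y \<in> fix_dom \<theta> e. q = Some y})"
      by blast
    moreover have "topspace (sub_space X \<theta> e) - {y \<in> fix_dom \<theta> e. q = Some y} = ?U"
      unfolding topspace_sub_space[OF e] by auto
    ultimately have "openin (sub_space X \<theta> e) ?U" by simp
    moreover have "x \<in> ?U" using x q(2) by auto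
    ultimately obtain g where g: "g \<in> C0 (sub_space X \<theta> e)" "g x = 1" "\<And>z. z \<notin> ?U \<Longrightarrow> g z = 0"
      using C0_bump[OF LCH_sub_space[OF e]] by metis
    have "ext_inf g q = 0" using g(3) by (cases q) auto
    then show False using eq[OF g(1)] g(2) by simp
  qed
  show False
  proof (cases p)
    case (Some x)
    then show ?thesis using aux[of x q] p eq pq by auto
  next
    case None
    then obtain x where "q = Some x" "x \<in> fix_dom \<theta> e" using p pq by auto
    then show ?thesis using aux[of x p] p eq pq by auto
  qed
qed

lemma continuous_map_theta:
  assumes e: "e \<in> idems" "e \<preceq> s\<^sup>\<star> * s"
  shows "continuous_map (sub_space X \<theta> e) (sub_space X \<theta> (s * e * s\<^sup>\<star>)) (\<lambda>x. the (\<theta> s x))"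
  unfolding continuous_map_in_subtopology
proof
  have sub: "fix_dom \<theta> e \<subseteq> fix_dom \<theta> (s\<^sup>\<star> * s)"
    using fix_dom_mult[OF star_mult_idem(1)[of s] e(1)] e by (auto simp: natural_le_idem)
  have "continuous_map (subtopology X (fix_dom \<theta> (s\<^sup>\<star> * s))) X (\<lambda>x. the (\<theta> s x))"
    using action[unfolded semigroup_action_def, THEN conjunct2, THEN conjunct2, THEN conjunct2,
        THEN conjunct1, rule_format, of s]
    by (rule continuous_map_into_fulltopology)
  then show "continuous_map (sub_space X \<theta> e) X (\<lambda>x. the (\<theta> s x))"
    using sub by (rule continuous_map_from_subtopology_mono)
  have "the (\<theta> s x) \<in> fix_dom \<theta> (s * e * s\<^sup>\<star>)" if x: "x \<in> fix_dom \<theta> e" for x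
  proof -
    obtain y where y: "\<theta> s x = Some y" using theta_defined sub x by blast
    then show ?thesis using fix_dom_conj[OF e(1), of y "s\<^sup>\<star>"] theta_Some(2)[OF y] x by simp
  qed
  then show "(\<lambda>x. the (\<theta> s x)) \<in> topspace (sub_space X \<theta> e) \<rightarrow> fix_dom \<theta> (s * e * s\<^sup>\<star>)"
    unfolding topspace_sub_space[OF e(1)] by blast
qed

lemma alpha_Some: "\<theta> (s\<^sup>\<star>) y = Some x \<Longrightarrow> alpha \<theta> s g y = g x"
  using theta_Some(1)[of "s\<^sup>\<star>" y x] by (simp add: alpha_def zero_off_def)

text \<open>The map \<open>\<theta> s\<close> restricts to a homeomorphism from the domain of \<open>e\<close> to that of \<open>s * e * s\<^sup>\<star>\<close>, with
  inverse \<open>\<theta> (s\<^sup>\<star>)\<close>. So it carries the compact level sets of \<open>g\<close> to those of its transport.\<close>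

lemma alpha_C0:
  assumes e: "e \<in> idems" "e \<preceq> s\<^sup>\<star> * s" and g: "g \<in> C0 (sub_space X \<theta> e)"
  shows "alpha \<theta> s g \<in> C0 (sub_space X \<theta> (s * e * s\<^sup>\<star>))"
proof -
  let ?d = "s * e * s\<^sup>\<star>"
  have d: "?d \<in> idems" "?d \<preceq> (s\<^sup>\<star>)\<^sup>\<star> * s\<^sup>\<star>" using conj_idem'[OF e(1)] conj_le[OF e(1)] by simp_all
  have mem: "y \<in> fix_dom \<theta> ?d \<longleftrightarrow> (\<exists>x. \<theta> (s\<^sup>\<star>) y = Some x \<and> x \<in> fix_dom \<theta> e)" for y
    using fix_dom_conj[OF e(1), of y "s\<^sup>\<star>"] by simp
  have off: "alpha \<theta> s g y = 0" if y: "y \<notin> fix_dom \<theta> ?d" for y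
  proof (cases "\<theta> (s\<^sup>\<star>) y")
    case None
    then have "y \<notin> fix_dom \<theta> (s * s\<^sup>\<star>)" using theta_defined[of y "s\<^sup>\<star>"] by auto
    then show ?thesis by (simp add: alpha_def zero_off_def)
  next
    case (Some x)
    then have "x \<notin> fix_dom \<theta> e" using mem y by blast
    then show ?thesis using alpha_Some[OF Some] C0_off[OF g] topspace_sub_space[OF e(1)] by simp
  qed
  have "continuous_map (sub_space X \<theta> ?d) (sub_space X \<theta> e) (\<lambda>x. the (\<theta> (s\<^sup>\<star>) x))"
    using continuous_map_theta[OF d] by (simp add: conj_conj[OF e])
  from continuous_map_compose[OF this C0_continuous[OF g]]
  have cont: "continuous_map (sub_space X \<theta> ?d) euclidean (alpha \<theta> s g)"
  proof (rule continuous_map_eq)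
    fix y assume "y \<in> topspace (sub_space X \<theta> ?d)"
    then obtain x where "\<theta> (s\<^sup>\<star>) y = Some x" using mem topspace_sub_space[OF d(1)] by auto
    then show "(g \<circ> (\<lambda>x. the (\<theta> (s\<^sup>\<star>) x))) y = alpha \<theta> s g y" by (simp add: alpha_Some)
  qed
  have "compactin (sub_space X \<theta> ?d) {y \<in> topspace (sub_space X \<theta> ?d). r \<le> cmod (alpha \<theta> s g y)}"
    if r: "r > 0" for r
  proof -
    have "compactin (sub_space X \<theta> ?d) ((\<lambda>x. the (\<theta> s x)) ` {x \<in> topspace (sub_space X \<theta> e). r \<le> cmod (g x)})"
      by (rule image_compactin[OF C0_compact[OF g r] continuous_map_theta[OF e]])
    moreover have "(\<lambda>x. the (\<theta> s x)) ` {x \<in> topspace (sub_space X \<theta> e). r \<le> cmod (g x)}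
        = {y \<in> topspace (sub_space X \<theta> ?d). r \<le> cmod (alpha \<theta> s g y)}"
    proof (intro equalityI subsetI)
      fix y assume "y \<in> (\<lambda>x. the (\<theta> s x)) ` {x \<in> topspace (sub_space X \<theta> e). r \<le> cmod (g x)}"
      then obtain x where x: "x \<in> fix_dom \<theta> e" "r \<le> cmod (g x)" "y = the (\<theta> s x)"
        using topspace_sub_space[OF e(1)] by auto
      have "fix_dom \<theta> e \<subseteq> fix_dom \<theta> (s\<^sup>\<star> * s)"
        using fix_dom_mult[OF star_mult_idem(1)[of s] e(1)] e by (auto simp: natural_le_idem)
      then have "\<theta> s x = Some y" using theta_defined[of x s] x by auto
      then have "\<theta> (s\<^sup>\<star>) y = Some x" by (rule theta_Some)
      then show "y \<in> {y \<in> topspace (sub_space X \<theta> ?d). r \<le> cmod (alpha \<theta> s g y)}"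
        using x mem unfolding topspace_sub_space[OF d(1)] by (auto simp: alpha_Some)
    next
      fix y assume y: "y \<in> {y \<in> topspace (sub_space X \<theta> ?d). r \<le> cmod (alpha \<theta> s g y)}"
      then obtain x where x: "\<theta> (s\<^sup>\<star>) y = Some x" "x \<in> fix_dom \<theta> e"
        using mem unfolding topspace_sub_space[OF d(1)] by auto
      then have "\<theta> s x = Some y" using theta_Some(2)[OF x(1)] by simp
      then show "y \<in> (\<lambda>x. the (\<theta> s x)) ` {x \<in> topspace (sub_space X \<theta> e). r \<le> cmod (g x)}"
        using x y unfolding topspace_sub_space[OF e(1)]
        by (intro image_eqI[of _ _ x]) (auto simp: alpha_Some)
    qed
    ultimately show ?thesis by simp
  qed
  then show ?thesis
    unfolding C0_def topspace_sub_space[OF d(1)] using cont off by simp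
qed

section \<open>Points of the space XKS\<close>

abbreviation KS_space :: "('s \<Rightarrow> 'x option) topology" where
  "KS_space \<equiv> XKS X \<theta>"

lemma KS_PiE:
  "\<tau> \<in> topspace KS_space \<Longrightarrow>
    \<tau> \<in> (\<Pi>\<^sub>E e\<in>idems. topspace (Alexandroff_compactification (sub_space X \<theta> e)))"
  unfolding XKS_def topspace_subtopology topspace_product_topology by (rule IntD1)

lemma KS_value:
  assumes "\<tau> \<in> topspace KS_space" and e: "e \<in> idems"
  shows "\<tau> e \<in> insert None (Some ` fix_dom \<theta> e)"
  using PiE_mem[OF KS_PiE[OF assms(1)] e]
  unfolding topspace_Alexandroff_compactification topspace_sub_space[OF e] .

lemma KS_Some: "\<tau> \<in> topspace KS_space \<Longrightarrow> e \<in> idems \<Longrightarrow> \<tau> e = Some x \<Longrightarrow> x \<in> fix_dom \<theta> e"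
  using KS_value[of \<tau> e] by auto

lemma KS_extensional: "\<tau> \<in> topspace KS_space \<Longrightarrow> \<tau> \<in> extensional idems"
  using KS_PiE[of \<tau>] by (simp add: PiE_def)

lemma KS_conditions:
  assumes "\<tau> \<in> topspace KS_space"
  shows "\<And>e f. e \<in> idems \<Longrightarrow> f \<in> idems \<Longrightarrow> e \<preceq> f \<Longrightarrow> \<tau> e \<noteq> None \<Longrightarrow> \<tau> f = \<tau> e"
    and "\<And>e f. e \<in> idems \<Longrightarrow> f \<in> idems \<Longrightarrow> \<tau> e \<noteq> None \<Longrightarrow> \<tau> f \<noteq> None \<Longrightarrow> \<tau> (e * f) \<noteq> None"
    and "\<tau> \<noteq> (\<lambda>e\<in>idems. None)"
  using IntD2[OF assms[unfolded XKS_def topspace_subtopology]] unfolding mem_Collect_eq by blast+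

lemma KS_up:
  assumes "\<tau> \<in> topspace KS_space" "e \<in> idems" "f \<in> idems" "e \<preceq> f" "\<tau> e = Some x"
  shows "\<tau> f = Some x"
  using KS_conditions(1)[OF assms(1-4)] assms(5) by simp

text \<open>Thus the idempotents at which \<open>\<tau>\<close> is finite form a filter, and \<open>\<tau>\<close> is constant on it: a point of \<open>XKS\<close>
  is a nonempty filter \<open>F\<close> of idempotents together with a point in the domains of all \<open>e \<in> F\<close>.\<close>

lemma KS_mult_iff:
  assumes "\<tau> \<in> topspace KS_space" "e \<in> idems" "f \<in> idems"
  shows "\<tau> (e * f) = Some x \<longleftrightarrow> \<tau> e = Some x \<and> \<tau> f = Some x"
proof
  show "\<tau> (e * f) = Some x \<Longrightarrow> \<tau> e = Some x \<and> \<tau> f = Some x"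
    using KS_up[OF assms(1) idems_mult[OF assms(2,3)]] natural_le_mult[OF assms(2,3)] assms by blast
  assume *: "\<tau> e = Some x \<and> \<tau> f = Some x"
  then have "\<tau> (e * f) \<noteq> None" using KS_conditions(2)[OF assms] by simp
  then obtain z where z: "\<tau> (e * f) = Some z" by blast
  then have "\<tau> e = Some z"
    using KS_up[OF assms(1) idems_mult[OF assms(2,3)]] natural_le_mult[OF assms(2,3)] assms by blast
  then show "\<tau> (e * f) = Some x" using * z by simp
qed

lemma KS_unique:
  assumes "\<tau> \<in> topspace KS_space" "e \<in> idems" "f \<in> idems" "\<tau> e = Some x" "\<tau> f = Some y"
  shows "x = y"
proof -
  have "\<tau> (e * f) \<noteq> None" using KS_conditions(2)[OF assms(1-3)] assms(4,5) by simp
  then obtain z where "\<tau> (e * f) = Some z" by blast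
  then show ?thesis using KS_mult_iff[OF assms(1-3), of z] assms by simp
qed

lemma KS_nonempty: "\<tau> \<in> topspace KS_space \<Longrightarrow> \<exists>e\<in>idems. \<tau> e \<noteq> None"
proof (rule ccontr)
  assume *: "\<tau> \<in> topspace KS_space" "\<not> (\<exists>e\<in>idems. \<tau> e \<noteq> None)"
  then have "\<tau> = (\<lambda>e\<in>idems. None)"
    by (intro extensionalityI[OF KS_extensional[OF *(1)] restrict_extensional]) auto
  then show False using KS_conditions(3)[OF *(1)] by simp
qed

lemma KS_I:
  assumes "\<tau> \<in> extensional idems"
    and "\<And>e x. e \<in> idems \<Longrightarrow> \<tau> e = Some x \<Longrightarrow> x \<in> fix_dom \<theta> e"
    and "\<And>e f x. e \<in> idems \<Longrightarrow> f \<in> idems \<Longrightarrow> \<tau> (e * f) = Some x \<longleftrightarrow> \<tau> e = Some x \<and> \<tau> f = Some x"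
    and "\<And>e f x y. e \<in> idems \<Longrightarrow> f \<in> idems \<Longrightarrow> \<tau> e = Some x \<Longrightarrow> \<tau> f = Some y \<Longrightarrow> x = y"
    and "e0 \<in> idems" "\<tau> e0 \<noteq> None"
  shows "\<tau> \<in> topspace KS_space"
  unfolding XKS_def topspace_subtopology[of "product_topology _ _"] topspace_product_topology
proof (intro IntI CollectI conjI ballI impI)
  show "\<tau> \<in> (\<Pi>\<^sub>E e\<in>idems. topspace (Alexandroff_compactification (sub_space X \<theta> e)))"
  proof (rule PiE_I)
    fix e :: 's assume e: "e \<in> idems"
    show "\<tau> e \<in> topspace (Alexandroff_compactification (sub_space X \<theta> e))"
      unfolding topspace_Alexandroff_compactification topspace_sub_space[OF e] using assms(2)[OF e] by (cases "\<tau> e") auto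
  qed (rule extensional_arb[OF assms(1)])
  fix e f :: 's assume e: "e \<in> idems" and f: "f \<in> idems"
  show "\<tau> f = \<tau> e" if ef: "e \<preceq> f \<and> \<tau> e \<noteq> None"
  proof -
    obtain x where x: "\<tau> e = Some x" using ef by blast
    have "e * f = e" using natural_le_trans_mult ef e f by blast
    then show ?thesis using assms(3)[OF e f, of x] x by simp
  qed
  show "\<tau> (e * f) \<noteq> None" if ef: "\<tau> e \<noteq> None \<and> \<tau> f \<noteq> None"
  proof -
    obtain x y where xy: "\<tau> e = Some x" "\<tau> f = Some y" using ef by blast
    then have "x = y" using assms(4)[OF e f] by blast
    then show ?thesis using assms(3)[OF e f, of x] xy by simp
  qed
next
  show "\<tau> \<noteq> (\<lambda>e\<in>idems. None)" using assms(5,6) by auto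
qed

text \<open>The point given by the principal filter of \<open>f\<close> and a point \<open>x\<close> in the domain of \<open>f\<close>.\<close>

definition principal_point :: "'s \<Rightarrow> 'x \<Rightarrow> 's \<Rightarrow> 'x option" where
  "principal_point f x = (\<lambda>e\<in>idems. if f * e = f then Some x else None)"

lemma principal_point:
  assumes f: "f \<in> idems" and x: "x \<in> fix_dom \<theta> f"
  shows "principal_point f x \<in> topspace KS_space"
proof (rule KS_I)
  show "principal_point f x \<in> extensional idems" by (simp add: principal_point_def)
  show "y \<in> fix_dom \<theta> e" if e: "e \<in> idems" and y: "principal_point f x e = Some y" for e y
  proof -
    have "y = x" "f * e = f" using e y by (auto simp: principal_point_def split: if_splits)
    then show ?thesis using fix_dom_mult[OF f e] x by auto
  qed
  show "f \<in> idems" by (rule f)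
  show "principal_point f x f \<noteq> None" using f by (simp add: principal_point_def idem)
  fix e d :: 's and y assume e: "e \<in> idems" and d: "d \<in> idems"
  have "f * (e * d) = f \<longleftrightarrow> f * e = f \<and> f * d = f"
  proof
    assume *: "f * (e * d) = f"
    have "f * e = (f * (e * d)) * e" using * by simp
    also have "\<dots> = f * (e * (d * e))" by (simp add: mult.assoc)
    also have "e * (d * e) = d * e"
      using idems_left_commute[OF e d, of e] idem[OF e] by simp
    also have "d * e = e * d" by (rule idems_commute[OF d e])
    finally have 1: "f * e = f" using * by simp
    have "f * d = (f * (e * d)) * d" using * by simp
    also have "\<dots> = f * (e * (d * d))" by (simp add: mult.assoc)
    finally show "f * e = f \<and> f * d = f" using 1 * idem[OF d] by simp
  next
    assume "f * e = f \<and> f * d = f"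
    then show "f * (e * d) = f" by (simp flip: mult.assoc)
  qed
  then show "principal_point f x (e * d) = Some y \<longleftrightarrow>
      principal_point f x e = Some y \<and> principal_point f x d = Some y"
    using e d idems_mult[OF e d] by (auto simp: principal_point_def)
  fix z assume "principal_point f x e = Some y" "principal_point f x d = Some z"
  then show "y = z" using e d by (auto simp: principal_point_def split: if_splits)
qed

lemma KS_multiplicative:
  assumes "\<tau> \<in> topspace KS_space" "e \<in> idems" "f \<in> idems"
  shows "ext_inf (\<lambda>x. g x * h x) (\<tau> (e * f)) = ext_inf g (\<tau> e) * ext_inf h (\<tau> f)"
proof (cases "\<tau> (e * f)")
  case (Some x)
  then show ?thesis using KS_mult_iff[OF assms, of x] by simp
next
  case None
  have "\<tau> e = None \<or> \<tau> f = None"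
  proof (rule ccontr)
    assume "\<not> ?thesis"
    then obtain x y where "\<tau> e = Some x" "\<tau> f = Some y" by auto
    then show False using KS_unique[OF assms] KS_mult_iff[OF assms, of x] None by auto
  qed
  then show ?thesis using None by auto
qed

text \<open>If an ideal \<open>I\<close> of idempotents contains an element \<open>d\<close> of the filter of \<open>\<tau>\<close>, then the values on \<open>I\<close>
  determine the whole filter: \<open>f\<close> belongs to it exactly if \<open>d * f\<close>, an element of \<open>I\<close>, does.\<close>

lemma KS_eqI:
  assumes "\<tau> \<in> topspace KS_space" "\<tau>' \<in> topspace KS_space"
    and I: "I \<subseteq> idems" "\<And>e f. e \<in> I \<Longrightarrow> f \<in> idems \<Longrightarrow> e * f \<in> I" "d \<in> I" "\<tau> d \<noteq> None"
    and eq: "\<And>e. e \<in> I \<Longrightarrow> \<tau> e = \<tau>' e"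
  shows "\<tau> = \<tau>'"
proof (rule extensionalityI[OF KS_extensional[OF assms(1)] KS_extensional[OF assms(2)]])
  fix f :: 's assume f: "f \<in> idems"
  have d: "d \<in> idems" using I by blast
  obtain x where x: "\<tau> d = Some x" "\<tau>' d = Some x" using I(3,4) eq[of d] by auto
  have "\<tau> f = Some y \<longleftrightarrow> \<tau>' f = Some y" for y
  proof (cases "y = x")
    case True
    then show ?thesis
      using KS_mult_iff[OF assms(1) d f, of x] KS_mult_iff[OF assms(2) d f, of x]
        eq[OF I(2)[OF I(3) f]] x by simp
  next
    case False
    then show ?thesis using KS_unique[OF assms(1) d f x(1)] KS_unique[OF assms(2) d f x(2)] by blast
  qed
  then show "\<tau> f = \<tau>' f" by (rule option_eqI)
qed

section \<open>Topology of the space XKS\<close>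

abbreviation product_space :: "('s \<Rightarrow> 'x option) topology" where
  "product_space \<equiv> product_topology (\<lambda>e. Alexandroff_compactification (sub_space X \<theta> e)) idems"

text \<open>The conditions on a point of \<open>XKS\<close>, with the point at infinity admitted.\<close>

definition KS_tilde :: "('s \<Rightarrow> 'x option) set" where
  "KS_tilde = {\<tau>. (\<forall>e1\<in>idems. \<forall>e2\<in>idems. e1 \<preceq> e2 \<and> \<tau> e1 \<noteq> None \<longrightarrow> \<tau> e2 = \<tau> e1) \<and>
     (\<forall>e1\<in>idems. \<forall>e2\<in>idems. \<tau> e1 \<noteq> None \<and> \<tau> e2 \<noteq> None \<longrightarrow> \<tau> (e1 * e2) \<noteq> None)}"

abbreviation KS_tilde_space :: "('s \<Rightarrow> 'x option) topology" where
  "KS_tilde_space \<equiv> subtopology product_space KS_tilde"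

lemma KS_space_eq: "KS_space = subtopology KS_tilde_space {\<tau>. \<tau> \<noteq> (\<lambda>e\<in>idems. None)}"
proof -
  have "KS_tilde \<inter> {\<tau>. \<tau> \<noteq> (\<lambda>e\<in>idems. None)} =
      {\<tau>. (\<forall>e1\<in>idems. \<forall>e2\<in>idems. e1 \<preceq> e2 \<and> \<tau> e1 \<noteq> None \<longrightarrow> \<tau> e2 = \<tau> e1) \<and>
           (\<forall>e1\<in>idems. \<forall>e2\<in>idems. \<tau> e1 \<noteq> None \<and> \<tau> e2 \<noteq> None \<longrightarrow> \<tau> (e1 * e2) \<noteq> None) \<and>
           \<tau> \<noteq> (\<lambda>e\<in>idems. None)}"
    unfolding KS_tilde_def by (rule set_eqI) simp
  then show ?thesis unfolding XKS_def subtopology_subtopology by simp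
qed

lemma topspace_KS_tilde_space:
  "\<tau> \<in> topspace KS_tilde_space \<Longrightarrow> \<tau> \<noteq> (\<lambda>e\<in>idems. None) \<Longrightarrow> \<tau> \<in> topspace KS_space"
  unfolding KS_space_eq by simp

lemma continuous_map_coordinate:
  assumes e: "e \<in> idems" and g: "g \<in> C0 (sub_space X \<theta> e)"
  shows "continuous_map product_space euclidean (\<lambda>\<tau>. ext_inf g (\<tau> e))"
proof -
  have "continuous_map product_space (Alexandroff_compactification (sub_space X \<theta> e)) (\<lambda>\<tau>. \<tau> e)"
    by (rule continuous_map_product_projection[OF e])
  moreover have "continuous_map (Alexandroff_compactification (sub_space X \<theta> e)) euclidean (ext_inf g)"
    using g C0_iff_continuous_Alexandroff[OF LCH_sub_space(2)[OF e]] by simp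
  ultimately show ?thesis
    using continuous_map_compose by (fastforce simp: o_def)
qed

text \<open>The two conditions on a point mean that the values \<open>g (\<tau> e)\<close> depend multiplicatively on
  \<open>\<delta>\<^sub>e g\<close>. These are equations between continuous functions of \<open>\<tau>\<close>. So adding the point at infinity
  gives a closed subspace of a product of compact spaces, although the second condition alone is not
  a closed condition.\<close>

lemma KS_tilde_iff_multiplicative:
  assumes \<tau>: "\<tau> \<in> topspace product_space"
  shows "\<tau> \<in> KS_tilde \<longleftrightarrow> (\<forall>e\<in>idems. \<forall>f\<in>idems. \<forall>g\<in>C0 (sub_space X \<theta> e). \<forall>h\<in>C0 (sub_space X \<theta> f).
    ext_inf g (\<tau> e) * ext_inf h (\<tau> f) - ext_inf (\<lambda>x. g x * h x) (\<tau> (e * f)) = 0)"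
  (is "_ \<longleftrightarrow> ?M")
proof
  assume K: "\<tau> \<in> KS_tilde"
  show ?M
  proof (cases "\<tau> = (\<lambda>e\<in>idems. None)")
    case True
    then show ?thesis using idems_mult by auto
  next
    case False
    then have "\<tau> \<in> topspace KS_space" using topspace_KS_tilde_space[of \<tau>] K \<tau> by simp
    then show ?thesis using KS_multiplicative[of \<tau>] by simp
  qed
next
  assume M: ?M
  have val: "\<tau> e \<in> insert None (Some ` fix_dom \<theta> e)" if "e \<in> idems" for e
    using \<tau> that topspace_sub_space[OF that] by (auto simp: PiE_iff)
  show "\<tau> \<in> KS_tilde"
    unfolding KS_tilde_def
  proof (intro CollectI conjI ballI impI)
    fix e f :: 's assume e: "e \<in> idems" and f: "f \<in> idems" and ef: "e \<preceq> f \<and> \<tau> e \<noteq> None"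
    obtain x where x: "\<tau> e = Some x" "x \<in> fix_dom \<theta> e" using ef val[OF e] by auto
    obtain g where g: "g \<in> C0 (sub_space X \<theta> e)" "g x = 1" by (rule sub_space_bump[OF e x(2)])
    have e_f: "e * f = e" using natural_le_trans_mult ef e f by blast
    show "\<tau> f = \<tau> e"
    proof (rule sub_space_separate[OF f val[OF f]])
      show "\<tau> e \<in> insert None (Some ` fix_dom \<theta> f)"
        using x fix_dom_mult[OF e f] e_f by auto
      fix h assume h: "h \<in> C0 (sub_space X \<theta> f)"
      have "ext_inf g (\<tau> e) * ext_inf h (\<tau> f) - ext_inf (\<lambda>x. g x * h x) (\<tau> (e * f)) = 0"
        using M e f g(1) h by blast
      then show "ext_inf h (\<tau> f) = ext_inf h (\<tau> e)" using x(1) g(2) e_f by simp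
    qed
  next
    fix e f :: 's assume e: "e \<in> idems" and f: "f \<in> idems" and ef: "\<tau> e \<noteq> None \<and> \<tau> f \<noteq> None"
    obtain x y where x: "\<tau> e = Some x" "x \<in> fix_dom \<theta> e" and y: "\<tau> f = Some y" "y \<in> fix_dom \<theta> f"
      using ef val[OF e] val[OF f] by auto
    obtain g where g: "g \<in> C0 (sub_space X \<theta> e)" "g x = 1" by (rule sub_space_bump[OF e x(2)])
    obtain h where h: "h \<in> C0 (sub_space X \<theta> f)" "h y = 1" by (rule sub_space_bump[OF f y(2)])
    have "ext_inf g (\<tau> e) * ext_inf h (\<tau> f) - ext_inf (\<lambda>x. g x * h x) (\<tau> (e * f)) = 0"
      using M e f g(1) h(1) by blast
    then show "\<tau> (e * f) \<noteq> None" using x(1) y(1) g(2) h(2) by (cases "\<tau> (e * f)") auto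
  qed
qed

lemma closedin_KS_tilde: "closedin product_space (topspace product_space \<inter> KS_tilde)"
proof -
  define \<phi> where "\<phi> = (\<lambda>(e, f, g, h) \<tau>.
    ext_inf g (\<tau> e) * ext_inf h (\<tau> f) - ext_inf (\<lambda>x. g x * h x) ((\<tau> :: 's \<Rightarrow> 'x option) (e * f)))"
  define Q where "Q = {(e, f, g, h). e \<in> idems \<and> f \<in> idems \<and>
    g \<in> C0 (sub_space X \<theta> e) \<and> h \<in> C0 (sub_space X \<theta> f)}"
  have eq: "topspace product_space \<inter> KS_tilde =
      \<Inter> (insert (topspace product_space) ((\<lambda>q. {\<tau> \<in> topspace product_space. \<phi> q \<tau> \<in> {0}}) ` Q))"
    (is "_ = \<Inter> ?S")
    using KS_tilde_iff_multiplicative by (auto simp: \<phi>_def Q_def)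
  have "closedin product_space {\<tau> \<in> topspace product_space. \<phi> q \<tau> \<in> {0}}" if "q \<in> Q" for q
  proof (rule closedin_continuous_map_preimage)
    obtain e f g h where q: "q = (e, f, g, h)" by (cases q)
    then have *: "e \<in> idems" "f \<in> idems" "g \<in> C0 (sub_space X \<theta> e)" "h \<in> C0 (sub_space X \<theta> f)"
      using that by (auto simp: Q_def)
    show "continuous_map product_space euclidean (\<phi> q)"
      unfolding q \<phi>_def prod.case
      by (intro continuous_map_diff continuous_map_mult_complex continuous_map_coordinate
          C0_sub_space_mult idems_mult *)
  qed simp
  then have "closedin product_space C" if "C \<in> ?S" for C
    using that closedin_topspace by blast
  then have "closedin product_space (\<Inter> ?S)" by (intro closedin_Inter insert_not_empty)
  then show ?thesis unfolding eq .
qed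

lemma compact_Hausdorff_KS_tilde_space: "compact_space KS_tilde_space" "Hausdorff_space KS_tilde_space"
proof -
  have "compact_space product_space" by (simp add: compact_space_product_topology)
  then have "compactin product_space (topspace product_space \<inter> KS_tilde)"
    using closedin_KS_tilde by (rule closedin_compact_space)
  then show "compact_space KS_tilde_space"
    by (metis compact_space_subtopology subtopology_restrict)
  show "Hausdorff_space KS_tilde_space"
    by (intro Hausdorff_space_subtopology)
      (simp add: Hausdorff_space_product_topology Hausdorff_space_Alexandroff_compactification LCH_sub_space)
qed

lemma LCH_KS_space: "locally_compact_space KS_space" "Hausdorff_space KS_space"
proof -
  note K = compact_Hausdorff_KS_tilde_space
  have *: "KS_space = subtopology KS_tilde_space (topspace KS_tilde_space - {\<lambda>e\<in>idems. None})"
    unfolding KS_space_eq subtopology_restrict[of KS_tilde_space "{\<tau>. \<tau> \<noteq> (\<lambda>e\<in>idems. None)}", symmetric]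
    by (rule arg_cong[where f = "subtopology KS_tilde_space"]) blast
  show "Hausdorff_space KS_space"
    unfolding * by (rule Hausdorff_space_subtopology[OF K(2)])
  have "openin KS_tilde_space (topspace KS_tilde_space - {\<lambda>e\<in>idems. None})"
    using open_in_Hausdorff_delete[OF K(2) openin_topspace] .
  then show "locally_compact_space KS_space"
    unfolding * using K by (intro locally_compact_space_open_subset compact_imp_locally_compact_space) auto
qed

lemma openin_KS_dom: "e \<in> idems \<Longrightarrow> openin KS_space (XKS_dom X \<theta> e)"
proof -
  assume e: "e \<in> idems"
  have "continuous_map KS_space (Alexandroff_compactification (sub_space X \<theta> e)) (\<lambda>\<tau>. \<tau> e)"
    unfolding XKS_def by (intro continuous_map_from_subtopology continuous_map_product_projection e)
  moreover have "openin (Alexandroff_compactification (sub_space X \<theta> e)) (Some ` topspace (sub_space X \<theta> e))"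
    by (simp only: openin_Alexandroff_compactification_image_Some openin_topspace)
  ultimately have "openin KS_space {\<tau> \<in> topspace KS_space. \<tau> e \<in> Some ` topspace (sub_space X \<theta> e)}"
    by (rule openin_continuous_map_preimage)
  moreover have "{\<tau> \<in> topspace KS_space. \<tau> e \<in> Some ` topspace (sub_space X \<theta> e)} = XKS_dom X \<theta> e"
    unfolding XKS_dom_def topspace_sub_space[OF e] using KS_value[OF _ e] by fastforce
  ultimately show ?thesis by simp
qed

text \<open>A level set of \<open>\<tau> \<mapsto> g (\<tau> e)\<close> is closed in the compact space with the point at infinity, and
  avoids that point.\<close>

lemma C0_coordinate:
  assumes e: "e \<in> idems" and g: "g \<in> C0 (sub_space X \<theta> e)"
  shows "zero_off (topspace KS_space) (\<lambda>\<tau>. ext_inf g (\<tau> e)) \<in> C0 KS_space"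
proof -
  let ?f = "zero_off (topspace KS_space) (\<lambda>\<tau>. ext_inf g (\<tau> e))"
  have "continuous_map KS_space euclidean (\<lambda>\<tau>. ext_inf g (\<tau> e))"
    unfolding XKS_def by (intro continuous_map_from_subtopology continuous_map_coordinate assms)
  then have cont: "continuous_map KS_space euclidean ?f"
    by (rule continuous_map_eq) (simp add: zero_off_def)
  have "compactin KS_space {\<tau> \<in> topspace KS_space. r \<le> cmod (?f \<tau>)}" if r: "r > 0" for r
  proof -
    let ?L = "{\<tau> \<in> topspace KS_tilde_space. cmod (ext_inf g (\<tau> e)) \<in> {r..}}"
    have "continuous_map KS_tilde_space euclideanreal (\<lambda>\<tau>. cmod (ext_inf g (\<tau> e)))"
      by (intro continuous_map_norm continuous_map_from_subtopology continuous_map_coordinate assms)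
    then have "closedin KS_tilde_space ?L" by (rule closedin_continuous_map_preimage) simp
    then have "compactin KS_tilde_space ?L"
      by (rule closedin_compact_space[OF compact_Hausdorff_KS_tilde_space(1)])
    moreover have L: "?L \<subseteq> {\<tau>. \<tau> \<noteq> (\<lambda>e\<in>idems. None)}" using r e by auto
    ultimately have "compactin KS_space ?L"
      unfolding KS_space_eq by (simp add: compactin_subtopology)
    moreover have "?L = {\<tau> \<in> topspace KS_space. r \<le> cmod (?f \<tau>)}"
    proof (intro equalityI subsetI)
      fix \<tau> assume "\<tau> \<in> ?L"
      then show "\<tau> \<in> {\<tau> \<in> topspace KS_space. r \<le> cmod (?f \<tau>)}"
        using L topspace_KS_tilde_space[of \<tau>] by (simp add: zero_off_def subset_iff)
    next
      fix \<tau> assume "\<tau> \<in> {\<tau> \<in> topspace KS_space. r \<le> cmod (?f \<tau>)}"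
      then have t: "\<tau> \<in> topspace KS_space" and "r \<le> cmod (?f \<tau>)" by blast+
      moreover have "\<tau> \<in> topspace KS_tilde_space"
        using t unfolding KS_space_eq topspace_subtopology by blast
      ultimately show "\<tau> \<in> ?L"
        by (simp only: zero_off_def if_True mem_Collect_eq atLeast_iff conj_absorb)
    qed
    ultimately show ?thesis by simp
  qed
  then show ?thesis using cont by (simp add: C0_def zero_off_def)
qed

section \<open>The convolution algebra and its representation by functions on XKS\<close>

abbreviation D :: "('s \<Rightarrow> 'x \<Rightarrow> complex) star_alg" where
  "D \<equiv> KS_direct_sum X \<theta>"

lemma D_simps:
  "vzero D = (\<lambda>_ _. 0)" "vadd D a b = (\<lambda>e x. a e x + b e x)" "vscale D c a = (\<lambda>e x. c * a e x)"
  "vmult D a b = (\<lambda>d x. \<Sum>(e, f)\<in>{(e, f) \<in> supp a \<times> supp b. e * f = d}. a e x * b f x)"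
  "vstar D a = (\<lambda>e x. cnj (a e x))"
  by (simp_all add: KS_direct_sum_def)

lemma D_carr:
  "a \<in> carr D \<longleftrightarrow> finite (supp a) \<and> supp a \<subseteq> idems \<and> (\<forall>e\<in>idems. a e \<in> C0 (sub_space X \<theta> e))"
  by (simp add: KS_direct_sum_def)

lemma D_finite: "a \<in> carr D \<Longrightarrow> finite (supp a)"
  and D_supp: "a \<in> carr D \<Longrightarrow> supp a \<subseteq> idems"
  and D_C0: "a \<in> carr D \<Longrightarrow> e \<in> idems \<Longrightarrow> a e \<in> C0 (sub_space X \<theta> e)"
  by (simp_all add: D_carr)

lemma not_supp: "e \<notin> supp a \<Longrightarrow> a e = (\<lambda>_. 0)"
  by (simp add: supp_def)

lemma supp_ops:
  "supp (vadd D a b) \<subseteq> supp a \<union> supp b" "supp (vscale D c a) \<subseteq> supp a" "supp (vstar D a) \<subseteq> supp a"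
  by (auto simp: D_simps supp_def)

lemma supp_vmult: "supp (vmult D a b) \<subseteq> (\<lambda>(e, f). e * f) ` (supp a \<times> supp b)"
proof
  fix d assume d: "d \<in> supp (vmult D a b)"
  show "d \<in> (\<lambda>(e, f). e * f) ` (supp a \<times> supp b)"
  proof (rule ccontr)
    assume "\<not> ?thesis"
    then have "{(e, f) \<in> supp a \<times> supp b. e * f = d} = {}" by auto
    then have "vmult D a b d = (\<lambda>_. 0)" by (simp only: D_simps sum.empty)
    then show False using d by (simp add: supp_def)
  qed
qed

lemma D_vzero: "vzero D \<in> carr D"
  unfolding D_carr D_simps by (simp add: supp_def C0_zero)

lemma D_vadd: "a \<in> carr D \<Longrightarrow> b \<in> carr D \<Longrightarrow> vadd D a b \<in> carr D"
  using supp_ops(1)[of a b] finite_subset[OF supp_ops(1)[of a b]]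
  unfolding D_carr by (auto simp: D_simps(2) intro: C0_add)

lemma D_vscale: "a \<in> carr D \<Longrightarrow> vscale D c a \<in> carr D"
  using supp_ops(2)[of c a] finite_subset[OF supp_ops(2)[of c a]]
  unfolding D_carr by (auto simp: D_simps(3) intro: C0_scale)

lemma D_vstar: "a \<in> carr D \<Longrightarrow> vstar D a \<in> carr D"
  using supp_ops(3)[of a] finite_subset[OF supp_ops(3)[of a]]
  unfolding D_carr by (auto simp: D_simps(5) intro: C0_cnj)

lemma D_vmult:
  assumes a: "a \<in> carr D" and b: "b \<in> carr D" shows "vmult D a b \<in> carr D"
  unfolding D_carr
proof (intro conjI ballI)
  show "finite (supp (vmult D a b))"
    by (rule finite_subset[OF supp_vmult]) (intro finite_imageI finite_cartesian_product D_finite a b)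
  show "supp (vmult D a b) \<subseteq> idems"
    using supp_vmult[of a b] D_supp[OF a] D_supp[OF b] idems_mult by fast
  fix d :: 's assume d: "d \<in> idems"
  show "vmult D a b d \<in> C0 (sub_space X \<theta> d)"
    unfolding D_simps
  proof (rule C0_sum)
    fix p assume "p \<in> {(e, f). (e, f) \<in> supp a \<times> supp b \<and> e * f = d}"
    then obtain e f where p: "p = (e, f)" "e \<in> supp a" "f \<in> supp b" "e * f = d" by auto
    have ef: "e \<in> idems" "f \<in> idems" using p D_supp[OF a] D_supp[OF b] by auto
    show "(\<lambda>x. case p of (e, f) \<Rightarrow> a e x * b f x) \<in> C0 (sub_space X \<theta> d)"
      using C0_sub_space_mult[OF ef D_C0[OF a ef(1)] D_C0[OF b ef(2)]] p by simp
  qed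
qed

lemma closed_under_ops_D: "closed_under_ops D"
  unfolding closed_under_ops_def using D_vadd D_vscale D_vmult D_vstar by blast

lemma supp_delta: "supp (delta e g) \<subseteq> {e}"
  by (auto simp: supp_def delta_def)

lemma delta_D:
  assumes "e \<in> idems" "g \<in> C0 (sub_space X \<theta> e)" shows "delta e g \<in> carr D"
  unfolding D_carr
proof (intro conjI ballI)
  show "finite (supp (delta e g))" by (rule finite_subset[OF supp_delta]) simp
  show "supp (delta e g) \<subseteq> idems" using supp_delta[of e g] assms(1) by auto
  show "delta e g f \<in> C0 (sub_space X \<theta> f)" for f using assms(2) by (auto simp: delta_def C0_zero)
qed

lemma star_hom_delta: "e \<in> idems \<Longrightarrow> star_hom (C0_alg (sub_space X \<theta> e)) D (delta e)"
  unfolding star_hom_def C0_alg_simps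
  using delta_D KS_direct_sum_mult_delta[of X \<theta> e _ e] KS_direct_sum_star_delta[of X \<theta> e] idem[of e]
  by (auto simp: D_simps delta_def fun_eq_iff)

text \<open>For fixed \<open>\<tau>\<close>, the map \<open>a \<mapsto> ev a \<tau>\<close> is the character of \<open>D\<close> given by \<open>\<tau>\<close>.\<close>

definition ev :: "('s \<Rightarrow> 'x \<Rightarrow> complex) \<Rightarrow> ('s \<Rightarrow> 'x option) \<Rightarrow> complex" where
  "ev a = zero_off (topspace KS_space) (\<lambda>\<tau>. \<Sum>e\<in>supp a. ext_inf (a e) (\<tau> e))"

lemma ev_eq_sum:
  assumes "finite F" "supp a \<subseteq> F" "\<tau> \<in> topspace KS_space"
  shows "ev a \<tau> = (\<Sum>e\<in>F. ext_inf (a e) (\<tau> e))"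
proof -
  have "ext_inf (a e) (\<tau> e) = 0" if "e \<in> F - supp a" for e
    using that not_supp[of e a] ext_inf_linear(4) by simp
  then have "(\<Sum>e\<in>supp a. ext_inf (a e) (\<tau> e)) = (\<Sum>e\<in>F. ext_inf (a e) (\<tau> e))"
    using assms by (intro sum.mono_neutral_left) auto
  then show ?thesis using assms(3) by (simp only: ev_def zero_off_def if_True)
qed

lemma ev_off: "\<tau> \<notin> topspace KS_space \<Longrightarrow> ev a \<tau> = 0"
  by (simp only: ev_def zero_off_def if_False)

lemma ev_delta:
  assumes "\<tau> \<in> topspace KS_space" shows "ev (delta e g) \<tau> = ext_inf g (\<tau> e)"
  using ev_eq_sum[OF _ supp_delta assms, of e g] by (simp add: delta_def)

lemma ev_C0:
  assumes a: "a \<in> carr D" shows "ev a \<in> C0 KS_space"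
proof -
  have "ev a = (\<lambda>\<tau>. \<Sum>e\<in>supp a. zero_off (topspace KS_space) (\<lambda>\<tau>. ext_inf (a e) (\<tau> e)) \<tau>)"
    by (rule ext) (simp only: ev_def zero_off_def split: if_split, simp)
  moreover have "\<dots> \<in> C0 KS_space"
  proof (rule C0_sum)
    fix e assume "e \<in> supp a"
    then have e: "e \<in> idems" using D_supp[OF a] by auto
    show "zero_off (topspace KS_space) (\<lambda>\<tau>. ext_inf (a e) (\<tau> e)) \<in> C0 KS_space"
      by (rule C0_coordinate[OF e D_C0[OF a e]])
  qed
  ultimately show ?thesis by simp
qed

lemma ev_vmult:
  assumes a: "a \<in> carr D" and b: "b \<in> carr D" and \<tau>: "\<tau> \<in> topspace KS_space"
  shows "ev (vmult D a b) \<tau> = ev a \<tau> * ev b \<tau>"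
proof -
  let ?S = "supp a \<times> supp b"
  let ?m = "\<lambda>(e, f). e * f :: 's"
  let ?t = "\<lambda>(e, f). ext_inf (a e) (\<tau> e) * ext_inf (b f) (\<tau> f)"
  have fin: "finite ?S" using D_finite[OF a] D_finite[OF b] by simp
  have "ev (vmult D a b) \<tau> = (\<Sum>d\<in>?m ` ?S. ext_inf (vmult D a b d) (\<tau> d))"
    by (rule ev_eq_sum[OF finite_imageI[OF fin] supp_vmult \<tau>])
  also have "\<dots> = (\<Sum>d\<in>?m ` ?S. \<Sum>p\<in>{p. p \<in> ?S \<and> ?m p = d}. ?t p)"
  proof (rule sum.cong[OF refl])
    fix d
    have "ext_inf (vmult D a b d) (\<tau> d) =
        (\<Sum>p\<in>{(e, f). (e, f) \<in> ?S \<and> e * f = d}. ext_inf (\<lambda>x. case p of (e, f) \<Rightarrow> a e x * b f x) (\<tau> d))"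
      unfolding D_simps by (rule ext_inf_sum)
    also have "\<dots> = (\<Sum>p\<in>{(e, f). (e, f) \<in> ?S \<and> e * f = d}. ?t p)"
    proof (rule sum.cong[OF refl])
      fix p assume "p \<in> {(e, f). (e, f) \<in> ?S \<and> e * f = d}"
      then obtain e f where p: "p = (e, f)" "e \<in> supp a" "f \<in> supp b" "e * f = d" by auto
      have ef: "e \<in> idems" "f \<in> idems" using p D_supp[OF a] D_supp[OF b] by auto
      show "ext_inf (\<lambda>x. case p of (e, f) \<Rightarrow> a e x * b f x) (\<tau> d) = ?t p"
        using KS_multiplicative[OF \<tau> ef] p by simp
    qed
    also have "{(e, f). (e, f) \<in> ?S \<and> e * f = d} = {p. p \<in> ?S \<and> ?m p = d}" by auto
    finally show "ext_inf (vmult D a b d) (\<tau> d) = (\<Sum>p\<in>{p. p \<in> ?S \<and> ?m p = d}. ?t p)" .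
  qed
  also have "\<dots> = (\<Sum>p\<in>?S. ?t p)" by (rule sum.image_gen[OF fin, symmetric])
  also have "\<dots> = (\<Sum>e\<in>supp a. ext_inf (a e) (\<tau> e)) * (\<Sum>f\<in>supp b. ext_inf (b f) (\<tau> f))"
    by (simp only: sum_product sum.cartesian_product)
  also have "\<dots> = ev a \<tau> * ev b \<tau>"
    using ev_eq_sum[OF D_finite[OF a] order_refl \<tau>] ev_eq_sum[OF D_finite[OF b] order_refl \<tau>]
    by (simp only:)
  finally show ?thesis .
qed

lemma star_hom_ev: "star_hom D (C0_alg KS_space) ev"
  unfolding star_hom_def C0_alg_simps
proof (intro conjI ballI allI)
  fix a c assume a: "a \<in> carr D"
  note fin = D_finite[OF a]
  show "ev a \<in> C0 KS_space" by (rule ev_C0[OF a])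
  show "ev (vscale D c a) = (\<lambda>\<tau>. c * ev a \<tau>)"
  proof
    fix \<tau> show "ev (vscale D c a) \<tau> = c * ev a \<tau>"
    proof (cases "\<tau> \<in> topspace KS_space")
      case True
      show ?thesis
        unfolding ev_eq_sum[OF fin supp_ops(2) True] ev_eq_sum[OF fin order_refl True]
        unfolding D_simps ext_inf_linear sum_distrib_left ..
    next
      case False
      show ?thesis by (simp only: ev_off[OF False] mult_zero_right)
    qed
  qed
  show "ev (vstar D a) = (\<lambda>\<tau>. cnj (ev a \<tau>))"
  proof
    fix \<tau> show "ev (vstar D a) \<tau> = cnj (ev a \<tau>)"
    proof (cases "\<tau> \<in> topspace KS_space")
      case True
      show ?thesis
        unfolding ev_eq_sum[OF fin supp_ops(3) True] ev_eq_sum[OF fin order_refl True]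
        unfolding D_simps ext_inf_linear cnj_sum ..
    next
      case False
      show ?thesis by (simp only: ev_off[OF False] complex_cnj_zero)
    qed
  qed
next
  fix a b assume a: "a \<in> carr D" and b: "b \<in> carr D"
  have fin: "finite (supp a \<union> supp b)" using D_finite[OF a] D_finite[OF b] by simp
  show "ev (vadd D a b) = (\<lambda>\<tau>. ev a \<tau> + ev b \<tau>)"
  proof
    fix \<tau> show "ev (vadd D a b) \<tau> = ev a \<tau> + ev b \<tau>"
    proof (cases "\<tau> \<in> topspace KS_space")
      case True
      show ?thesis
        unfolding ev_eq_sum[OF fin supp_ops(1) True] ev_eq_sum[OF fin Un_upper1 True]
          ev_eq_sum[OF fin Un_upper2 True]
        unfolding D_simps ext_inf_linear sum.distrib ..
    next
      case False
      show ?thesis by (simp only: ev_off[OF False] add_0_right)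
    qed
  qed
  show "ev (vmult D a b) = (\<lambda>\<tau>. ev a \<tau> * ev b \<tau>)"
  proof
    fix \<tau> show "ev (vmult D a b) \<tau> = ev a \<tau> * ev b \<tau>"
    proof (cases "\<tau> \<in> topspace KS_space")
      case True
      show ?thesis by (rule ev_vmult[OF a b True])
    next
      case False
      show ?thesis by (simp only: ev_off[OF False] mult_zero_right)
    qed
  qed
qed

section \<open>The enveloping norm\<close>

text \<open>The values of \<open>ev a\<close> at principal points determine the coefficients of \<open>a\<close> by a triangular
  system of equations: the value at the point of \<open>x\<close> and \<open>e\<close> is \<open>a e x\<close> plus the coefficients at larger
  idempotents. Only finitely many idempotents occur, so the inverse of the system is bounded.\<close>

lemma coefficient_bound:
  assumes F: "finite F" "F \<subseteq> idems" and e: "e \<in> F"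
  shows "\<exists>C\<ge>0. \<forall>a\<in>carr D. supp a \<subseteq> F \<longrightarrow> (\<forall>x. cmod (a e x) \<le> C * unorm (ev a))"
  using e
proof (induction "card {f \<in> F. e * f = e \<and> f \<noteq> e}" arbitrary: e rule: less_induct)
  case less
  let ?U = "\<lambda>e. {f \<in> F. e * f = e \<and> f \<noteq> e}"
  have eI: "e \<in> idems" using less.prems F by auto
  have "\<exists>C\<ge>0. \<forall>a\<in>carr D. supp a \<subseteq> F \<longrightarrow> (\<forall>x. cmod (a f x) \<le> C * unorm (ev a))" if f: "f \<in> ?U e" for f
  proof (rule less.hyps)
    have fI: "f \<in> idems" and ef: "e * f = e" "f \<noteq> e" "f \<in> F" using f F by auto
    have "?U f \<subset> ?U e"
    proof
      show "?U f \<subseteq> ?U e"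
      proof
        fix d assume d: "d \<in> ?U f"
        then have dI: "d \<in> idems" and fd: "f * d = f" "d \<in> F" using F by auto
        have "e * d = e * f * d" using ef by simp
        also have "\<dots> = e" unfolding mult.assoc fd(1) by (rule ef)
        finally have ed: "e * d = e" .
        have "d \<noteq> e"
        proof
          assume "d = e"
          then have "f * e = f" using fd by simp
          then show False using ef idems_commute[OF eI fI] by simp
        qed
        then show "d \<in> ?U e" using ed fd by simp
      qed
      show "?U f \<noteq> ?U e" using f by blast
    qed
    then show "card (?U f) < card (?U e)" using F by (intro psubset_card_mono) auto
    show "f \<in> F" by (rule ef)
  qed
  then have "\<forall>f\<in>?U e. \<exists>C\<ge>0. \<forall>a\<in>carr D. supp a \<subseteq> F \<longrightarrow> (\<forall>x. cmod (a f x) \<le> C * unorm (ev a))"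
    by (rule ballI)
  from bchoice[OF this] obtain C where C_all: "\<forall>f\<in>?U e. C f \<ge> 0 \<and>
      (\<forall>a\<in>carr D. supp a \<subseteq> F \<longrightarrow> (\<forall>x. cmod (a f x) \<le> C f * unorm (ev a)))" ..
  have C: "C f \<ge> 0" "cmod (a f x) \<le> C f * unorm (ev a)"
    if "f \<in> ?U e" "a \<in> carr D" "supp a \<subseteq> F" for f a x
    using bspec[OF C_all that(1)] that(2,3) by simp_all
  define K where "K = 1 + (\<Sum>f\<in>?U e. C f)"
  have K0: "K \<ge> 0" unfolding K_def using C_all by (intro add_nonneg_nonneg sum_nonneg zero_le_one) blast
  have "cmod (a e x) \<le> K * unorm (ev a)" if a: "a \<in> carr D" "supp a \<subseteq> F" for a x
  proof (cases "x \<in> fix_dom \<theta> e")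
    case False
    then have "a e x = 0" using C0_off[OF D_C0[OF a(1) eI], of x] topspace_sub_space[OF eI] by simp
    then show ?thesis using K0 unorm_nonneg[OF ev_C0[OF a(1)]] by simp
  next
    case True
    let ?p = "principal_point e x"
    have p: "?p \<in> topspace KS_space" by (rule principal_point[OF eI True])
    have val: "ext_inf (a f) (?p f) = (if e * f = e then a f x else 0)" if "f \<in> F" for f
      using that F by (auto simp: principal_point_def)
    have "ev a ?p = (\<Sum>f\<in>F. if e * f = e then a f x else 0)"
      unfolding ev_eq_sum[OF F(1) a(2) p] by (intro sum.cong refl val)
    also have "\<dots> = (\<Sum>f\<in>{f \<in> F. e * f = e}. a f x)"
      using F(1) by (simp add: sum.If_cases Int_def)
    also have "{f \<in> F. e * f = e} = insert e (?U e)" using less.prems idem[OF eI] by auto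
    also have "(\<Sum>f\<in>insert e (?U e). a f x) = a e x + (\<Sum>f\<in>?U e. a f x)"
      using F(1) by (subst sum.insert) auto
    finally have "a e x = ev a ?p - (\<Sum>f\<in>?U e. a f x)" by simp
    then have "cmod (a e x) \<le> cmod (ev a ?p) + cmod (\<Sum>f\<in>?U e. a f x)"
      by (simp only: norm_triangle_ineq4)
    also have "\<dots> \<le> unorm (ev a) + (\<Sum>f\<in>?U e. C f * unorm (ev a))"
      by (intro add_mono unorm_upper[OF ev_C0[OF a(1)]] sum_norm_le C(2) a)
    also have "\<dots> = K * unorm (ev a)" by (simp add: K_def algebra_simps sum_distrib_left sum_distrib_right)
    finally show ?thesis .
  qed
  then show ?case using K0 by blast
qed

lemma cstar_seminorm_delta_le:
  assumes p: "cstar_seminorm D p" and e: "e \<in> idems" "g \<in> C0 (sub_space X \<theta> e)"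
  shows "p (delta e g) \<le> unorm g"
  using cstar_seminorm_C0_le_unorm[OF cstar_seminorm_pullback[OF star_hom_delta[OF e(1)] p] e(2)]
  by (simp add: C0_cnj)

text \<open>Each summand of \<open>D\<close> is a copy of a function algebra, on which the supremum norm is the largest
  C*-seminorm.\<close>

lemma cstar_seminorm_le_sum:
  assumes p: "cstar_seminorm D p" and F: "finite F"
  shows "a \<in> carr D \<Longrightarrow> supp a \<subseteq> F \<Longrightarrow> p a \<le> (\<Sum>e\<in>F. unorm (a e))"
  using F
proof (induction F arbitrary: a)
  case empty
  then have "a = vscale D 0 (vzero D)" using not_supp[of _ a] by (simp add: D_simps fun_eq_iff)
  moreover have "p (vscale D 0 (vzero D)) = cmod 0 * p (vzero D)"
    using p D_vzero unfolding cstar_seminorm_def by blast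
  ultimately show ?case by simp
next
  case (insert e F)
  show ?case
  proof (cases "e \<in> idems")
    case False
    then have e: "e \<notin> supp a" using D_supp[OF insert.prems(1)] by blast
    then have "supp a \<subseteq> F" using insert.prems(2) by blast
    then have "p a \<le> (\<Sum>f\<in>F. unorm (a f))" by (rule insert.IH[OF insert.prems(1)])
    moreover have "unorm (a e) = 0" unfolding not_supp[OF e] by (simp add: unorm_def)
    ultimately show ?thesis using insert.hyps by simp
  next
    case e: True
    let ?b = "a(e := (\<lambda>_. 0))"
    have sb: "supp ?b \<subseteq> F" "supp ?b \<subseteq> supp a" using insert.prems(2) by (auto simp: supp_def)
    have b: "?b \<in> carr D"
      unfolding D_carr using insert.prems(1) sb(2) finite_subset[OF sb(2)]
      by (auto simp: D_carr C0_zero)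
    have d: "delta e (a e) \<in> carr D" by (rule delta_D[OF e D_C0[OF insert.prems(1) e]])
    have "a = vadd D (delta e (a e)) ?b" by (auto simp: D_simps delta_def fun_eq_iff)
    then have "p a = p (vadd D (delta e (a e)) ?b)" by simp
    also have "\<dots> \<le> p (delta e (a e)) + p ?b"
      using p d b unfolding cstar_seminorm_def by blast
    also have "\<dots> \<le> unorm (a e) + (\<Sum>f\<in>F. unorm (?b f))"
      by (intro add_mono cstar_seminorm_delta_le[OF p e D_C0[OF insert.prems(1) e]] insert.IH[OF b sb(1)])
    also have "(\<Sum>f\<in>F. unorm (?b f)) = (\<Sum>f\<in>F. unorm (a f))"
      using insert.hyps by (intro sum.cong) auto
    finally show ?thesis using insert.hyps by simp
  qed
qed

lemma le_of_double_power_le: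
  fixes x y C :: real
  assumes "\<And>n. x ^ (2 ^ n) \<le> C * y ^ (2 ^ n)" "0 \<le> x" "0 \<le> y"
  shows "x \<le> y"
proof (rule ccontr)
  assume xy: "\<not> x \<le> y"
  show False
  proof (cases "y = 0")
    case True
    then show ?thesis using assms(1)[of 0] xy by simp
  next
    case False
    then have y: "y > 0" using assms(3) by simp
    then have q: "x / y > 1" using xy by simp
    obtain n where n: "C < (x / y) ^ n" using real_arch_pow[OF q] by blast
    also have "(x / y) ^ n \<le> (x / y) ^ (2 ^ n)" using q by (intro power_increasing) auto
    also have "\<dots> \<le> C" using assms(1)[of n] y by (simp add: power_divide divide_le_eq)
    finally show False by simp
  qed
qed

text \<open>Let \<open>a\<close> be supported in a finite multiplicatively closed set. There \<open>p\<close> is dominated by a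
  constant times the norm of \<open>ev a\<close>. The constant disappears when \<open>a\<close> is replaced repeatedly by \<open>a\<^sup>* a\<close>,
  which squares both norms.\<close>

lemma cstar_seminorm_le_ev:
  assumes p: "cstar_seminorm D p" and a: "a \<in> carr D"
  shows "p a \<le> unorm (ev a)"
proof -
  obtain G where G: "finite G" "supp a \<subseteq> G" "G \<subseteq> idems" "\<And>e f. e \<in> G \<Longrightarrow> f \<in> G \<Longrightarrow> e * f \<in> G"
    by (rule finite_subsemilattice[OF D_finite[OF a] D_supp[OF a]]) (rule that)
  have "\<forall>e\<in>G. \<exists>C\<ge>0. \<forall>a\<in>carr D. supp a \<subseteq> G \<longrightarrow> (\<forall>x. cmod (a e x) \<le> C * unorm (ev a))"
    using coefficient_bound[OF G(1,3)] by blast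
  from bchoice[OF this] obtain C where C_all: "\<forall>e\<in>G. C e \<ge> 0 \<and>
      (\<forall>a\<in>carr D. supp a \<subseteq> G \<longrightarrow> (\<forall>x. cmod (a e x) \<le> C e * unorm (ev a)))" ..
  have C: "cmod (b e x) \<le> C e * unorm (ev b)" if "e \<in> G" "b \<in> carr D" "supp b \<subseteq> G" for e b x
    using bspec[OF C_all that(1)] that(2,3) by simp
  have dom: "p b \<le> (\<Sum>e\<in>G. C e) * unorm (ev b)" if b: "b \<in> carr D" "supp b \<subseteq> G" for b
  proof -
    have "p b \<le> (\<Sum>e\<in>G. unorm (b e))" by (rule cstar_seminorm_le_sum[OF p G(1) b])
    also have "\<dots> \<le> (\<Sum>e\<in>G. C e * unorm (ev b))"
      by (intro sum_mono unorm_least C b)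
    finally show ?thesis by (simp add: sum_distrib_right)
  qed
  let ?q = "\<lambda>b. vmult D (vstar D b) b"
  have step: "?q b \<in> carr D \<and> supp (?q b) \<subseteq> G" if "b \<in> carr D \<and> supp b \<subseteq> G" for b
  proof
    show "?q b \<in> carr D" using that by (intro D_vmult D_vstar) auto
    show "supp (?q b) \<subseteq> G"
      using supp_vmult[of "vstar D b" b] supp_ops(3)[of b] that G(4) by fast
  qed
  have iter: "(?q ^^ n) a \<in> carr D \<and> supp ((?q ^^ n) a) \<subseteq> G" for n
    by (induction n) (use a G(2) step in auto)
  have sq: "p (?q b) = (p b)\<^sup>2" "unorm (ev (?q b)) = (unorm (ev b))\<^sup>2" if "b \<in> carr D" for b
  proof -
    show "p (?q b) = (p b)\<^sup>2" using p that unfolding cstar_seminorm_def by blast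
    have "cstar_seminorm D (\<lambda>b. unorm (ev b))"
      by (rule cstar_seminorm_pullback[OF star_hom_ev cstar_seminorm_unorm D_vstar])
    then show "unorm (ev (?q b)) = (unorm (ev b))\<^sup>2" using that unfolding cstar_seminorm_def by blast
  qed
  have pow: "p ((?q ^^ n) a) = p a ^ (2 ^ n)" "unorm (ev ((?q ^^ n) a)) = unorm (ev a) ^ (2 ^ n)" for n
  proof (induction n)
    case (Suc n)
    { case 1 then show ?case using sq(1)[of "(?q ^^ n) a"] iter[of n] Suc by (simp add: mult.commute flip: power_mult) }
    { case 2 then show ?case using sq(2)[of "(?q ^^ n) a"] iter[of n] Suc by (simp add: mult.commute flip: power_mult) }
  qed auto
  show ?thesis
  proof (rule le_of_double_power_le)
    show "p a ^ (2 ^ n) \<le> (\<Sum>e\<in>G. C e) * unorm (ev a) ^ (2 ^ n)" for n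
      using dom[of "(?q ^^ n) a"] iter[of n] pow[of n] by simp
    show "0 \<le> p a" using p a unfolding cstar_seminorm_def by blast
    show "0 \<le> unorm (ev a)" by (rule unorm_nonneg[OF ev_C0[OF a]])
  qed
qed

lemma env_seminorm_eq: "a \<in> carr D \<Longrightarrow> env_seminorm D a = unorm (ev a)"
  unfolding env_seminorm_def
proof (rule cSup_eq_maximum)
  assume a: "a \<in> carr D"
  have "cstar_seminorm D (\<lambda>b. unorm (ev b))"
    by (rule cstar_seminorm_pullback[OF star_hom_ev cstar_seminorm_unorm D_vstar])
  then show "unorm (ev a) \<in> (\<lambda>p. p a) ` {p. cstar_seminorm D p}" by (intro image_eqI CollectI) simp
  show "t \<le> unorm (ev a)" if "t \<in> (\<lambda>p. p a) ` {p. cstar_seminorm D p}" for t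
    using that cstar_seminorm_le_ev[OF _ a] by blast
qed

section \<open>Density of the image\<close>

lemma ev_eq_0:
  assumes a: "a \<in> carr D" "supp a \<subseteq> I" and None: "\<And>e. e \<in> I \<Longrightarrow> \<tau> e = None"
  shows "ev a \<tau> = 0"
proof (cases "\<tau> \<in> topspace KS_space")
  case True
  have "ext_inf (a e) (\<tau> e) = 0" if "e \<in> supp a" for e
    using None[of e] that a(2) by auto
  then show ?thesis
    unfolding ev_eq_sum[OF D_finite[OF a(1)] order_refl True] by (simp add: sum.neutral)
qed (rule ev_off)

text \<open>The functions \<open>ev a\<close> with \<open>a\<close> supported in \<open>I\<close> form a star-algebra. They separate the points of \<open>U\<close>, since
  such a point is determined by its values on \<open>I\<close>. The case of all idempotents gives density in the
  functions on \<open>XKS\<close>; the idempotents below \<open>e\<close> give the ideal of \<open>e\<close>.\<close>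

lemma dense_ideal:
  assumes I: "I \<subseteq> idems" "\<And>e f. e \<in> I \<Longrightarrow> f \<in> idems \<Longrightarrow> e * f \<in> I"
    and U: "U = {\<tau> \<in> topspace KS_space. \<exists>e\<in>I. \<tau> e \<noteq> None}"
    and f: "f \<in> C0 (subtopology KS_space U)" and r: "r > 0"
  obtains a where "a \<in> carr D" "supp a \<subseteq> I" "\<And>\<tau>. cmod (f \<tau> - ev a \<tau>) < r"
proof -
  let ?A = "{ev a | a. a \<in> carr D \<and> supp a \<subseteq> I}"
  let ?Y = "subtopology KS_space U"
  have U_eq: "U = (\<Union>e\<in>I. XKS_dom X \<theta> e)" unfolding U XKS_dom_def by blast
  have oU: "openin KS_space U" unfolding U_eq using I(1) openin_KS_dom by blast
  have tY: "topspace ?Y = U" using openin_subset[OF oU] by (simp only: topspace_subtopology inf_absorb2)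
  have Y: "locally_compact_space ?Y" "Hausdorff_space ?Y"
    using locally_compact_space_open_subset[OF _ LCH_KS_space(1) oU] LCH_KS_space(2)
      Hausdorff_space_subtopology by blast+
  have hom: "ev (vadd D a b) = (\<lambda>y. ev a y + ev b y)" "ev (vmult D a b) = (\<lambda>y. ev a y * ev b y)"
    "ev (vscale D c a) = (\<lambda>y. c * ev a y)" "ev (vstar D a) = (\<lambda>y. cnj (ev a y))"
    if "a \<in> carr D" "b \<in> carr D" for a b c
    using star_hom_ev that by (simp_all add: star_hom_def)
  have deltaA: "ev (delta e g) \<in> ?A" if "e \<in> I" "g \<in> C0 (sub_space X \<theta> e)" for e g
    using that delta_D[of e g] supp_delta[of e g] I(1) by blast
  obtain h where h: "h \<in> ?A" "\<And>\<tau>. cmod (f \<tau> - h \<tau>) < r"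
  proof (rule C0_Stone_Weierstrass[OF Y _ _ _ _ _ _ _ _ f r])
    show "?A \<subseteq> C0 ?Y"
    proof
      fix h assume "h \<in> ?A"
      then obtain a where a: "a \<in> carr D" "supp a \<subseteq> I" "h = ev a" by blast
      have "ev a \<tau> = 0" if "\<tau> \<notin> U" for \<tau>
      proof (cases "\<tau> \<in> topspace KS_space")
        case True
        then show ?thesis using that unfolding U by (intro ev_eq_0[OF a(1,2)]) blast
      qed (rule ev_off)
      then show "h \<in> C0 ?Y"
        unfolding C0_open_subspace[OF LCH_KS_space(2) oU] using a(3) ev_C0[OF a(1)] by blast
    qed
    have "ev (vzero D) = (\<lambda>_. 0)" "supp (vzero D) \<subseteq> I"
      by (auto simp: ev_def zero_off_def D_simps supp_def)
    then show "(\<lambda>_. 0) \<in> ?A" using D_vzero by force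
    have inA: "ev a \<in> ?A" if "a \<in> carr D" "supp a \<subseteq> I" for a
      using that by blast
    show "(\<lambda>y. h y + k y) \<in> ?A" if hk: "h \<in> ?A" "k \<in> ?A" for h k
    proof -
      obtain a b where a: "a \<in> carr D" "supp a \<subseteq> I" "h = ev a" and b: "b \<in> carr D" "supp b \<subseteq> I" "k = ev b"
        using hk by blast
      have "ev (vadd D a b) \<in> ?A"
        using supp_ops(1)[of a b] a(2) b(2) by (intro inA D_vadd a(1) b(1)) blast
      then show ?thesis unfolding hom(1)[OF a(1) b(1)] a(3) b(3) .
    qed
    show "(\<lambda>y. h y * k y) \<in> ?A" if hk: "h \<in> ?A" "k \<in> ?A" for h k
    proof -
      obtain a b where a: "a \<in> carr D" "supp a \<subseteq> I" "h = ev a" and b: "b \<in> carr D" "supp b \<subseteq> I" "k = ev b"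
        using hk by blast
      have "(\<lambda>(e, f). e * f) ` (supp a \<times> supp b) \<subseteq> I" using a(2) b(2) I(1)
        by (auto intro!: I(2))
      then have "ev (vmult D a b) \<in> ?A"
        using supp_vmult[of a b] by (intro inA D_vmult a(1) b(1)) (rule order_trans)
      then show ?thesis unfolding hom(2)[OF a(1) b(1)] a(3) b(3) .
    qed
    show "(\<lambda>y. c * h y) \<in> ?A" if h: "h \<in> ?A" for c h
    proof -
      obtain a where a: "a \<in> carr D" "supp a \<subseteq> I" "h = ev a" using h by blast
      have "ev (vscale D c a) \<in> ?A" using a(2) supp_ops(2) by (intro inA D_vscale a(1)) blast
      then show ?thesis unfolding hom(3)[OF a(1) a(1)] a(3) .
    qed
    show "(\<lambda>y. cnj (h y)) \<in> ?A" if h: "h \<in> ?A" for h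
    proof -
      obtain a where a: "a \<in> carr D" "supp a \<subseteq> I" "h = ev a" using h by blast
      have "ev (vstar D a) \<in> ?A" using a(2) supp_ops(3) by (intro inA D_vstar a(1)) blast
      then show ?thesis unfolding hom(4)[OF a(1) a(1)] a(3) .
    qed
    show "\<exists>h\<in>?A. h \<tau> \<noteq> 0" if t: "\<tau> \<in> topspace ?Y" for \<tau>
    proof -
      have "\<tau> \<in> U" using t by (simp only: tY)
      then obtain e x where e: "\<tau> \<in> topspace KS_space" "e \<in> I" "\<tau> e = Some x"
        unfolding U by blast
      then have eI: "e \<in> idems" using I(1) by blast
      obtain g where g: "g \<in> C0 (sub_space X \<theta> e)" "g x = 1" by (rule sub_space_bump[OF eI KS_Some[OF e(1) eI e(3)]])
      show ?thesis
        using ev_delta[OF e(1), of e g] e(3) g(2) by (intro bexI[OF _ deltaA[OF e(2) g(1)]]) simp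
    qed
    show "\<exists>h\<in>?A. h \<tau> \<noteq> h \<tau>'" if t: "\<tau> \<in> topspace ?Y" "\<tau>' \<in> topspace ?Y" "\<tau> \<noteq> \<tau>'" for \<tau> \<tau>'
    proof -
      have tU: "\<tau> \<in> U" "\<tau>' \<in> U" using t(1,2) by (simp_all only: tY)
      obtain d where d: "\<tau> \<in> topspace KS_space" "d \<in> I" "\<tau> d \<noteq> None"
        using tU(1) unfolding U by blast
      have t': "\<tau>' \<in> topspace KS_space" using tU(2) unfolding U by blast
      obtain e where e: "e \<in> I" "\<tau> e \<noteq> \<tau>' e" 
        using KS_eqI[OF d(1) t' I d(2,3)] t(3) by meson
      then have eI: "e \<in> idems" using I(1) by blast
      obtain g where g: "g \<in> C0 (sub_space X \<theta> e)" "ext_inf g (\<tau> e) \<noteq> ext_inf g (\<tau>' e)"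
        using sub_space_separate[OF eI KS_value[OF d(1) eI] KS_value[OF t' eI]] e(2) by blast
      show ?thesis
        using ev_delta[OF d(1), of e g] ev_delta[OF t', of e g] g(2)
        by (intro bexI[OF _ deltaA[OF e(1) g(1)]]) simp
    qed
    fix h assume "h \<in> ?A" "\<And>y. cmod (f y - h y) < r"
    then show thesis using that by blast
  qed
  then show thesis using that by blast
qed

lemma dense_ev:
  assumes f: "f \<in> C0 KS_space" and r: "r > 0"
  shows "\<exists>a\<in>carr D. \<forall>\<tau>. cmod (f \<tau> - ev a \<tau>) < r"
proof -
  have "topspace KS_space = {\<tau> \<in> topspace KS_space. \<exists>e\<in>idems. \<tau> e \<noteq> None}"
    using KS_nonempty by blast
  moreover have "f \<in> C0 (subtopology KS_space (topspace KS_space))" using f by simp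
  ultimately obtain a where "a \<in> carr D" "\<And>\<tau>. cmod (f \<tau> - ev a \<tau>) < r"
    using dense_ideal[OF order_refl idems_mult _ _ r] by metis
  then show ?thesis by blast
qed

text \<open>So the enveloping algebra of \<open>D\<close> is \<open>C0\<close> of the space \<open>XKS\<close>, through \<open>rep.gelfand\<close>.\<close>

sublocale rep: dense_representation D KS_space ev
proof
  show "Hausdorff_space KS_space" by (rule LCH_KS_space)
  show "closed_under_ops D" by (rule closed_under_ops_D)
  show "vzero D \<in> carr D" by (rule D_vzero)
  show "ev (vzero D) = (\<lambda>_. 0)" by (simp add: ev_def zero_off_def D_simps supp_def)
  show "star_hom D (C0_alg KS_space) ev" by (rule star_hom_ev)
  show "env_seminorm D a = unorm (ev a)" if "a \<in> carr D" for a using that by (rule env_seminorm_eq)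
  show "\<exists>a\<in>carr D. \<forall>\<tau>. cmod (f \<tau> - ev a \<tau>) < r" if "f \<in> C0 KS_space" "r > 0" for f r
    using that by (rule dense_ev)
qed

section \<open>The ideals as function algebras\<close>

abbreviation A :: "('s, 'x) KS normed_star_alg" where
  "A \<equiv> C0_KS X \<theta>"

abbreviation J :: "'s \<Rightarrow> ('s, 'x) KS normed_star_alg" where
  "J e \<equiv> C0_KS_ideal X \<theta> e"

abbreviation KS_sub :: "'s \<Rightarrow> ('s \<Rightarrow> 'x option) topology" where
  "KS_sub e \<equiv> subtopology KS_space (XKS_dom X \<theta> e)"

abbreviation gelf :: "('s, 'x) KS \<Rightarrow> ('s \<Rightarrow> 'x option) \<Rightarrow> complex" where
  "gelf \<equiv> rep.gelfand"

abbreviation below :: "'s \<Rightarrow> 's set" where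
  "below e \<equiv> {f \<in> idems. f \<preceq> e}"

lemma A_eq: "A = envelope D"
  by (simp add: C0_KS_def)

lemma below_ideal:
  assumes e: "e \<in> idems"
  shows "below e \<subseteq> idems" "\<And>f d. f \<in> below e \<Longrightarrow> d \<in> idems \<Longrightarrow> f * d \<in> below e" "e \<in> below e"
proof -
  show "below e \<subseteq> idems" by blast
  show "e \<in> below e" using e natural_le_refl by blast
  fix f d :: 's assume f: "f \<in> below e" and d: "d \<in> idems"
  have fd: "f * d \<in> idems" using f d idems_mult by blast
  have "e * (f * d) = f * d" using f natural_le_idem[of f e] by (simp flip: mult.assoc)
  then show "f * d \<in> below e" using fd by (simp add: natural_le_idem)
qed

lemma KS_dom_eq:
  assumes e: "e \<in> idems"
  shows "XKS_dom X \<theta> e = {\<tau> \<in> topspace KS_space. \<exists>f\<in>below e. \<tau> f \<noteq> None}"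
proof (intro equalityI subsetI)
  fix \<tau> assume "\<tau> \<in> XKS_dom X \<theta> e"
  then show "\<tau> \<in> {\<tau> \<in> topspace KS_space. \<exists>f\<in>below e. \<tau> f \<noteq> None}"
    using below_ideal(3)[OF e] unfolding XKS_dom_def by blast
next
  fix \<tau> assume "\<tau> \<in> {\<tau> \<in> topspace KS_space. \<exists>f\<in>below e. \<tau> f \<noteq> None}"
  then obtain f x where "\<tau> \<in> topspace KS_space" "f \<in> idems" "f \<preceq> e" "\<tau> f = Some x" by blast
  then show "\<tau> \<in> XKS_dom X \<theta> e" using KS_up[of \<tau> f e x] e by (simp add: XKS_dom_def)
qed

lemma KS_dom_D: "\<tau> \<in> XKS_dom X \<theta> e \<Longrightarrow> \<tau> \<in> topspace KS_space"
  and KS_dom_Some: "\<tau> \<in> XKS_dom X \<theta> e \<Longrightarrow> \<exists>x. \<tau> e = Some x"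
  by (simp_all add: XKS_dom_def)

lemma KS_dom_sub: "XKS_dom X \<theta> e \<subseteq> topspace KS_space"
  using KS_dom_D by blast

lemma topspace_KS_sub: "topspace (KS_sub e) = XKS_dom X \<theta> e"
  using KS_dom_sub by (simp only: topspace_subtopology inf_absorb2)

lemma LCH_KS_sub:
  assumes "e \<in> idems"
  shows "locally_compact_space (KS_sub e)" "Hausdorff_space (KS_sub e)"
  using locally_compact_space_open_subset[OF _ LCH_KS_space(1) openin_KS_dom[OF assms]] LCH_KS_space(2)
    Hausdorff_space_subtopology by blast+

lemma C0_KS_sub:
  "e \<in> idems \<Longrightarrow> C0 (KS_sub e) = {f \<in> C0 KS_space. \<forall>\<tau>. \<tau> \<notin> XKS_dom X \<theta> e \<longrightarrow> f \<tau> = 0}"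
  by (intro C0_open_subspace LCH_KS_space openin_KS_dom)

lemma ev_C0_KS_sub:
  assumes e: "e \<in> idems" and a: "a \<in> carr D" "supp a \<subseteq> below e"
  shows "ev a \<in> C0 (KS_sub e)"
proof -
  have "ev a \<tau> = 0" if \<tau>: "\<tau> \<notin> XKS_dom X \<theta> e" for \<tau>
  proof (cases "\<tau> \<in> topspace KS_space")
    case True
    then show ?thesis using \<tau> unfolding KS_dom_eq[OF e] by (intro ev_eq_0[OF a]) blast
  qed (rule ev_off)
  then show ?thesis unfolding C0_KS_sub[OF e] using ev_C0[OF a(1)] by blast
qed

lemma gelf_ops:
  assumes "P \<in> carr A" "Q \<in> carr A"
  shows "vadd A P Q \<in> carr A" "vscale A c P \<in> carr A" "vmult A P Q \<in> carr A" "vstar A P \<in> carr A"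
    "gelf (vadd A P Q) = (\<lambda>\<tau>. gelf P \<tau> + gelf Q \<tau>)" "gelf (vscale A c P) = (\<lambda>\<tau>. c * gelf P \<tau>)"
    "gelf (vmult A P Q) = (\<lambda>\<tau>. gelf P \<tau> * gelf Q \<tau>)" "gelf (vstar A P) = (\<lambda>\<tau>. cnj (gelf P \<tau>))"
  using rep.closed_under_ops_envelope rep.star_hom_gelfand assms
  unfolding A_eq closed_under_ops_def star_hom_def C0_alg_simps by blast+

lemma gelf_inj:
  assumes "P \<in> carr A" "Q \<in> carr A" "gelf P = gelf Q" shows "P = Q"
proof -
  have "P = rep.cls (gelf P)" by (rule rep.cls_gelfand[OF assms(1)[unfolded A_eq], symmetric])
  also have "\<dots> = rep.cls (gelf Q)" by (simp only: assms(3))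
  also have "\<dots> = Q" by (rule rep.cls_gelfand[OF assms(2)[unfolded A_eq]])
  finally show ?thesis .
qed

lemma gelf_C0: "P \<in> carr A \<Longrightarrow> gelf P \<in> C0 KS_space"
  unfolding A_eq by (rule rep.gelfand_C0)

lemma gelf_cls: "f \<in> C0 KS_space \<Longrightarrow> rep.cls f \<in> carr A" "f \<in> C0 KS_space \<Longrightarrow> gelf (rep.cls f) = f"
  unfolding A_eq by (simp_all add: rep.carr_envelope rep.gelfand_cls)

lemma embed_A: "a \<in> carr D \<Longrightarrow> env_embed D a \<in> carr A" "a \<in> carr D \<Longrightarrow> gelf (env_embed D a) = ev a"
  unfolding A_eq by (rule rep.gelfand_embed; assumption)+

lemma delta_KS_A:
  assumes "e \<in> idems" "g \<in> C0 (sub_space X \<theta> e)"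
  shows "delta_KS X \<theta> e g \<in> carr A" "gelf (delta_KS X \<theta> e g) = ev (delta e g)"
  unfolding delta_KS_def using embed_A[OF delta_D[OF assms]] by auto

abbreviation gens :: "'s \<Rightarrow> ('s, 'x) KS set" where
  "gens e \<equiv> {delta_KS X \<theta> e0 g | e0 g. e0 \<in> idems \<and> e0 \<preceq> e \<and> g \<in> C0 (sub_space X \<theta> e0)}"

lemma vspan_imp_ev:
  assumes e: "e \<in> idems" and b: "b \<in> vspan A (gens e)"
  shows "b \<in> carr A \<and> (\<exists>a\<in>carr D. supp a \<subseteq> below e \<and> gelf b = ev a)"
  using b
proof induction
  case zero
  have "supp (vzero D) \<subseteq> below e" by (simp add: D_simps supp_def)
  then show ?case
    using rep.gelfand_vzero rep.ev_zero D_vzero unfolding A_eq by (intro conjI bexI[of _ "vzero D"]) simp_all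
next
  case (gen b)
  then obtain f g where b: "b = delta_KS X \<theta> f g" "f \<in> below e" and g: "g \<in> C0 (sub_space X \<theta> f)" by blast
  then have f: "f \<in> idems" by blast
  show ?case
    unfolding b(1) using delta_KS_A[OF f g] delta_D[OF f g] supp_delta[of f g] b(2) by blast
next
  case (add b c)
  then obtain a a' where a: "a \<in> carr D" "supp a \<subseteq> below e" "gelf b = ev a"
    and a': "a' \<in> carr D" "supp a' \<subseteq> below e" "gelf c = ev a'" by blast
  have "gelf (vadd A b c) = ev (vadd D a a')"
    using gelf_ops(5)[of b c] add.IH a a' rep.ev_ops(1)[OF a(1) a'(1)] by simp
  moreover have "supp (vadd D a a') \<subseteq> below e" using supp_ops(1)[of a a'] a(2) a'(2) by blast
  ultimately show ?case using gelf_ops(1)[of b c] add.IH D_vadd[OF a(1) a'(1)] by blast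
next
  case (scale b c)
  then obtain a where a: "a \<in> carr D" "supp a \<subseteq> below e" "gelf b = ev a" by blast
  have "gelf (vscale A c b) = ev (vscale D c a)"
    using gelf_ops(6)[of b b c] scale.IH a rep.ev_unary_ops(1)[OF a(1)] by simp
  moreover have "supp (vscale D c a) \<subseteq> below e" using supp_ops(2)[of c a] a(2) by blast
  ultimately show ?case using gelf_ops(2)[of b b c] scale.IH D_vscale[OF a(1)] by blast
qed

lemma embed_mem_vspan:
  assumes F: "finite F"
  shows "a \<in> carr D \<Longrightarrow> supp a \<subseteq> F \<Longrightarrow> F \<subseteq> below e \<Longrightarrow> env_embed D a \<in> vspan A (gens e)"
  using F
proof (induction F arbitrary: a)
  case empty
  then have "a = vzero D" using not_supp[of _ a] by (simp add: D_simps fun_eq_iff)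
  then have "env_embed D a = vzero A" by (simp add: A_eq envelope_def env_embed_def)
  then show ?case using vspan.zero[of A "gens e"] by (simp only:)
next
  case (insert f F)
  have f: "f \<in> idems" "f \<preceq> e" using insert.prems(3) by auto
  let ?b = "a(f := (\<lambda>_. 0))"
  have sb: "supp ?b \<subseteq> F" "supp ?b \<subseteq> supp a" using insert.prems(2) by (auto simp: supp_def)
  have b: "?b \<in> carr D"
    unfolding D_carr using insert.prems(1) sb(2) finite_subset[OF sb(2)]
    by (auto simp: D_carr C0_zero)
  have g: "a f \<in> C0 (sub_space X \<theta> f)" by (rule D_C0[OF insert.prems(1) f(1)])
  have d: "delta f (a f) \<in> carr D" by (rule delta_D[OF f(1) g])
  have "a = vadd D (delta f (a f)) ?b" by (auto simp: D_simps delta_def fun_eq_iff)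
  then have "env_embed D a = env_embed D (vadd D (delta f (a f)) ?b)" by (rule arg_cong)
  also have "\<dots> = vadd A (env_embed D (delta f (a f))) (env_embed D ?b)"
    unfolding A_eq rep.env_embed_eq[OF D_vadd[OF d b]] rep.env_embed_eq[OF d] rep.env_embed_eq[OF b]
      rep.cls_vadd[OF ev_C0[OF d] ev_C0[OF b]] rep.ev_ops(1)[OF d b] ..
  finally have eq: "env_embed D a = vadd A (env_embed D (delta f (a f))) (env_embed D ?b)" .
  have "env_embed D (delta f (a f)) \<in> gens e"
    using f g unfolding delta_KS_def by blast
  moreover have "F \<subseteq> below e" using insert.prems(3) by blast
  ultimately show ?case
    unfolding eq using insert.IH[OF b sb(1)] by (intro vspan.add[OF vspan.gen])
qed

text \<open>The span of the generators consists of the classes of the \<open>a \<in> D\<close> supported below \<open>e\<close>. Their functions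
  are dense in \<open>C0\<close> of the domain of \<open>e\<close>, and the isomorphism is isometric; so the closed span is the
  preimage of this algebra.\<close>

lemma carr_J:
  assumes e: "e \<in> idems"
  shows "carr (J e) = {P \<in> carr A. gelf P \<in> C0 (KS_sub e)}"
proof (intro equalityI subsetI)
  have diff: "vdiff A P b \<in> carr A" "gelf (vdiff A P b) = (\<lambda>\<tau>. gelf P \<tau> - gelf b \<tau>)"
    if "P \<in> carr A" "b \<in> carr A" for P b
    unfolding vdiff_def
    using gelf_ops(1)[OF that(1) gelf_ops(2)[OF that(2) that(2), of "-1"]]
      gelf_ops(5)[OF that(1) gelf_ops(2)[OF that(2) that(2), of "-1"]]
      gelf_ops(6)[OF that(2) that(2), of "-1"] by simp_all
  have carrJ: "carr (J e) = closed_vspan A (gens e)" by (simp add: C0_KS_ideal_def)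
  {
    fix P assume "P \<in> carr (J e)"
    then have P: "P \<in> carr A" "\<And>r. r > 0 \<Longrightarrow> \<exists>b\<in>vspan A (gens e). vnorm A (vdiff A P b) < r"
      unfolding carrJ closed_vspan_def by blast+
    have "gelf P \<in> C0 (KS_sub e)"
    proof (rule C0_uniform_limit[OF LCH_KS_sub(2)[OF e]])
      fix r :: real assume "r > 0"
      then obtain b where b: "b \<in> vspan A (gens e)" "vnorm A (vdiff A P b) < r" using P(2) by blast
      obtain a where a: "b \<in> carr A" "a \<in> carr D" "supp a \<subseteq> below e" "gelf b = ev a"
        using vspan_imp_ev[OF e b(1)] by blast
      have "unorm (\<lambda>\<tau>. gelf P \<tau> - ev a \<tau>) < r"
        using b(2) diff[OF P(1) a(1)] rep.vnorm_gelfand[of "vdiff A P b"] a(4) by (simp add: A_eq)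
      then have "cmod (gelf P \<tau> - ev a \<tau>) < r" for \<tau>
        using unorm_upper[OF C0_diff[OF gelf_C0[OF P(1)] ev_C0[OF a(2)]], of \<tau>] by simp
      then show "\<exists>g\<in>C0 (KS_sub e). \<forall>\<tau>. cmod (gelf P \<tau> - g \<tau>) < r"
        using ev_C0_KS_sub[OF e a(2,3)] by blast
    qed
    then show "P \<in> {P \<in> carr A. gelf P \<in> C0 (KS_sub e)}" using P(1) by blast
  }
  {
    fix P assume "P \<in> {P \<in> carr A. gelf P \<in> C0 (KS_sub e)}"
    then have P: "P \<in> carr A" "gelf P \<in> C0 (KS_sub e)" by blast+
    have "\<exists>b\<in>vspan A (gens e). vnorm A (vdiff A P b) < r" if r: "r > 0" for r
    proof -
      have r2: "r / 2 > 0" using r by simp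
      obtain a where a: "a \<in> carr D" "supp a \<subseteq> below e" "\<And>\<tau>. cmod (gelf P \<tau> - ev a \<tau>) < r / 2"
        by (rule dense_ideal[OF below_ideal(1,2)[OF e] KS_dom_eq[OF e] P(2) r2]) (assumption, assumption, rule that)
      have "vnorm A (vdiff A P (env_embed D a)) = unorm (\<lambda>\<tau>. gelf P \<tau> - ev a \<tau>)"
        using diff[OF P(1) embed_A(1)[OF a(1)]] embed_A(2)[OF a(1)]
          rep.vnorm_gelfand[of "vdiff A P (env_embed D a)"] by (simp add: A_eq)
      also have "\<dots> \<le> r / 2" using a(3) by (intro unorm_least less_imp_le)
      also have "\<dots> < r" using r by simp
      finally show ?thesis
        using embed_mem_vspan[OF D_finite[OF a(1)] a(1) order_refl a(2)] by blast
    qed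
    then show "P \<in> carr (J e)" using P(1) unfolding carrJ closed_vspan_def by blast
  }
qed

lemma J_simps [simp]:
  "vzero (J e) = vzero A" "vadd (J e) = vadd A" "vscale (J e) = vscale A" "vmult (J e) = vmult A"
  "vstar (J e) = vstar A"
  by (simp_all add: C0_KS_ideal_def)

lemma J_D:
  assumes "e \<in> idems" "P \<in> carr (J e)" shows "P \<in> carr A" "gelf P \<in> C0 (KS_sub e)"
  using assms carr_J[OF assms(1)] by blast+

lemma J_I: "e \<in> idems \<Longrightarrow> P \<in> carr A \<Longrightarrow> gelf P \<in> C0 (KS_sub e) \<Longrightarrow> P \<in> carr (J e)"
  using carr_J by blast

lemma gens_J:
  assumes e: "e \<in> idems" and f: "f \<in> idems" "f \<preceq> e" and g: "g \<in> C0 (sub_space X \<theta> f)"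
  shows "delta_KS X \<theta> f g \<in> carr (J e)"
proof (rule J_I[OF e delta_KS_A(1)[OF f(1) g]])
  show "gelf (delta_KS X \<theta> f g) \<in> C0 (KS_sub e)"
    unfolding delta_KS_A(2)[OF f(1) g]
    using f supp_delta[of f g] by (intro ev_C0_KS_sub[OF e delta_D[OF f(1) g]]) blast
qed

lemma gelf_delta_KS:
  "f \<in> idems \<Longrightarrow> g \<in> C0 (sub_space X \<theta> f) \<Longrightarrow> \<tau> \<in> topspace KS_space \<Longrightarrow>
    gelf (delta_KS X \<theta> f g) \<tau> = ext_inf g (\<tau> f)"
  by (simp only: delta_KS_A(2) ev_delta)

lemma closed_under_ops_J:
  assumes e: "e \<in> idems" shows "closed_under_ops (J e)"
  unfolding closed_under_ops_def J_simps
proof (intro ballI allI conjI)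
  fix P Q c assume P: "P \<in> carr (J e)" and Q: "Q \<in> carr (J e)"
  note p = J_D[OF e P] and q = J_D[OF e Q]
  note op = gelf_ops[OF p(1) q(1)]
  show "vadd A P Q \<in> carr (J e)" by (rule J_I[OF e op(1)]) (simp only: op C0_add p q)
  show "vscale A c P \<in> carr (J e)" by (rule J_I[OF e op(2)]) (simp only: op C0_scale p q)
  show "vmult A P Q \<in> carr (J e)" by (rule J_I[OF e op(3)]) (simp only: op C0_mult p q)
  show "vstar A P \<in> carr (J e)" by (rule J_I[OF e op(4)]) (simp only: op C0_cnj p q)
qed

lemma star_hom_gelf_J:
  assumes e: "e \<in> idems" shows "star_hom (J e) (C0_alg (KS_sub e)) gelf"
  unfolding star_hom_def J_simps C0_alg_simps
proof (intro conjI ballI allI)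
  fix P Q c assume "P \<in> carr (J e)" "Q \<in> carr (J e)"
  note op = gelf_ops[OF J_D(1)[OF e this(1)] J_D(1)[OF e this(2)]]
  show "gelf (vadd A P Q) = (\<lambda>\<tau>. gelf P \<tau> + gelf Q \<tau>)" by (rule op)
  show "gelf (vmult A P Q) = (\<lambda>\<tau>. gelf P \<tau> * gelf Q \<tau>)" by (rule op)
next
  fix P c assume P: "P \<in> carr (J e)"
  note op = gelf_ops[OF J_D(1)[OF e P] J_D(1)[OF e P]]
  show "gelf P \<in> C0 (KS_sub e)" by (rule J_D(2)[OF e P])
  show "gelf (vscale A c P) = (\<lambda>\<tau>. c * gelf P \<tau>)" by (rule op)
  show "gelf (vstar A P) = (\<lambda>\<tau>. cnj (gelf P \<tau>))" by (rule op)
qed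

lemma star_iso_gelf_J:
  assumes e: "e \<in> idems" shows "star_iso (J e) (C0_alg (KS_sub e)) gelf"
proof -
  have "bij_betw gelf (carr (J e)) (C0 (KS_sub e))"
    unfolding bij_betw_def
  proof
    show "inj_on gelf (carr (J e))"
      using gelf_inj J_D(1)[OF e] by (intro inj_onI) blast
    show "gelf ` carr (J e) = C0 (KS_sub e)"
    proof (intro equalityI subsetI)
      fix f assume f: "f \<in> C0 (KS_sub e)"
      then have f': "f \<in> C0 KS_space" using C0_KS_sub[OF e] by blast
      have "rep.cls f \<in> carr (J e)" by (rule J_I[OF e gelf_cls(1)[OF f']]) (simp only: gelf_cls(2)[OF f'] f)
      then show "f \<in> gelf ` carr (J e)" using gelf_cls(2)[OF f'] by (intro image_eqI[of _ _ "rep.cls f"]) simp_all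
    qed (use J_D(2)[OF e] in blast)
  qed
  then show ?thesis using star_hom_gelf_J[OF e] by (simp add: star_iso_def)
qed

section \<open>Characters and the maps Phi\<close>

text \<open>A nonzero homomorphism is evaluation at a point, and the generators separate the points. This makes
  the isomorphisms in the definitions of \<open>Phi\<close> and \<open>alpha_KS\<close> unique: compose them with evaluations.\<close>

lemma J_hom_unique:
  assumes e: "e \<in> idems"
    and h1: "star_hom (J e) complex_alg \<xi>1" and h2: "star_hom (J e) complex_alg \<xi>2"
    and eq: "\<And>f g. f \<in> idems \<Longrightarrow> f \<preceq> e \<Longrightarrow> g \<in> C0 (sub_space X \<theta> f) \<Longrightarrow>
      \<xi>1 (delta_KS X \<theta> f g) = \<xi>2 (delta_KS X \<theta> f g)"
    and P: "P \<in> carr (J e)"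
  shows "\<xi>1 P = \<xi>2 P"
proof -
  let ?c = "\<lambda>\<tau>. \<lambda>Q\<in>carr (J e). gelf Q \<tau>"
  have hm: "homeomorphic_map (KS_sub e) (Sp (J e)) ?c"
    by (rule homeomorphic_map_spectrum[OF star_iso_gelf_J[OF e] closed_under_ops_J[OF e] LCH_KS_sub[OF e]])
  have point: "\<exists>\<tau>\<in>XKS_dom X \<theta> e. \<forall>Q\<in>carr (J e). \<xi> Q = gelf Q \<tau>"
    if h: "star_hom (J e) complex_alg \<xi>" and Q0: "Q0 \<in> carr (J e)" "\<xi> Q0 \<noteq> 0" for \<xi> Q0
  proof -
    have "star_hom (J e) complex_alg (restrict \<xi> (carr (J e)))"
      by (rule star_hom_restrict[OF h closed_under_ops_J[OF e]])
    then have "restrict \<xi> (carr (J e)) \<in> topspace (Sp (J e))"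
      unfolding topspace_Sp characters_def using Q0 by auto
    then have "restrict \<xi> (carr (J e)) \<in> ?c ` XKS_dom X \<theta> e"
      using homeomorphic_imp_surjective_map[OF hm] topspace_KS_sub by simp
    then obtain \<tau> where \<tau>: "\<tau> \<in> XKS_dom X \<theta> e" "restrict \<xi> (carr (J e)) = ?c \<tau>" by blast
    have "\<xi> Q = gelf Q \<tau>" if "Q \<in> carr (J e)" for Q
      using fun_cong[OF \<tau>(2), of Q] that by simp
    then show ?thesis using \<tau>(1) by blast
  qed
  have nonzero: "\<exists>f g. f \<in> idems \<and> f \<preceq> e \<and> g \<in> C0 (sub_space X \<theta> f) \<and> \<xi> (delta_KS X \<theta> f g) \<noteq> 0"
    if \<tau>: "\<tau> \<in> XKS_dom X \<theta> e" and \<xi>: "\<forall>Q\<in>carr (J e). \<xi> Q = gelf Q \<tau>" for \<xi> \<tau>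
  proof -
    obtain x where x: "\<tau> e = Some x" using KS_dom_Some[OF \<tau>] by blast
    obtain g where g: "g \<in> C0 (sub_space X \<theta> e)" "g x = 1"
      by (rule sub_space_bump[OF e KS_Some[OF KS_dom_D[OF \<tau>] e x]])
    have "\<xi> (delta_KS X \<theta> e g) = 1"
      using bspec[OF \<xi> gens_J[OF e e natural_le_refl[OF e] g(1)]] gelf_delta_KS[OF e g(1) KS_dom_D[OF \<tau>]] x g(2)
      by simp
    then show ?thesis using e g(1) natural_le_refl[OF e] by (intro exI[of _ e] exI[of _ g]) simp
  qed
  have nonzero_transfer: "\<exists>Q\<in>carr (J e). \<xi>' Q \<noteq> 0"
    if h: "star_hom (J e) complex_alg \<xi>" "\<exists>Q\<in>carr (J e). \<xi> Q \<noteq> 0"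
      and eq: "\<And>f g. f \<in> idems \<Longrightarrow> f \<preceq> e \<Longrightarrow> g \<in> C0 (sub_space X \<theta> f) \<Longrightarrow>
        \<xi> (delta_KS X \<theta> f g) = \<xi>' (delta_KS X \<theta> f g)" for \<xi> \<xi>'
  proof -
    obtain \<tau> where "\<tau> \<in> XKS_dom X \<theta> e" "\<forall>Q\<in>carr (J e). \<xi> Q = gelf Q \<tau>" using point[OF h(1)] h(2) by blast
    from nonzero[OF this] obtain f g where fg: "f \<in> idems" "f \<preceq> e" "g \<in> C0 (sub_space X \<theta> f)"
      "\<xi> (delta_KS X \<theta> f g) \<noteq> 0" by blast
    show ?thesis using fg(4) gens_J[OF e fg(1-3)] unfolding eq[OF fg(1-3)] by (rule bexI)
  qed
  have zero_iff: "(\<exists>Q\<in>carr (J e). \<xi>1 Q \<noteq> 0) \<longleftrightarrow> (\<exists>Q\<in>carr (J e). \<xi>2 Q \<noteq> 0)"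
    using nonzero_transfer[OF h1 _ eq] nonzero_transfer[OF h2 _ eq[symmetric]] by (rule iffI)
  show ?thesis
  proof (cases "\<exists>Q\<in>carr (J e). \<xi>1 Q \<noteq> 0")
    case False
    then have "\<not> (\<exists>Q\<in>carr (J e). \<xi>2 Q \<noteq> 0)" using zero_iff by blast
    then show ?thesis using False P by simp
  next
    case True
    then obtain \<tau>1 where t1: "\<tau>1 \<in> XKS_dom X \<theta> e" "\<forall>Q\<in>carr (J e). \<xi>1 Q = gelf Q \<tau>1"
      using point[OF h1] by blast
    obtain \<tau>2 where t2: "\<tau>2 \<in> XKS_dom X \<theta> e" "\<forall>Q\<in>carr (J e). \<xi>2 Q = gelf Q \<tau>2"
      using point[OF h2] True zero_iff by blast
    note k1 = KS_dom_D[OF t1(1)] and k2 = KS_dom_D[OF t2(1)]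
    have "\<tau>1 = \<tau>2"
    proof (rule KS_eqI[OF k1 k2 below_ideal[OF e]])
      show "\<tau>1 e \<noteq> None" using KS_dom_Some[OF t1(1)] by auto
      fix f assume "f \<in> below e"
      then have f: "f \<in> idems" "f \<preceq> e" by auto
      show "\<tau>1 f = \<tau>2 f"
      proof (rule sub_space_separate[OF f(1) KS_value[OF k1 f(1)] KS_value[OF k2 f(1)]])
        fix g assume g: "g \<in> C0 (sub_space X \<theta> f)"
        have d: "delta_KS X \<theta> f g \<in> carr (J e)" by (rule gens_J[OF e f g])
        show "ext_inf g (\<tau>1 f) = ext_inf g (\<tau>2 f)"
          using eq[OF f g] bspec[OF t1(2) d] bspec[OF t2(2) d]
          by (simp only: gelf_delta_KS[OF f(1) g k1] gelf_delta_KS[OF f(1) g k2])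
      qed
    qed
    then show ?thesis using t1(2) t2(2) P by simp
  qed
qed

lemma Phi_eq:
  assumes e: "e \<in> idems" shows "Phi X \<theta> e = restrict gelf (carr (J e))"
  unfolding Phi_def
proof (rule the_equality)
  have "restrict gelf (carr (J e)) (delta_KS X \<theta> f g) \<tau> = ext_inf g (\<tau> f)"
    if "f \<in> idems" "f \<preceq> e" "g \<in> C0 (sub_space X \<theta> f)" "\<tau> \<in> XKS_dom X \<theta> e" for f g \<tau>
    using gelf_delta_KS[OF that(1,3) KS_dom_D[OF that(4)]] gens_J[OF e that(1-3)] by simp
  then show "restrict gelf (carr (J e)) \<in> extensional (carr (J e)) \<and>
     star_iso (J e) (C0_alg (KS_sub e)) (restrict gelf (carr (J e))) \<and>
     (\<forall>e0\<in>idems. e0 \<preceq> e \<longrightarrow> (\<forall>g\<in>C0 (sub_space X \<theta> e0). \<forall>\<tau>\<in>XKS_dom X \<theta> e.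
        restrict gelf (carr (J e)) (delta_KS X \<theta> e0 g) \<tau> = ext_inf g (\<tau> e0)))"
    using star_iso_restrict[OF star_iso_gelf_J[OF e] closed_under_ops_J[OF e]] by (intro conjI restrict_extensional) blast+
  fix \<Phi> assume \<Phi>: "\<Phi> \<in> extensional (carr (J e)) \<and>
     star_iso (J e) (C0_alg (KS_sub e)) \<Phi> \<and>
     (\<forall>e0\<in>idems. e0 \<preceq> e \<longrightarrow> (\<forall>g\<in>C0 (sub_space X \<theta> e0). \<forall>\<tau>\<in>XKS_dom X \<theta> e.
        \<Phi> (delta_KS X \<theta> e0 g) \<tau> = ext_inf g (\<tau> e0)))"
  then have ex: "\<Phi> \<in> extensional (carr (J e))" and hom: "star_hom (J e) (C0_alg (KS_sub e)) \<Phi>"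
    and gen: "\<And>f g \<tau>. f \<in> idems \<Longrightarrow> f \<preceq> e \<Longrightarrow> g \<in> C0 (sub_space X \<theta> f) \<Longrightarrow> \<tau> \<in> XKS_dom X \<theta> e \<Longrightarrow>
        \<Phi> (delta_KS X \<theta> f g) \<tau> = ext_inf g (\<tau> f)"
    using star_iso_hom by blast+
  show "\<Phi> = restrict gelf (carr (J e))"
  proof (rule extensionalityI[OF ex restrict_extensional])
    fix P assume P: "P \<in> carr (J e)"
    have "\<Phi> P \<tau> = gelf P \<tau>" for \<tau>
    proof (cases "\<tau> \<in> XKS_dom X \<theta> e")
      case True
      show ?thesis
      proof (rule J_hom_unique[OF e _ _ _ P])
        show "star_hom (J e) complex_alg (\<lambda>P. \<Phi> P \<tau>)"
          by (rule star_hom_compose[OF hom star_hom_evaluation])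
        show "star_hom (J e) complex_alg (\<lambda>P. gelf P \<tau>)"
          by (rule star_hom_compose[OF star_hom_gelf_J[OF e] star_hom_evaluation])
        show "\<Phi> (delta_KS X \<theta> f g) \<tau> = gelf (delta_KS X \<theta> f g) \<tau>"
          if "f \<in> idems" "f \<preceq> e" "g \<in> C0 (sub_space X \<theta> f)" for f g
          unfolding gen[OF that True] gelf_delta_KS[OF that(1,3) KS_dom_D[OF True]] ..
      qed
    next
      case False
      have "\<Phi> P \<in> C0 (KS_sub e)" using hom P by (simp add: star_hom_def)
      then have "\<Phi> P \<tau> = 0" "gelf P \<tau> = 0"
        using J_D(2)[OF e P] False unfolding C0_KS_sub[OF e] by blast+
      then show ?thesis by simp
    qed
    then show "\<Phi> P = restrict gelf (carr (J e)) P" using P by (simp add: fun_eq_iff)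
  qed
qed

abbreviation point_char :: "('s \<Rightarrow> 'x option) \<Rightarrow> ('s, 'x) KS \<Rightarrow> complex" where
  "point_char \<tau> \<equiv> (\<lambda>P\<in>carr A. gelf P \<tau>)"

lemma homeomorphic_map_point_char: "homeomorphic_map KS_space (Sp A) point_char"
  unfolding A_eq
  by (rule homeomorphic_map_spectrum[OF rep.star_iso_gelfand rep.closed_under_ops_envelope LCH_KS_space])

lemma point_char_delta:
  assumes "e \<in> idems" "g \<in> C0 (sub_space X \<theta> e)" "\<tau> \<in> topspace KS_space"
  shows "point_char \<tau> (delta_KS X \<theta> e g) = ext_inf g (\<tau> e)"
  using gelf_delta_KS[OF assms] delta_KS_A(1)[OF assms(1,2)] by simp

lemma KS_eq_ext_inf:
  assumes t: "\<tau> \<in> topspace KS_space" "\<tau>' \<in> topspace KS_space"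
    and eq: "\<And>e g. e \<in> idems \<Longrightarrow> g \<in> C0 (sub_space X \<theta> e) \<Longrightarrow> ext_inf g (\<tau> e) = ext_inf g (\<tau>' e)"
  shows "\<tau> = \<tau>'"
proof (rule extensionalityI[OF KS_extensional[OF t(1)] KS_extensional[OF t(2)]])
  fix e :: 's assume e: "e \<in> idems"
  show "\<tau> e = \<tau>' e"
    using eq[OF e] by (rule sub_space_separate[OF e KS_value[OF t(1) e] KS_value[OF t(2) e]])
qed

lemma Sp_A_point_char: "topspace (Sp A) = point_char ` topspace KS_space"
  using homeomorphic_imp_surjective_map[OF homeomorphic_map_point_char] by simp

lemma chi_of_eq:
  assumes t: "\<tau> \<in> topspace KS_space" shows "chi_of X \<theta> \<tau> = point_char \<tau>"
  unfolding chi_of_def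
proof (rule the_equality)
  show "point_char \<tau> \<in> topspace (Sp A) \<and>
    (\<forall>e\<in>idems. \<forall>g\<in>C0 (sub_space X \<theta> e). point_char \<tau> (delta_KS X \<theta> e g) = ext_inf g (\<tau> e))"
    using t point_char_delta[OF _ _ t] unfolding Sp_A_point_char by blast
  fix \<xi> assume \<xi>: "\<xi> \<in> topspace (Sp A) \<and>
    (\<forall>e\<in>idems. \<forall>g\<in>C0 (sub_space X \<theta> e). \<xi> (delta_KS X \<theta> e g) = ext_inf g (\<tau> e))"
  then obtain \<tau>' where t': "\<tau>' \<in> topspace KS_space" "\<xi> = point_char \<tau>'" unfolding Sp_A_point_char by blast
  have "\<tau>' = \<tau>"
  proof (rule KS_eq_ext_inf[OF t'(1) t])
    fix e :: 's and g assume e: "e \<in> idems" and g: "g \<in> C0 (sub_space X \<theta> e)"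
    have "\<xi> (delta_KS X \<theta> e g) = ext_inf g (\<tau> e)" using \<xi> e g by blast
    then show "ext_inf g (\<tau>' e) = ext_inf g (\<tau> e)" unfolding t'(2) point_char_delta[OF e g t'(1)] .
  qed
  then show "\<xi> = point_char \<tau>" by (simp only: t'(2))
qed

lemma tau_of_point_char:
  assumes t: "\<tau> \<in> topspace KS_space" shows "tau_of X \<theta> (point_char \<tau>) = \<tau>"
  unfolding tau_of_def
proof (rule the_equality)
  show "\<tau> \<in> topspace KS_space \<and>
    (\<forall>e\<in>idems. \<forall>g\<in>C0 (sub_space X \<theta> e). ext_inf g (\<tau> e) = point_char \<tau> (delta_KS X \<theta> e g))"
    using t point_char_delta[OF _ _ t] by (intro conjI ballI) (simp_all only:)
  fix \<tau>' assume t': "\<tau>' \<in> topspace KS_space \<and>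
    (\<forall>e\<in>idems. \<forall>g\<in>C0 (sub_space X \<theta> e). ext_inf g (\<tau>' e) = point_char \<tau> (delta_KS X \<theta> e g))"
  show "\<tau>' = \<tau>"
  proof (rule KS_eq_ext_inf[OF _ t])
    show "\<tau>' \<in> topspace KS_space" using t' by blast
    fix e :: 's and g assume e: "e \<in> idems" and g: "g \<in> C0 (sub_space X \<theta> e)"
    have "ext_inf g (\<tau>' e) = point_char \<tau> (delta_KS X \<theta> e g)" using t' e g by blast
    then show "ext_inf g (\<tau>' e) = ext_inf g (\<tau> e)" unfolding point_char_delta[OF e g t] .
  qed
qed

lemma homeomorphic_maps_tau_chi: "homeomorphic_maps (Sp A) KS_space (tau_of X \<theta>) (chi_of X \<theta>)"
proof -
  obtain g where g: "homeomorphic_maps KS_space (Sp A) point_char g"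
    using homeomorphic_map_point_char unfolding homeomorphic_map_maps by blast
  have "homeomorphic_maps KS_space (Sp A) (chi_of X \<theta>) (tau_of X \<theta>)"
  proof (rule homeomorphic_maps_eq[OF g])
    show "point_char \<tau> = chi_of X \<theta> \<tau>" if "\<tau> \<in> topspace KS_space" for \<tau>
      by (rule chi_of_eq[OF that, symmetric])
    fix \<xi> assume "\<xi> \<in> topspace (Sp A)"
    then obtain \<tau> where t: "\<tau> \<in> topspace KS_space" "\<xi> = point_char \<tau>" unfolding Sp_A_point_char by blast
    have "g (point_char \<tau>) = \<tau>" using g t(1) unfolding homeomorphic_maps_def by blast
    then show "g \<xi> = tau_of X \<theta> \<xi>" unfolding t(2) tau_of_point_char[OF t(1)] .
  qed
  then show ?thesis by (rule homeomorphic_maps_sym[THEN iffD1])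
qed

text \<open>The functions of the elements of the ideal vanish outside the domain of \<open>e\<close>, and have no common zero
  inside.\<close>

lemma Sp_dom_iff:
  assumes e: "e \<in> idems" and t: "\<tau> \<in> topspace KS_space"
  shows "point_char \<tau> \<in> Sp_dom X \<theta> e \<longleftrightarrow> \<tau> \<in> XKS_dom X \<theta> e"
proof
  assume "point_char \<tau> \<in> Sp_dom X \<theta> e"
  then obtain P where P: "P \<in> carr (J e)" "point_char \<tau> P \<noteq> 0" unfolding Sp_dom_def by blast
  then have "gelf P \<tau> \<noteq> 0" using J_D(1)[OF e P(1)] by simp
  then show "\<tau> \<in> XKS_dom X \<theta> e" using J_D(2)[OF e P(1)] unfolding C0_KS_sub[OF e] by blast
next
  assume t': "\<tau> \<in> XKS_dom X \<theta> e"
  obtain x where x: "\<tau> e = Some x" using KS_dom_Some[OF t'] by blast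
  obtain g where g: "g \<in> C0 (sub_space X \<theta> e)" "g x = 1" by (rule sub_space_bump[OF e KS_Some[OF t e x]])
  have "point_char \<tau> (delta_KS X \<theta> e g) \<noteq> 0"
    unfolding point_char_delta[OF e g(1) t] x using g(2) by simp
  moreover have "point_char \<tau> \<in> topspace (Sp A)" using t unfolding Sp_A_point_char by blast
  ultimately show "point_char \<tau> \<in> Sp_dom X \<theta> e"
    unfolding Sp_dom_def using gens_J[OF e e natural_le_refl[OF e] g(1)] by blast
qed

lemma homeomorphic_maps_tau_chi_dom:
  assumes e: "e \<in> idems"
  shows "homeomorphic_maps (subtopology (Sp A) (Sp_dom X \<theta> e)) (KS_sub e) (tau_of X \<theta>) (chi_of X \<theta>)"
proof (rule homeomorphic_maps_subtopologies_alt[OF homeomorphic_maps_tau_chi])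
  show "tau_of X \<theta> ` (topspace (Sp A) \<inter> Sp_dom X \<theta> e) \<subseteq> XKS_dom X \<theta> e"
  proof clarify
    fix \<xi> assume "\<xi> \<in> topspace (Sp A)" and x: "\<xi> \<in> Sp_dom X \<theta> e"
    then obtain \<tau> where t: "\<tau> \<in> topspace KS_space" "\<xi> = point_char \<tau>" unfolding Sp_A_point_char by blast
    show "tau_of X \<theta> \<xi> \<in> XKS_dom X \<theta> e"
      using x unfolding t(2) tau_of_point_char[OF t(1)] Sp_dom_iff[OF e t(1)] .
  qed
  show "chi_of X \<theta> ` (topspace KS_space \<inter> XKS_dom X \<theta> e) \<subseteq> Sp_dom X \<theta> e"
  proof clarify
    fix \<tau> assume t: "\<tau> \<in> topspace KS_space" "\<tau> \<in> XKS_dom X \<theta> e"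
    show "chi_of X \<theta> \<tau> \<in> Sp_dom X \<theta> e"
      unfolding chi_of_eq[OF t(1)] Sp_dom_iff[OF e t(1)] by (rule t(2))
  qed
qed

text \<open>Both spectra are the domain of \<open>e\<close> in \<open>XKS\<close>, and restriction is the resulting identification.\<close>

lemma homeomorphic_map_restrict_character:
  assumes e: "e \<in> idems"
  shows "homeomorphic_map (subtopology (Sp A) (Sp_dom X \<theta> e)) (Sp (J e)) (\<lambda>\<xi>. restrict \<xi> (carr (J e)))"
proof (rule homeomorphic_map_eq)
  let ?c = "\<lambda>\<tau>. \<lambda>Q\<in>carr (J e). gelf Q \<tau>"
  have "homeomorphic_map (KS_sub e) (Sp (J e)) ?c"
    by (rule homeomorphic_map_spectrum[OF star_iso_gelf_J[OF e] closed_under_ops_J[OF e] LCH_KS_sub[OF e]])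
  moreover have "homeomorphic_map (subtopology (Sp A) (Sp_dom X \<theta> e)) (KS_sub e) (tau_of X \<theta>)"
    using homeomorphic_maps_tau_chi_dom[OF e] unfolding homeomorphic_map_maps by blast
  ultimately show "homeomorphic_map (subtopology (Sp A) (Sp_dom X \<theta> e)) (Sp (J e)) (?c \<circ> tau_of X \<theta>)"
    by (rule homeomorphic_map_compose[rotated])
  fix \<xi> assume "\<xi> \<in> topspace (subtopology (Sp A) (Sp_dom X \<theta> e))"
  then have "\<xi> \<in> topspace (Sp A)" unfolding topspace_subtopology by (rule IntD1)
  then obtain \<tau> where t: "\<tau> \<in> topspace KS_space" "\<xi> = point_char \<tau>" unfolding Sp_A_point_char by blast
  show "(?c \<circ> tau_of X \<theta>) \<xi> = restrict \<xi> (carr (J e))"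
    unfolding t(2) comp_def tau_of_point_char[OF t(1)]
    using J_D(1)[OF e] by (simp add: restrict_def fun_eq_iff)
qed

section \<open>Equivariance\<close>

text \<open>The action moves the filter of \<open>\<tau>\<close> by conjugation and its point by \<open>\<theta> s\<close>.\<close>

lemma theta_KS_Some:
  assumes t: "\<tau> \<in> topspace KS_space" and e: "e \<in> idems"
  shows "theta_KS \<theta> s \<tau> e = Some y \<longleftrightarrow> (\<exists>x. \<tau> (s\<^sup>\<star> * e * s) = Some x \<and> \<theta> s x = Some y)"
proof (cases "\<tau> (s\<^sup>\<star> * e * s)")
  case None
  then show ?thesis using e by (simp add: theta_KS_def)
next
  case (Some x)
  obtain z where z: "\<theta> s x = Some z" "z \<in> fix_dom \<theta> e"
    using KS_Some[OF t conj_idem[OF e] Some] unfolding fix_dom_conj[OF e] by blast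
  have "theta_KS \<theta> s \<tau> e = \<theta> (e * s) x" using e Some by (simp add: theta_KS_def)
  also have "\<dots> = Some z" using theta_restrict[OF e] z by blast
  finally show ?thesis using Some z by simp
qed

lemma theta_KS_dom:
  assumes t: "\<tau> \<in> XKS_dom X \<theta> (s\<^sup>\<star> * s)"
  shows "theta_KS \<theta> s \<tau> \<in> XKS_dom X \<theta> (s * s\<^sup>\<star>)"
proof -
  let ?T = "theta_KS \<theta> s \<tau>"
  note k = KS_dom_D[OF t]
  have conj: "s\<^sup>\<star> * (s * s\<^sup>\<star>) * s = s\<^sup>\<star> * s" by (simp add: inv_star_left mult.assoc)
  obtain x where x: "\<tau> (s\<^sup>\<star> * s) = Some x" using KS_dom_Some[OF t] by blast
  obtain y where y: "\<theta> s x = Some y" using theta_defined[OF KS_Some[OF k _ x]] by auto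
  have ne: "?T (s * s\<^sup>\<star>) = Some y"
    unfolding theta_KS_Some[OF k star_mult_idem(2)] conj using x y by blast
  have "?T \<in> topspace KS_space"
  proof (rule KS_I)
    show "?T \<in> extensional idems" by (simp add: theta_KS_def)
    show "s * s\<^sup>\<star> \<in> idems" by simp
    show "?T (s * s\<^sup>\<star>) \<noteq> None" using ne by simp
    show "z \<in> fix_dom \<theta> e" if e: "e \<in> idems" and z: "?T e = Some z" for e z
    proof -
      obtain w where w: "\<tau> (s\<^sup>\<star> * e * s) = Some w" "\<theta> s w = Some z" using z unfolding theta_KS_Some[OF k e] by blast
      show ?thesis using KS_Some[OF k conj_idem[OF e] w(1)] w(2) unfolding fix_dom_conj[OF e] by auto
    qed
    fix e f :: 's and z assume e: "e \<in> idems" and f: "f \<in> idems"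
    have mult: "\<tau> (s\<^sup>\<star> * (e * f) * s) = Some w \<longleftrightarrow> \<tau> (s\<^sup>\<star> * e * s) = Some w \<and> \<tau> (s\<^sup>\<star> * f * s) = Some w" for w
      using KS_mult_iff[OF k conj_idem[OF e, of s] conj_idem[OF f, of s]] unfolding conj_mult_conj[OF e f] .
    have uniq: "w = w'" if "\<tau> (s\<^sup>\<star> * e * s) = Some w" "\<tau> (s\<^sup>\<star> * f * s) = Some w'" for w w'
      by (rule KS_unique[OF k conj_idem[OF e] conj_idem[OF f] that])
    show "?T (e * f) = Some z \<longleftrightarrow> ?T e = Some z \<and> ?T f = Some z"
      unfolding theta_KS_Some[OF k e] theta_KS_Some[OF k f] theta_KS_Some[OF k idems_mult[OF e f]] mult
      using uniq by blast
    fix z' assume "?T e = Some z" "?T f = Some z'"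
    then obtain w w' where w: "\<tau> (s\<^sup>\<star> * e * s) = Some w" "\<theta> s w = Some z"
      and w': "\<tau> (s\<^sup>\<star> * f * s) = Some w'" "\<theta> s w' = Some z'"
      unfolding theta_KS_Some[OF k e] theta_KS_Some[OF k f] by blast
    show "z = z'" using uniq[OF w(1) w'(1)] w(2) w'(2) by simp
  qed
  then show ?thesis using ne by (simp add: XKS_dom_def)
qed

lemma theta_KS_inverse:
  assumes t: "\<tau> \<in> XKS_dom X \<theta> (s\<^sup>\<star> * s)"
  shows "theta_KS \<theta> (s\<^sup>\<star>) (theta_KS \<theta> s \<tau>) = \<tau>"
proof (rule extensionalityI[where A = idems])
  let ?T = "theta_KS \<theta> s \<tau>"
  note k = KS_dom_D[OF t] and k' = KS_dom_D[OF theta_KS_dom[OF t]]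
  show "theta_KS \<theta> (s\<^sup>\<star>) ?T \<in> extensional idems" by (simp add: theta_KS_def)
  show "\<tau> \<in> extensional idems" by (rule KS_extensional[OF k])
  obtain x0 where x0: "\<tau> (s\<^sup>\<star> * s) = Some x0" using KS_dom_Some[OF t] by blast
  fix e :: 's assume e: "e \<in> idems"
  have conj: "s\<^sup>\<star> * (s * e * s\<^sup>\<star>) * s = ((s\<^sup>\<star> * s) * e) * (s\<^sup>\<star> * s)" by (simp add: mult.assoc)
  have iff: "\<tau> (s\<^sup>\<star> * (s * e * s\<^sup>\<star>) * s) = Some x \<longleftrightarrow> \<tau> e = Some x" for x
    unfolding conj KS_mult_iff[OF k idems_mult[OF star_mult_idem(1) e] star_mult_idem(1)]
      KS_mult_iff[OF k star_mult_idem(1) e]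
    using KS_unique[OF k star_mult_idem(1) e x0] x0 by auto
  show "theta_KS \<theta> (s\<^sup>\<star>) ?T e = \<tau> e"
  proof (rule option_eqI)
    fix x
    have "theta_KS \<theta> (s\<^sup>\<star>) ?T e = Some x \<longleftrightarrow> (\<exists>y. ?T (s * e * s\<^sup>\<star>) = Some y \<and> \<theta> (s\<^sup>\<star>) y = Some x)"
      using theta_KS_Some[OF k' e, of "s\<^sup>\<star>" x] by simp
    also have "\<dots> \<longleftrightarrow> (\<exists>y z. \<tau> e = Some z \<and> \<theta> s z = Some y \<and> \<theta> (s\<^sup>\<star>) y = Some x)"
      unfolding theta_KS_Some[OF k conj_idem'[OF e]] iff by blast
    also have "\<dots> \<longleftrightarrow> \<tau> e = Some x"
    proof
      assume "\<exists>y z. \<tau> e = Some z \<and> \<theta> s z = Some y \<and> \<theta> (s\<^sup>\<star>) y = Some x"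
      then obtain y z where yz: "\<tau> e = Some z" "\<theta> s z = Some y" "\<theta> (s\<^sup>\<star>) y = Some x" by blast
      then show "\<tau> e = Some x" using theta_Some(2)[OF yz(2)] by simp
    next
      assume x: "\<tau> e = Some x"
      then have "x = x0" using KS_unique[OF k star_mult_idem(1) e x0] by simp
      then obtain y where y: "\<theta> s x = Some y" using theta_defined[OF KS_Some[OF k star_mult_idem(1) x0]] by blast
      show "\<exists>y z. \<tau> e = Some z \<and> \<theta> s z = Some y \<and> \<theta> (s\<^sup>\<star>) y = Some x"
        using x y theta_Some(2)[OF y] by blast
    qed
    finally show "theta_KS \<theta> (s\<^sup>\<star>) ?T e = Some x \<longleftrightarrow> \<tau> e = Some x" .
  qed
qed

definition pullback :: "'s \<Rightarrow> (('s \<Rightarrow> 'x option) \<Rightarrow> complex) \<Rightarrow> ('s \<Rightarrow> 'x option) \<Rightarrow> complex" where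
  "pullback s f = zero_off (XKS_dom X \<theta> (s * s\<^sup>\<star>)) (\<lambda>\<tau>. f (theta_KS \<theta> (s\<^sup>\<star>) \<tau>))"

lemma theta_KS_star_dom: "\<tau> \<in> XKS_dom X \<theta> (s * s\<^sup>\<star>) \<Longrightarrow> theta_KS \<theta> (s\<^sup>\<star>) \<tau> \<in> XKS_dom X \<theta> (s\<^sup>\<star> * s)"
  using theta_KS_dom[of \<tau> "s\<^sup>\<star>"] by simp

text \<open>On generators, equivariance is this equation.\<close>

lemma ext_inf_theta_KS:
  assumes t: "\<tau> \<in> topspace KS_space" and e: "e \<in> idems"
  shows "ext_inf g (theta_KS \<theta> (s\<^sup>\<star>) \<tau> e) = ext_inf (alpha \<theta> s g) (\<tau> (s * e * s\<^sup>\<star>))"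
proof (cases "\<tau> (s * e * s\<^sup>\<star>)")
  case None
  then have "theta_KS \<theta> (s\<^sup>\<star>) \<tau> e = None" using e by (simp add: theta_KS_def)
  then show ?thesis using None by simp
next
  case (Some x)
  obtain y where y: "\<theta> (s\<^sup>\<star>) x = Some y"
    using KS_Some[OF t conj_idem'[OF e] Some] fix_dom_conj[OF e, of x "s\<^sup>\<star>"] by auto
  have "theta_KS \<theta> (s\<^sup>\<star>) \<tau> e = Some y" using theta_KS_Some[OF t e, of "s\<^sup>\<star>" y] Some y by simp
  then show ?thesis using Some alpha_Some[OF y] by simp
qed

lemma pullback_delta:
  assumes e: "e \<in> idems" "e \<preceq> s\<^sup>\<star> * s" and g: "g \<in> C0 (sub_space X \<theta> e)"
  shows "pullback s (ev (delta e g)) = ev (delta (s * e * s\<^sup>\<star>) (alpha \<theta> s g))"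
    and "ev (delta (s * e * s\<^sup>\<star>) (alpha \<theta> s g)) \<in> C0 (KS_sub (s * s\<^sup>\<star>))"
proof -
  have d: "delta (s * e * s\<^sup>\<star>) (alpha \<theta> s g) \<in> carr D"
    by (rule delta_D[OF conj_idem'[OF e(1)] alpha_C0[OF e g]])
  show C: "ev (delta (s * e * s\<^sup>\<star>) (alpha \<theta> s g)) \<in> C0 (KS_sub (s * s\<^sup>\<star>))"
  proof (rule ev_C0_KS_sub[OF star_mult_idem(2) d])
    show "supp (delta (s * e * s\<^sup>\<star>) (alpha \<theta> s g)) \<subseteq> below (s * s\<^sup>\<star>)"
      using supp_delta[of "s * e * s\<^sup>\<star>" "alpha \<theta> s g"] conj_idem'[OF e(1), of s] conj_le[OF e(1), of s] by blast
  qed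
  show "pullback s (ev (delta e g)) = ev (delta (s * e * s\<^sup>\<star>) (alpha \<theta> s g))"
  proof
    fix \<tau>
    show "pullback s (ev (delta e g)) \<tau> = ev (delta (s * e * s\<^sup>\<star>) (alpha \<theta> s g)) \<tau>"
    proof (cases "\<tau> \<in> XKS_dom X \<theta> (s * s\<^sup>\<star>)")
      case True
      then show ?thesis
        unfolding pullback_def zero_off_def ev_delta[OF KS_dom_D[OF True]]
          ev_delta[OF KS_dom_D[OF theta_KS_star_dom[OF True]]]
        using ext_inf_theta_KS[OF KS_dom_D[OF True] e(1)] by simp
    next
      case False
      then have "ev (delta (s * e * s\<^sup>\<star>) (alpha \<theta> s g)) \<tau> = 0"
        using C unfolding C0_KS_sub[OF star_mult_idem(2)] by blast
      then show ?thesis using False by (simp add: pullback_def zero_off_def)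
    qed
  qed
qed

text \<open>Composition with the action maps functions of generators to functions of generators, hence functions in
  \<open>C0\<close> of the one domain to \<open>C0\<close> of the other: the generators span a dense subspace, and uniform limits stay
  in \<open>C0\<close>.\<close>

lemma pullback_C0:
  assumes f: "f \<in> C0 (KS_sub (s\<^sup>\<star> * s))"
  shows "pullback s f \<in> C0 (KS_sub (s * s\<^sup>\<star>))"
proof (rule C0_uniform_limit[OF LCH_KS_sub(2)[OF star_mult_idem(2)]])
  fix r :: real assume r: "r > 0"
  let ?e = "s\<^sup>\<star> * s"
  have e: "?e \<in> idems" by simp
  obtain a where a: "a \<in> carr D" "supp a \<subseteq> below ?e" "\<And>\<tau>. cmod (f \<tau> - ev a \<tau>) < r"
    by (rule dense_ideal[OF below_ideal(1,2)[OF e] KS_dom_eq[OF e] f r]) (assumption, assumption, rule that)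
  have below: "d \<in> idems" "d \<preceq> ?e" "a d \<in> C0 (sub_space X \<theta> d)" if "d \<in> supp a" for d
    using a(2) that D_C0[OF a(1)] by blast+
  have "pullback s (ev a) = (\<lambda>\<tau>. \<Sum>d\<in>supp a. pullback s (ev (delta d (a d))) \<tau>)"
  proof
    fix \<tau>
    show "pullback s (ev a) \<tau> = (\<Sum>d\<in>supp a. pullback s (ev (delta d (a d))) \<tau>)"
    proof (cases "\<tau> \<in> XKS_dom X \<theta> (s * s\<^sup>\<star>)")
      case True
      note k = KS_dom_D[OF theta_KS_star_dom[OF True]]
      show ?thesis
        unfolding pullback_def zero_off_def ev_delta[OF k] ev_eq_sum[OF D_finite[OF a(1)] order_refl k]
        using True by (simp only: if_True)
    qed (simp add: pullback_def zero_off_def)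
  qed
  moreover have "(\<lambda>\<tau>. \<Sum>d\<in>supp a. pullback s (ev (delta d (a d))) \<tau>) \<in> C0 (KS_sub (s * s\<^sup>\<star>))"
  proof (rule C0_sum)
    fix d assume "d \<in> supp a"
    note b = below[OF this]
    show "pullback s (ev (delta d (a d))) \<in> C0 (KS_sub (s * s\<^sup>\<star>))"
      unfolding pullback_delta(1)[OF b] by (rule pullback_delta(2)[OF b])
  qed
  ultimately have "pullback s (ev a) \<in> C0 (KS_sub (s * s\<^sup>\<star>))" by simp
  moreover have "cmod (pullback s f \<tau> - pullback s (ev a) \<tau>) < r" for \<tau>
    using a(3)[of "theta_KS \<theta> (s\<^sup>\<star>) \<tau>"] r by (simp add: pullback_def zero_off_def)
  ultimately show "\<exists>g\<in>C0 (KS_sub (s * s\<^sup>\<star>)). \<forall>\<tau>. cmod (pullback s f \<tau> - g \<tau>) < r" by blast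
qed

lemma pullback_inverse:
  assumes f: "f \<in> C0 (KS_sub (s\<^sup>\<star> * s))"
  shows "pullback (s\<^sup>\<star>) (pullback s f) = f"
proof
  fix \<tau>
  show "pullback (s\<^sup>\<star>) (pullback s f) \<tau> = f \<tau>"
  proof (cases "\<tau> \<in> XKS_dom X \<theta> (s\<^sup>\<star> * s)")
    case True
    then show ?thesis
      using theta_KS_inverse[OF True] theta_KS_dom[OF True] by (simp add: pullback_def zero_off_def)
  next
    case False
    then have "f \<tau> = 0" using f unfolding C0_KS_sub[OF star_mult_idem(1)] by blast
    then show ?thesis using False by (simp add: pullback_def zero_off_def)
  qed
qed

lemma star_iso_pullback:
  "star_iso (C0_alg (KS_sub (s\<^sup>\<star> * s))) (C0_alg (KS_sub (s * s\<^sup>\<star>))) (pullback s)"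
  unfolding star_iso_def
proof
  show "star_hom (C0_alg (KS_sub (s\<^sup>\<star> * s))) (C0_alg (KS_sub (s * s\<^sup>\<star>))) (pullback s)"
    unfolding star_hom_def C0_alg_simps
    by (intro conjI ballI allI pullback_C0) (simp_all add: pullback_def zero_off_def fun_eq_iff)
  show "bij_betw (pullback s) (carr (C0_alg (KS_sub (s\<^sup>\<star> * s)))) (carr (C0_alg (KS_sub (s * s\<^sup>\<star>))))"
    unfolding C0_alg_simps
  proof (rule bij_betw_byWitness[where f' = "pullback (s\<^sup>\<star>)"])
    show "\<forall>f\<in>C0 (KS_sub (s\<^sup>\<star> * s)). pullback (s\<^sup>\<star>) (pullback s f) = f" using pullback_inverse by blast
    show "\<forall>f\<in>C0 (KS_sub (s * s\<^sup>\<star>)). pullback s (pullback (s\<^sup>\<star>) f) = f"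
      using pullback_inverse[of _ "s\<^sup>\<star>"] by simp
    show "pullback s ` C0 (KS_sub (s\<^sup>\<star> * s)) \<subseteq> C0 (KS_sub (s * s\<^sup>\<star>))" using pullback_C0 by blast
    show "pullback (s\<^sup>\<star>) ` C0 (KS_sub (s * s\<^sup>\<star>)) \<subseteq> C0 (KS_sub (s\<^sup>\<star> * s))"
      using pullback_C0[of _ "s\<^sup>\<star>"] by auto
  qed
qed

text \<open>The map \<open>alpha_KS\<close>, obtained by transporting composition with the action to the ideals.\<close>

definition alpha_lift :: "'s \<Rightarrow> ('s, 'x) KS \<Rightarrow> ('s, 'x) KS" where
  "alpha_lift s = (\<lambda>P\<in>carr (J (s\<^sup>\<star> * s)). inv_into (carr (J (s * s\<^sup>\<star>))) gelf (pullback s (gelf P)))"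

lemma star_iso_alpha_lift: "star_iso (J (s\<^sup>\<star> * s)) (J (s * s\<^sup>\<star>)) (alpha_lift s)"
  unfolding alpha_lift_def
  by (rule star_iso_restrict[OF star_iso_compose[OF
        star_iso_compose[OF star_iso_gelf_J[OF star_mult_idem(1)] star_iso_pullback]
        star_iso_inverse[OF star_iso_gelf_J[OF star_mult_idem(2)] closed_under_ops_J[OF star_mult_idem(2)]]]
        closed_under_ops_J[OF star_mult_idem(1)]])

lemma alpha_lift:
  assumes P: "P \<in> carr (J (s\<^sup>\<star> * s))"
  shows "alpha_lift s P \<in> carr (J (s * s\<^sup>\<star>))" "gelf (alpha_lift s P) = pullback s (gelf P)"
proof -
  show "alpha_lift s P \<in> carr (J (s * s\<^sup>\<star>))"
    using star_iso_hom[OF star_iso_alpha_lift] P by (simp add: star_hom_def)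
  have "pullback s (gelf P) \<in> gelf ` carr (J (s * s\<^sup>\<star>))"
    using pullback_C0[OF J_D(2)[OF star_mult_idem(1) P]] star_iso_bij[OF star_iso_gelf_J[OF star_mult_idem(2)]]
    by (simp add: bij_betw_def)
  then show "gelf (alpha_lift s P) = pullback s (gelf P)"
    using P by (simp add: alpha_lift_def f_inv_into_f)
qed

lemma alpha_lift_delta_KS:
  assumes e: "e \<in> idems" "e \<preceq> s\<^sup>\<star> * s" and g: "g \<in> C0 (sub_space X \<theta> e)"
  shows "alpha_lift s (delta_KS X \<theta> e g) = delta_KS X \<theta> (s * e * s\<^sup>\<star>) (alpha \<theta> s g)"
proof (rule gelf_inj)
  note P = gens_J[OF star_mult_idem(1) e g]
  note d = delta_KS_A[OF conj_idem'[OF e(1)] alpha_C0[OF e g]]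
  show "alpha_lift s (delta_KS X \<theta> e g) \<in> carr A" by (rule J_D(1)[OF star_mult_idem(2) alpha_lift(1)[OF P]])
  show "delta_KS X \<theta> (s * e * s\<^sup>\<star>) (alpha \<theta> s g) \<in> carr A" by (rule d)
  show "gelf (alpha_lift s (delta_KS X \<theta> e g)) = gelf (delta_KS X \<theta> (s * e * s\<^sup>\<star>) (alpha \<theta> s g))"
    unfolding alpha_lift(2)[OF P] d(2) delta_KS_A(2)[OF e(1) g] by (rule pullback_delta(1)[OF e g])
qed

lemma alpha_KS_eq: "alpha_KS X \<theta> s = alpha_lift s"
  unfolding alpha_KS_def
proof (rule the_equality)
  note e = star_mult_idem(1)[of s] and e' = star_mult_idem(2)[of s]
  show "alpha_lift s \<in> extensional (carr (J (s\<^sup>\<star> * s))) \<and>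
     star_iso (J (s\<^sup>\<star> * s)) (J (s * s\<^sup>\<star>)) (alpha_lift s) \<and>
     (\<forall>e0\<in>idems. e0 \<preceq> s\<^sup>\<star> * s \<longrightarrow> (\<forall>g\<in>C0 (sub_space X \<theta> e0).
        alpha_lift s (delta_KS X \<theta> e0 g) = delta_KS X \<theta> (s * e0 * s\<^sup>\<star>) (alpha \<theta> s g)))"
    using star_iso_alpha_lift alpha_lift_delta_KS
    by (intro conjI ballI impI) (simp_all add: alpha_lift_def)
  fix \<alpha> assume \<alpha>: "\<alpha> \<in> extensional (carr (J (s\<^sup>\<star> * s))) \<and>
     star_iso (J (s\<^sup>\<star> * s)) (J (s * s\<^sup>\<star>)) \<alpha> \<and>
     (\<forall>e0\<in>idems. e0 \<preceq> s\<^sup>\<star> * s \<longrightarrow> (\<forall>g\<in>C0 (sub_space X \<theta> e0).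
        \<alpha> (delta_KS X \<theta> e0 g) = delta_KS X \<theta> (s * e0 * s\<^sup>\<star>) (alpha \<theta> s g)))"
  then have ex: "\<alpha> \<in> extensional (carr (J (s\<^sup>\<star> * s)))" and hom: "star_hom (J (s\<^sup>\<star> * s)) (J (s * s\<^sup>\<star>)) \<alpha>"
    and gen: "\<And>f g. f \<in> idems \<Longrightarrow> f \<preceq> s\<^sup>\<star> * s \<Longrightarrow> g \<in> C0 (sub_space X \<theta> f) \<Longrightarrow>
        \<alpha> (delta_KS X \<theta> f g) = delta_KS X \<theta> (s * f * s\<^sup>\<star>) (alpha \<theta> s g)"
    using star_iso_hom by blast+
  have ex': "alpha_lift s \<in> extensional (carr (J (s\<^sup>\<star> * s)))" by (simp add: alpha_lift_def)
  show "\<alpha> = alpha_lift s"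
  proof (rule extensionalityI[OF ex ex'])
    fix P assume P: "P \<in> carr (J (s\<^sup>\<star> * s))"
    have aP: "\<alpha> P \<in> carr (J (s * s\<^sup>\<star>))" using hom P by (simp add: star_hom_def)
    have "gelf (\<alpha> P) \<tau> = gelf (alpha_lift s P) \<tau>" for \<tau>
    proof (rule J_hom_unique[OF e _ _ _ P])
      show "star_hom (J (s\<^sup>\<star> * s)) complex_alg (\<lambda>P. gelf (\<alpha> P) \<tau>)"
        by (rule star_hom_compose[OF hom star_hom_compose[OF star_hom_gelf_J[OF e'] star_hom_evaluation]])
      show "star_hom (J (s\<^sup>\<star> * s)) complex_alg (\<lambda>P. gelf (alpha_lift s P) \<tau>)"
        by (rule star_hom_compose[OF star_iso_hom[OF star_iso_alpha_lift]
              star_hom_compose[OF star_hom_gelf_J[OF e'] star_hom_evaluation]])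
      show "gelf (\<alpha> (delta_KS X \<theta> f g)) \<tau> = gelf (alpha_lift s (delta_KS X \<theta> f g)) \<tau>"
        if "f \<in> idems" "f \<preceq> s\<^sup>\<star> * s" "g \<in> C0 (sub_space X \<theta> f)" for f g
        unfolding gen[OF that] alpha_lift_delta_KS[OF that] ..
    qed
    then have "gelf (\<alpha> P) = gelf (alpha_lift s P)" by (rule ext)
    then show "\<alpha> P = alpha_lift s P"
      by (rule gelf_inj[OF J_D(1)[OF e' aP] J_D(1)[OF e' alpha_lift(1)[OF P]]])
  qed
qed

lemma Phi_alpha_KS:
  assumes P: "P \<in> carr (J (s\<^sup>\<star> * s))"
  shows "Phi X \<theta> (s * s\<^sup>\<star>) (alpha_KS X \<theta> s P) = pullback s (Phi X \<theta> (s\<^sup>\<star> * s) P)"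
    and "pullback s (Phi X \<theta> (s\<^sup>\<star> * s) P) \<in> C0 (KS_sub (s * s\<^sup>\<star>))"
  unfolding Phi_eq[OF star_mult_idem(1)] Phi_eq[OF star_mult_idem(2)] alpha_KS_eq
  using P alpha_lift[OF P] pullback_C0[OF J_D(2)[OF star_mult_idem(1) P]] by simp_all

end

theorem proposition4p1p2:
  fixes X :: "'x topology" and \<theta> :: "'s::inverse_semigroup \<Rightarrow> 'x \<rightharpoonup> 'x"
  assumes "locally_compact_space X" and "Hausdorff_space X"
    and "semigroup_action X \<theta>"
  shows
    "homeomorphic_maps (Sp (C0_KS X \<theta>)) (XKS X \<theta>) (tau_of X \<theta>) (chi_of X \<theta>) \<and>
     (\<forall>e\<in>idems.
        homeomorphic_map (subtopology (Sp (C0_KS X \<theta>)) (Sp_dom X \<theta> e)) (Sp (C0_KS_ideal X \<theta> e))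
          (\<lambda>\<xi>. restrict \<xi> (carr (C0_KS_ideal X \<theta> e))) \<and>
        homeomorphic_maps (subtopology (Sp (C0_KS X \<theta>)) (Sp_dom X \<theta> e))
          (subtopology (XKS X \<theta>) (XKS_dom X \<theta> e)) (tau_of X \<theta>) (chi_of X \<theta>)) \<and>
     (\<forall>e\<in>idems.
        star_iso (C0_KS_ideal X \<theta> e) (C0_alg (subtopology (XKS X \<theta>) (XKS_dom X \<theta> e))) (Phi X \<theta> e) \<and>
        (\<forall>e0\<in>idems. e0 \<preceq> e \<longrightarrow> (\<forall>g\<in>C0 (sub_space X \<theta> e0). \<forall>\<tau>\<in>XKS_dom X \<theta> e.
           Phi X \<theta> e (delta_KS X \<theta> e0 g) \<tau> = chi_of X \<theta> \<tau> (delta_KS X \<theta> e0 g) \<and>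
           chi_of X \<theta> \<tau> (delta_KS X \<theta> e0 g) = ext_inf g (\<tau> e0)))) \<and>
     (\<forall>s. \<forall>a\<in>carr (C0_KS_ideal X \<theta> (s\<^sup>\<star> * s)).
        Phi X \<theta> (s * s\<^sup>\<star>) (alpha_KS X \<theta> s a) =
          zero_off (XKS_dom X \<theta> (s * s\<^sup>\<star>)) (\<lambda>\<tau>. Phi X \<theta> (s\<^sup>\<star> * s) a (theta_KS \<theta> (s\<^sup>\<star>) \<tau>)) \<and>
        zero_off (XKS_dom X \<theta> (s * s\<^sup>\<star>)) (\<lambda>\<tau>. Phi X \<theta> (s\<^sup>\<star> * s) a (theta_KS \<theta> (s\<^sup>\<star>) \<tau>))
          \<in> C0 (subtopology (XKS X \<theta>) (XKS_dom X \<theta> (s * s\<^sup>\<star>))))"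
proof -
  interpret LCH_action X \<theta> by (rule LCH_action.intro[OF assms])
  show ?thesis
  proof (intro conjI ballI allI impI)
    show "homeomorphic_maps (Sp (C0_KS X \<theta>)) (XKS X \<theta>) (tau_of X \<theta>) (chi_of X \<theta>)"
      by (rule homeomorphic_maps_tau_chi)
  next
    fix e :: 's assume e: "e \<in> idems"
    show "homeomorphic_map (subtopology (Sp (C0_KS X \<theta>)) (Sp_dom X \<theta> e)) (Sp (C0_KS_ideal X \<theta> e))
        (\<lambda>\<xi>. restrict \<xi> (carr (C0_KS_ideal X \<theta> e)))"
      by (rule homeomorphic_map_restrict_character[OF e])
    show "homeomorphic_maps (subtopology (Sp (C0_KS X \<theta>)) (Sp_dom X \<theta> e))
        (subtopology (XKS X \<theta>) (XKS_dom X \<theta> e)) (tau_of X \<theta>) (chi_of X \<theta>)"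
      by (rule homeomorphic_maps_tau_chi_dom[OF e])
    show "star_iso (C0_KS_ideal X \<theta> e) (C0_alg (subtopology (XKS X \<theta>) (XKS_dom X \<theta> e))) (Phi X \<theta> e)"
      unfolding Phi_eq[OF e] by (rule star_iso_restrict[OF star_iso_gelf_J[OF e] closed_under_ops_J[OF e]])
    fix f g \<tau> assume f: "f \<in> idems" "f \<preceq> e" and g: "g \<in> C0 (sub_space X \<theta> f)" and \<tau>: "\<tau> \<in> XKS_dom X \<theta> e"
    show chi: "chi_of X \<theta> \<tau> (delta_KS X \<theta> f g) = ext_inf g (\<tau> f)"
      unfolding chi_of_eq[OF KS_dom_D[OF \<tau>]] by (rule point_char_delta[OF f(1) g KS_dom_D[OF \<tau>]])
    show "Phi X \<theta> e (delta_KS X \<theta> f g) \<tau> = chi_of X \<theta> \<tau> (delta_KS X \<theta> f g)"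
      unfolding chi Phi_eq[OF e] restrict_apply'[OF gens_J[OF e f g]] by (rule gelf_delta_KS[OF f(1) g KS_dom_D[OF \<tau>]])
  next
    fix s a assume a: "a \<in> carr (C0_KS_ideal X \<theta> (s\<^sup>\<star> * s))"
    show "Phi X \<theta> (s * s\<^sup>\<star>) (alpha_KS X \<theta> s a) =
        zero_off (XKS_dom X \<theta> (s * s\<^sup>\<star>)) (\<lambda>\<tau>. Phi X \<theta> (s\<^sup>\<star> * s) a (theta_KS \<theta> (s\<^sup>\<star>) \<tau>))"
      using Phi_alpha_KS(1)[OF a] unfolding pullback_def .
    show "zero_off (XKS_dom X \<theta> (s * s\<^sup>\<star>)) (\<lambda>\<tau>. Phi X \<theta> (s\<^sup>\<star> * s) a (theta_KS \<theta> (s\<^sup>\<star>) \<tau>))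
        \<in> C0 (subtopology (XKS X \<theta>) (XKS_dom X \<theta> (s * s\<^sup>\<star>)))"
      using Phi_alpha_KS(2)[OF a] unfolding pullback_def .
  qed
qed

end
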